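(* Assume that the zero solution of the delay equation $$\begin{pmatrix}u\\ v\end{pmatrix}'(t)=f\big(u_t(0),v_t(0)\big)+g\big(u_t(0),v_t(0)\big)\,h\!\left(\int_{-t}^{0}\frac{1}{|u_t(s)|^{\kappa}}\,ds\right)\qquad(\ast)$$ is hyperbolic (i.e. $Df(0,0)$ has no eigenvalue on the imaginary axis) and that the unstable eigenspace $\tilde E^{u}\subset\mathbb{R}^2$ of $Df(0,0)$ is given by $\{u=0\}$. Let $\sigma_0>0$. Then there are $r,\delta>0$ such that the set $$W^{s}_{\mathrm{loc}}:=\Big\{(\phi,\sigma)\in\mathcal{B}\times[\sigma_0,\infty)\;:\;\|\Pi^{s}\phi\|_{\mathcal{B}}<r,\ \ \|\mu_t(\phi,\sigma)\|_{\mathcal{B}}<\delta\ \text{ for all } t\in[\sigma,\infty)\Big\}$$ is a manifold, given locally as the graph of a function $w\colon B_{E^{s}}(r)\times[\sigma_0,\infty)\to E^{u}$ (i.e. as a set of points $(\psi+w(\psi,\sigma),\sigma)$), with the following properties: (i) $w$ is Lipschitz continuous in its first argument and continuous in its second argument; (ii) $w(\cdot,\sigma)$ is differentiable at $0$, and $W^{s}_{\mathrm{loc}}$ is tangent to $E^{s}$ (i.e. for every $\sigma\ge\sigma_0$ the derivative of $w(\cdot,\sigma)$ at $0\in E^{s}$ vanishes); (iii) for every $\beta\in(0,\alpha)$ there is a constant $N$ such that $$\|\mu_t(\phi,\sigma)\|_{\mathcal{B}}\le N e^{-\beta(t-\sigma)}\|\phi\|_{\mathcal{B}}\qquad\text{for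 all }(\phi,\sigma)\in W^{s}_{\mathrm{loc}},\ t\in[\sigma,\infty);$$ (iv) $W^{s}_{\mathrm{loc}}$ is locally positively invariant, i.e. for every $(\phi,\sigma)\in W^{s}_{\mathrm{loc}}$ the solution $\mu_t(\phi,\sigma)$ lies in $W^{s}_{\mathrm{loc}}$ (that is, $(\mu_t(\phi,\sigma),t)\in W^{s}_{\mathrm{loc}}$) for every $t\ge\sigma$ as long as $\Pi^{s}\mu_t(\phi,\sigma)\in B_{E^{s}}(r)$.
   Context: Original equation. Consider the planar equation $\frac{d}{d\tau}(x,y)^\top=F(x,y)+G(x,y)h(\tau)$ with sufficiently smooth $F,G\colon\mathbb{R}^2\to\mathbb{R}^2$, $F(0,0)=G(0,0)=(0,0)$, where $DF(0,0)$ has at least one eigenvalue on the imaginary axis, and $h\in C^1(\mathbb{R};\mathbb{R})$ converges to $0$ as $\tau\to\pm\infty$ and satisfies $|h(\tau)|\le He^{-\eta\tau}$ and $|h'(\tau)|\le He^{-\eta\tau}$ for all $\tau\in\mathbb{R}$, with positive constants $H,\eta$. Blow-up and desingularization. The directional blow-up $(x,y)=(u,uv)$ transforms it into $(u,v)'=\tilde f(u,v)+\tilde g(u,v)h(\tau)$. For a fixed $\kappa\in\mathbb{N}$, $\kappa\geq 1$ (the degree of desingularization), set $f=|u|^{-\kappa}\tilde f$, $g=|u|^{-\kappa}\tilde g$; the half planes $\{u>0\}$ and $\{u<0\}$ are invariant, and $f,g$ are assumed to extend sufficiently smoothly (in particular $C^1$) to $\{u=0\}$. After the trajectory-wise time change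 $\tau=\int_0^t|u(s)|^{-\kappa}ds$ one obtains $(u,v)'=f(u,v)+g(u,v)\,h\big(\int_0^t|u(s)|^{-\kappa}ds\big)$ for $t\ge0$, which is $(\ast)$ in terms of segments $(u_t,v_t)(\theta)=(u,v)(t+\theta)$, $\theta\in\mathbb{R}^-=(-\infty,0]$. If $u_t$ has a zero in $[-t,0]$, the right-hand side of $(\ast)$ is understood to be $f(u_t(0),v_t(0))$. It is assumed that $f(0,0)=0$. Phase space. For a fixed $\lambda>0$ let $\tilde{\mathcal{B}}=\{\phi\in C(\mathbb{R}^-,\mathbb{R}^2):\sup_{\theta\le0}e^{\lambda\theta}\|\phi(\theta)\|<\infty\}$ with norm $\|\phi\|_{\mathcal{B}}=\sup_{\theta\le 0}e^{\lambda\theta}\|\phi(\theta)\|$, and let $\mathcal{B}\subset\tilde{\mathcal{B}}$ consist of those $\phi\in\tilde{\mathcal B}$ that satisfy $\|\phi(s)-\phi(t)\|\le M|s-t|$ for all $s,t\in\mathbb{R}^-$. Here $M>0$ is the supremum of the norm of the right-hand side of $(\ast)$ on a bounded domain $D$ around $0$, which is chosen so small that $M<\eta$; outside this domain the right-hand side of $(\ast)$ is assumed to be suitably modified by a cut-off function. Linear semigroup and splitting. For $t\ge0$ let $[V(t)\phi](\theta)=\phi(t+\theta)$ if $\theta<-t$ and $[V(t)\phi](\theta)=e^{(t+\theta)Df(0,0)}\phi(0)$ if $\theta\in[-t,0]$. With $\mathbb{R}^2=\tilde E^{s}\oplus\tilde E^{u}$ the splitting into stable and unstable eigenspaces of $Df(0,0)$,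 set $E^{s}=\{\phi\in\mathcal{B}:\phi(0)\in\tilde E^{s}\}$ and $E^{u}=\{\phi\in\mathcal{B}:\phi(0)\in\tilde E^{u},\ \phi(t)=e^{tDf(0,0)}\phi(0)\ \forall t\in\mathbb{R}^-\}$. The phase space is split as $\mathcal{B}=E^{s}\oplus E^{u}$ with corresponding projections $\Pi^{s},\Pi^{u}$, so that $(\Pi^{u}\phi)(\theta)=e^{\theta Df(0,0)}P^{u}\phi(0)$, where $P^u$ is the projection of $\mathbb{R}^2$ onto $\tilde E^{u}$ along $\tilde E^{s}$, and $\Pi^{s}=\mathrm{Id}-\Pi^{u}$. On $E^{u}$ the operators $V(t)$ extend to a group, $t\in\mathbb{R}$. The constants $C,\alpha>0$ are such that $\|V(t)|_{E^{s}}\|\le Ce^{-\alpha t}$ for $t\ge0$ and $\|V(t)|_{E^{u}}\|\le Ce^{\alpha t}$ for $t\le0$ ($\lambda$ being chosen appropriately). $B_{A}(r)$ denotes the closed ball of radius $r$ centered at the origin in $A$. Solutions. $\mu_t(\phi,\sigma)$ denotes the segment at time $t\ge\sigma$ of the solution of $(\ast)$ with initial data $(\phi,\sigma)\in\mathcal{B}\times\mathbb{R}$, i.e. with $\mu_\sigma(\phi,\sigma)=\phi$.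
   Formalization: Since B (fixed Lipschitz constant M) is not closed under addition, w is defined on the closed r-ball of E^s together with Π^s(B), and W^s_loc equals the part of the graph over ‖ψ‖<r that lies in B×[σ_0,∞). *)

theory Defs
  imports "HOL-Analysis.Analysis"
begin

text \<open>
  Points of the plane are vectors in \<^typ>\<open>real^2\<close>, with \<open>u = x $ 1\<close> and \<open>v = x $ 2\<close>.
\<close>

section \<open>Planar vector fields and the directional blow-up\<close>

definition C1_map :: "(real^2 \<Rightarrow> real^2) \<Rightarrow> bool" where
  "C1_map F \<longleftrightarrow> (\<exists>F'. (\<forall>x. (F has_derivative blinfun_apply (F' x)) (at x)) \<and> continuous_on UNIV F')"

text \<open>
  The field that \<open>F\<close> induces through \<open>(x, y) = (u, u v)\<close>: \<open>u' = x'\<close> and \<open>v' = (y' - v x') / u\<close>.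
  It is meaningful for \<open>u \<noteq> 0\<close> only.
\<close>
definition blow_up :: "(real^2 \<Rightarrow> real^2) \<Rightarrow> real^2 \<Rightarrow> real^2" where
  "blow_up F p = (let q = F (vector [p $ 1, p $ 1 * p $ 2])
                  in vector [q $ 1, (q $ 2 - p $ 2 * q $ 1) / p $ 1])"

text \<open>
  \<open>f\<close> is a \<open>C\<^sup>1\<close> extension to \<open>{u = 0}\<close> of the field obtained from \<open>F\<close> by blow-up and
  desingularization of degree \<open>\<kappa>\<close>.
\<close>
definition desingularization ::
    "nat \<Rightarrow> (real^2 \<Rightarrow> real^2) \<Rightarrow> (real^2 \<Rightarrow> real^2) \<Rightarrow> bool" where
  "desingularization \<kappa> F f \<longleftrightarrow>
     C1_map f \<and> (\<forall>p. p $ 1 \<noteq> 0 \<longrightarrow> f p = (1 / \<bar>p $ 1\<bar> ^ \<kappa>) *\<^sub>R blow_up F p)"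

section \<open>Spectral notions for real matrices\<close>

definition cmat :: "real^2^2 \<Rightarrow> complex^2^2" where
  "cmat A = (\<chi> i j. complex_of_real (A $ i $ j))"

definition cvec :: "real^2 \<Rightarrow> complex^2" where
  "cvec x = (\<chi> i. complex_of_real (x $ i))"

definition eigenvalue_of :: "real^2^2 \<Rightarrow> complex \<Rightarrow> bool" where
  "eigenvalue_of A z \<longleftrightarrow> (\<exists>x. x \<noteq> 0 \<and> cmat A *v x = z *s x)"

definition gen_eigenspace :: "real^2^2 \<Rightarrow> complex \<Rightarrow> (complex^2) set" where
  "gen_eigenspace A z = {x. \<exists>k. ((\<lambda>y. cmat A *v y - z *s y) ^^ k) x = 0}"

definition stable_space :: "real^2^2 \<Rightarrow> (real^2) set" where
  "stable_space A = {x. cvec x \<in> vec.span (\<Union>z\<in>{z. Re z < 0}. gen_eigenspace A z)}"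

definition unstable_space :: "real^2^2 \<Rightarrow> (real^2) set" where
  "unstable_space A = {x. cvec x \<in> vec.span (\<Union>z\<in>{z. Re z > 0}. gen_eigenspace A z)}"

text \<open>Projection onto the unstable along the stable space.\<close>
definition P_u :: "real^2^2 \<Rightarrow> real^2 \<Rightarrow> real^2" where
  "P_u A x = (THE y. y \<in> unstable_space A \<and> x - y \<in> stable_space A)"

text \<open>The vector \<open>e\<^bsup>t A\<^esup> x\<close>.\<close>
definition exp_mat :: "real^2^2 \<Rightarrow> real \<Rightarrow> real^2 \<Rightarrow> real^2" where
  "exp_mat A t x = (\<Sum>n. (t ^ n / fact n) *\<^sub>R (((*v) A) ^^ n) x)"

section \<open>Phase space\<close>

text \<open>
  A function on \<open>(-\<infinity>, 0]\<close> is represented by its extension to the whole line by \<open>0\<close>, so that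
  equality of representatives is equality on \<open>(-\<infinity>, 0]\<close>.
\<close>
type_synonym segment = "real \<Rightarrow> real^2"

definition Btilde :: "real \<Rightarrow> segment set" where
  "Btilde lam = {\<phi>. continuous_on {..0} \<phi> \<and> bdd_above ((\<lambda>\<theta>. exp (lam * \<theta>) * norm (\<phi> \<theta>)) ` {..0})
                \<and> (\<forall>\<theta>>0. \<phi> \<theta> = 0)}"

definition Bnorm :: "real \<Rightarrow> segment \<Rightarrow> real" where
  "Bnorm lam \<phi> = (SUP \<theta>\<in>{..0}. exp (lam * \<theta>) * norm (\<phi> \<theta>))"

definition Bspace :: "real \<Rightarrow> real \<Rightarrow> segment set" where
  "Bspace lam M = {\<phi> \<in> Btilde lam. \<forall>s\<le>0. \<forall>t\<le>0. norm (\<phi> s - \<phi> t) \<le> M * \<bar>s - t\<bar>}"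

definition seg :: "(real \<Rightarrow> real^2) \<Rightarrow> real \<Rightarrow> segment" where
  "seg x t = (\<lambda>\<theta>. if \<theta> \<le> 0 then x (t + \<theta>) else 0)"

definition seg_add :: "segment \<Rightarrow> segment \<Rightarrow> segment" where
  "seg_add \<phi> \<psi> = (\<lambda>\<theta>. \<phi> \<theta> + \<psi> \<theta>)"

definition seg_diff :: "segment \<Rightarrow> segment \<Rightarrow> segment" where
  "seg_diff \<phi> \<psi> = (\<lambda>\<theta>. \<phi> \<theta> - \<psi> \<theta>)"

definition Es :: "real \<Rightarrow> real \<Rightarrow> real^2^2 \<Rightarrow> segment set" where
  "Es lam M A = {\<phi> \<in> Bspace lam M. \<phi> 0 \<in> stable_space A}"

definition Eu :: "real \<Rightarrow> real \<Rightarrow> real^2^2 \<Rightarrow> segment set" where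
  "Eu lam M A = {\<phi> \<in> Bspace lam M. \<phi> 0 \<in> unstable_space A \<and> (\<forall>\<theta>\<le>0. \<phi> \<theta> = exp_mat A \<theta> (\<phi> 0))}"

definition Pi_u :: "real^2^2 \<Rightarrow> segment \<Rightarrow> segment" where
  "Pi_u A \<phi> = (\<lambda>\<theta>. if \<theta> \<le> 0 then exp_mat A \<theta> (P_u A (\<phi> 0)) else 0)"

definition Pi_s :: "real^2^2 \<Rightarrow> segment \<Rightarrow> segment" where
  "Pi_s A \<phi> = seg_diff \<phi> (Pi_u A \<phi>)"

text \<open>
  Because of the Lipschitz condition with the fixed constant \<open>M\<close>, the phase space is not closed
  under addition: \<open>Pi_s A \<phi>\<close> may have a Lipschitz constant larger than \<open>M\<close>, and so need
  not lie in \<^const>\<open>Es\<close>. The stable components of elements of the phase space form the set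
  \<open>Pi_s A ` Bspace lam M\<close>, and the closed ball below, the domain of the graph, includes them.
\<close>
definition Es_ball :: "real \<Rightarrow> real \<Rightarrow> real^2^2 \<Rightarrow> real \<Rightarrow> segment set" where
  "Es_ball lam M A r = {\<psi> \<in> Es lam M A \<union> Pi_s A ` Bspace lam M. Bnorm lam \<psi> \<le> r}"

text \<open>
  The linear semigroup. For \<open>t < 0\<close> and \<open>\<phi>\<close> in \<^const>\<open>Eu\<close> only the first case occurs for
  \<open>\<theta> \<le> 0\<close>, and it gives \<open>e\<^bsup>(t + \<theta>) A\<^esup> \<phi>(0)\<close>, so the same formula is the group on \<^const>\<open>Eu\<close>.
\<close>
definition V :: "real^2^2 \<Rightarrow> real \<Rightarrow> segment \<Rightarrow> segment" where
  "V A t \<phi> = (\<lambda>\<theta>. if \<theta> > 0 then 0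
                   else if \<theta> < - t then \<phi> (t + \<theta>)
                   else exp_mat A (t + \<theta>) (\<phi> 0))"

section \<open>The delay equation\<close>

definition delay_rhs ::
    "(real^2 \<Rightarrow> real^2) \<Rightarrow> (real^2 \<Rightarrow> real^2) \<Rightarrow> (real \<Rightarrow> real) \<Rightarrow> nat \<Rightarrow> real \<Rightarrow> segment \<Rightarrow> real^2" where
  "delay_rhs f g h \<kappa> t \<phi> =
     (if \<exists>s\<in>{-t..0}. \<phi> s $ 1 = 0 then f (\<phi> 0)
      else f (\<phi> 0) + h (integral {-t..0} (\<lambda>s. 1 / \<bar>\<phi> s $ 1\<bar> ^ \<kappa>)) *\<^sub>R g (\<phi> 0))"

text \<open>
  \<open>M\<close> is the supremum of the right-hand side over the bounded domain \<open>D\<close> around the origin, and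
  \<open>c\<close> is a cut-off function that modifies the right-hand side outside \<open>D\<close> such that the bound \<open>M\<close>
  holds globally; the latter makes the phase space invariant. A Lipschitz cut-off is
  asked for, not a smooth one: if the supremum is attained on the boundary of \<open>D\<close>, a function that
  is \<open>C\<^sup>1\<close> and equal to \<open>1\<close> on \<open>D\<close> need not preserve the bound.
\<close>
definition cut_off ::
    "(real^2 \<Rightarrow> real^2) \<Rightarrow> (real^2 \<Rightarrow> real^2) \<Rightarrow> (real \<Rightarrow> real) \<Rightarrow> nat \<Rightarrow> real
     \<Rightarrow> (real^2) set \<Rightarrow> (real^2 \<Rightarrow> real) \<Rightarrow> real \<Rightarrow> bool" where
  "cut_off f g h \<kappa> lam D c M \<longleftrightarrow>
     open D \<and> connected D \<and> bounded D \<and> 0 \<in> D \<and>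
     M = Sup {norm (delay_rhs f g h \<kappa> t \<phi>) | t \<phi>. 0 \<le> t \<and> \<phi> \<in> Btilde lam \<and> \<phi> 0 \<in> D} \<and>
     (\<exists>L. L-lipschitz_on UNIV c) \<and> (\<forall>x. 0 \<le> c x \<and> c x \<le> 1) \<and> (\<forall>x\<in>D. c x = 1) \<and>
     (\<forall>t\<ge>0. \<forall>\<phi>\<in>Btilde lam. norm (c (\<phi> 0) *\<^sub>R delay_rhs f g h \<kappa> t \<phi>) \<le> M)"

definition is_solution ::
    "(real^2 \<Rightarrow> real^2) \<Rightarrow> (real^2 \<Rightarrow> real^2) \<Rightarrow> (real \<Rightarrow> real) \<Rightarrow> nat \<Rightarrow> (real^2 \<Rightarrow> real)
     \<Rightarrow> segment \<Rightarrow> real \<Rightarrow> (real \<Rightarrow> real^2) \<Rightarrow> bool" where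
  "is_solution f g h \<kappa> c \<phi> \<sigma> x \<longleftrightarrow>
     (\<forall>\<theta>\<le>0. x (\<sigma> + \<theta>) = \<phi> \<theta>) \<and>
     (\<forall>t\<ge>\<sigma>. (x has_vector_derivative c (x t) *\<^sub>R delay_rhs f g h \<kappa> t (seg x t)) (at t within {\<sigma>..}))"

text \<open>The segment \<open>\<mu>\<^sub>t(\<phi>, \<sigma>)\<close> of the solution with initial data \<open>(\<phi>, \<sigma>)\<close>.\<close>
definition mu ::
    "(real^2 \<Rightarrow> real^2) \<Rightarrow> (real^2 \<Rightarrow> real^2) \<Rightarrow> (real \<Rightarrow> real) \<Rightarrow> nat \<Rightarrow> (real^2 \<Rightarrow> real)
     \<Rightarrow> real \<Rightarrow> segment \<Rightarrow> real \<Rightarrow> segment" where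
  "mu f g h \<kappa> c t \<phi> \<sigma> = seg (THE x. is_solution f g h \<kappa> c \<phi> \<sigma> x) t"

definition W_loc ::
    "(real^2 \<Rightarrow> real^2) \<Rightarrow> (real^2 \<Rightarrow> real^2) \<Rightarrow> (real \<Rightarrow> real) \<Rightarrow> nat \<Rightarrow> (real^2 \<Rightarrow> real)
     \<Rightarrow> real \<Rightarrow> real \<Rightarrow> real \<Rightarrow> real \<Rightarrow> real \<Rightarrow> (segment \<times> real) set" where
  "W_loc f g h \<kappa> c lam M \<sigma>\<^sub>0 r \<delta> =
     {(\<phi>, \<sigma>). \<phi> \<in> Bspace lam M \<and> \<sigma>\<^sub>0 \<le> \<sigma> \<and> Bnorm lam (Pi_s (jacobian f (at 0)) \<phi>) < r \<and>
               (\<forall>t\<ge>\<sigma>. Bnorm lam (mu f g h \<kappa> c t \<phi> \<sigma>) < \<delta>)}"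

end

theory Submission
  imports Defs
begin

text \<open>
  Since the unstable space is \<open>{u = 0}\<close>, the unstable direction is one-dimensional and invisible to
  the delay term, which depends on the history of \<open>u\<close> only. If \<open>u\<close> is \<open>M\<close>-Lipschitz and
  \<open>m = min \<bar>u\<bar>\<close>, the integral of \<open>1 / \<bar>u\<bar>\<^sup>\<kappa>\<close> is at least of order \<open>(1 / M) ln (1 / m)\<close>; hence
  the delay term is at most of order \<open>m\<close> to the power \<open>\<eta> / M > 1\<close>, and so it is Lipschitz in the
  history with a constant that is small near \<open>u = 0\<close>, even across zeros of \<open>u\<close>. The equation is
  therefore a small perturbation of a planar saddle.

  For a given history, the unstable coordinate of a bounded orbit exists by shooting: the initial
  values whose orbits leave the cone \<open>\<bar>z\<bar> \<le> \<bar>u\<bar>\<close> upwards and those whose orbits leave it downwards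
  form disjoint open sets, which cannot cover an interval. Two bounded orbits differ by at most a multiple of
  the difference of their histories, which gives uniqueness, the Lipschitz property and continuity
  in \<open>\<sigma>\<close>. Invariant cones \<open>\<bar>z\<bar> \<le> q \<bar>u\<bar>\<close> with small \<open>q\<close> give tangency and the decay rates.
\<close>

section \<open>The delay term\<close>

text \<open>The phase space with its fixed Lipschitz constant \<open>M\<close> is not a vector
  space: adding an unstable component to a history may leave it. Projections and sums therefore live
  in a larger class of histories, in which only the first component is \<open>M\<close>-Lipschitz;
  adding multiples of the second axis does not leave this class. The unstable component is then a
  single real number, which is why shooting on an interval can replace a fixed point argument in a
  space of segments. The global bound \<open>M\<close> on the right-hand side serves twice: it makes
  solutions exist for all time, and it keeps their first components \<open>M\<close>-Lipschitz, as
  every estimate of the delay term requires. The power estimates also need a window of length at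
  least \<open>\<sigma>\<^sub>0\<close>, since over a very short window the integral can be small
  even where \<open>u\<close> is small. The Lipschitz constant of \<open>w\<close> contains
  \<open>exp (lam * \<sigma>)\<close>, because the delay window reaches back to
  \<open>- \<sigma>\<close>, where the norm sees a history only with weight
  \<open>exp (- lam * \<sigma>)\<close>. The rate \<alpha> of the theorem is linked with the
  eigenvalue and with \<open>lam\<close> by testing the semigroup on one constant segment.\<close>

lemma inverse_power_ge_inverse:
  fixes q :: real
  assumes "0 < q" "q \<le> 1" "1 \<le> (k::nat)"
  shows "1 / q \<le> 1 / q ^ k"
proof -
  have "q ^ k \<le> q ^ 1" using assms by (intro power_decreasing) auto
  then show ?thesis using assms by (simp add: frac_le)
qed

lemma lipschitz_continuous_on:
  fixes u :: "real \<Rightarrow> 'a::real_normed_vector"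
  assumes "\<And>x y. x \<in> S \<Longrightarrow> y \<in> S \<Longrightarrow> norm (u x - u y) \<le> M * \<bar>x - y\<bar>" "0 < M"
  shows "continuous_on S u"
proof -
  have "M-lipschitz_on S u" using assms by (auto simp: lipschitz_on_def dist_norm)
  then show ?thesis by (rule lipschitz_on_continuous_on)
qed

lemma continuous_on_inverse_power:
  fixes u :: "real \<Rightarrow> real"
  assumes "continuous_on S u" "\<And>x. x \<in> S \<Longrightarrow> u x \<noteq> 0"
  shows "continuous_on S (\<lambda>s. 1 / \<bar>u s\<bar> ^ k)"
  using assms by (intro continuous_intros) auto

text \<open>The left end of the window is a parameter, because a shift of time moves the start of
  the delay integral. The value 0 in the presence of a zero is the convention of
  \<open>delay_rhs\<close>; it is also the limit dictated by the decay of \<open>h\<close>, as for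
  \<open>k \<ge> 1\<close> the integral diverges at a zero of a Lipschitz function.\<close>

definition hdelay :: "(real \<Rightarrow> real) \<Rightarrow> nat \<Rightarrow> real \<Rightarrow> real \<Rightarrow> (real \<Rightarrow> real) \<Rightarrow> real" where
  "hdelay h k l t u = (if \<exists>s\<in>{l..t}. u s = 0 then 0 else h (integral {l..t} (\<lambda>s. 1 / \<bar>u s\<bar> ^ k)))"

text \<open>The integrand is the extremal case: an \<open>M\<close>-Lipschitz \<open>u\<close> with
  \<open>\<bar>u c\<bar> = m\<close> satisfies
  \<open>\<bar>u s\<bar> \<le> m + M * \<bar>s - c\<bar>\<close>, so
  \<open>1 / \<bar>u s\<bar>\<close> is never smaller.\<close>

lemma integral_inverse_linear_right:
  fixes m M :: real
  assumes "0 < m" "0 < M" "0 \<le> d"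
  shows "((\<lambda>s. 1 / (m + M * (s - c))) has_integral (ln (m + M * d) - ln m) / M) {c..c + d}"
proof -
  have "((\<lambda>s. 1 / (m + M * (s - c))) has_integral (ln (m + M * (c + d - c)) / M - ln (m + M * (c - c)) / M)) {c..c + d}"
  proof (rule fundamental_theorem_of_calculus)
    fix x assume x: "x \<in> {c..c+d}"
    then have "0 < m + M * (x - c)" using assms by (auto intro: add_pos_nonneg)
    then show "((\<lambda>a. ln (m + M * (a - c)) / M) has_vector_derivative 1 / (m + M * (x - c))) (at x within {c..c + d})"
      unfolding has_real_derivative_iff_has_vector_derivative[symmetric]
      using assms by (auto intro!: derivative_eq_intros)
  qed (use assms in auto)
  then show ?thesis by (simp add: diff_divide_distrib)
qed

lemma integral_inverse_linear_left:
  fixes m M :: real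
  assumes "0 < m" "0 < M" "0 \<le> d"
  shows "((\<lambda>s. 1 / (m + M * (c - s))) has_integral (ln (m + M * d) - ln m) / M) {c - d..c}"
proof -
  have "((\<lambda>s. 1 / (m + M * (c - s))) has_integral (- ln (m + M * (c - c)) / M - - ln (m + M * (c - (c - d))) / M)) {c - d..c}"
  proof (rule fundamental_theorem_of_calculus)
    fix x assume x: "x \<in> {c - d..c}"
    then have "0 < m + M * (c - x)" using assms by (auto intro: add_pos_nonneg)
    then show "((\<lambda>a. - ln (m + M * (c - a)) / M) has_vector_derivative 1 / (m + M * (c - x))) (at x within {c - d..c})"
      unfolding has_real_derivative_iff_has_vector_derivative[symmetric]
      using assms by (auto intro!: derivative_eq_intros)
  qed (use assms in auto)
  then show ?thesis by (simp add: diff_divide_distrib)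
qed

text \<open>The bounds 1/2 on \<open>\<bar>u s\<bar>\<close> and \<open>M * d\<close> keep
  \<open>\<bar>u\<bar>\<close> at most 1 within distance \<open>d\<close> of \<open>s\<close>, where
  \<open>1 / \<bar>u\<bar> ^ k\<close> dominates \<open>1 / \<bar>u\<bar>\<close>; there
  \<open>u\<close> is compared with the extremal linear function. A window of length at least
  \<open>2 * d\<close> contains \<open>[s, s + d]\<close> or \<open>[s - d, s]\<close>.\<close>

lemma time_integral_lower_bound:
  fixes u :: "real \<Rightarrow> real"
  assumes M: "0 < M" and d: "0 < d" "M * d \<le> 1/2" "2 * d \<le> t - l"
    and lip: "\<And>x y. x \<in> {l..t} \<Longrightarrow> y \<in> {l..t} \<Longrightarrow> \<bar>u x - u y\<bar> \<le> M * \<bar>x - y\<bar>"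
    and nz: "\<And>x. x \<in> {l..t} \<Longrightarrow> u x \<noteq> 0"
    and s: "s \<in> {l..t}" and m: "\<bar>u s\<bar> \<le> 1/2" and k: "1 \<le> (k::nat)"
  shows "(ln (\<bar>u s\<bar> + M * d) - ln \<bar>u s\<bar>) / M \<le> integral {l..t} (\<lambda>s. 1 / \<bar>u s\<bar> ^ k)"
proof -
  let ?m = "\<bar>u s\<bar>"
  have cont: "continuous_on {l..t} u" using lip M by (intro lipschitz_continuous_on[of _ _ M]) auto
  have ci: "continuous_on {l..t} (\<lambda>s. 1 / \<bar>u s\<bar> ^ k)" using cont nz by (rule continuous_on_inverse_power)
  have int: "(\<lambda>s. 1 / \<bar>u s\<bar> ^ k) integrable_on {a..b}" if "{a..b} \<subseteq> {l..t}" for a b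
    by (rule integrable_continuous_real) (rule continuous_on_subset[OF ci that])
  have mp: "0 < ?m" using nz s by simp
  have le: "1 / (?m + M * \<bar>x - s\<bar>) \<le> 1 / \<bar>u x\<bar> ^ k" if "x \<in> {l..t}" "\<bar>x - s\<bar> \<le> d" for x
  proof -
    have 1: "\<bar>u x\<bar> \<le> ?m + M * \<bar>x - s\<bar>" using lip[OF that(1) s] by linarith
    have "M * \<bar>x - s\<bar> \<le> M * d" using that M by simp
    then have "\<bar>u x\<bar> \<le> 1" using 1 m d by linarith
    then have "1 / \<bar>u x\<bar> \<le> 1 / \<bar>u x\<bar> ^ k" using nz that k by (intro inverse_power_ge_inverse) auto
    moreover have "1 / (?m + M * \<bar>x - s\<bar>) \<le> 1 / \<bar>u x\<bar>" using 1 nz[OF that(1)] by (intro frac_le) auto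
    ultimately show ?thesis by linarith
  qed
  have mono: "integral {a..b} (\<lambda>s. 1 / \<bar>u s\<bar> ^ k) \<le> integral {l..t} (\<lambda>s. 1 / \<bar>u s\<bar> ^ k)" if "{a..b} \<subseteq> {l..t}" for a b
    using that int by (intro integral_subset_le) auto
  show ?thesis
  proof (cases "s + d \<le> t")
    case True
    then have sub: "{s..s+d} \<subseteq> {l..t}" using s by auto
    have "(ln (?m + M * d) - ln ?m) / M \<le> integral {s..s+d} (\<lambda>s. 1 / \<bar>u s\<bar> ^ k)"
    proof (rule has_integral_le[OF integral_inverse_linear_right[OF mp M] integrable_integral[OF int[OF sub]]])
      fix x assume x: "x \<in> {s..s+d}"
      show "1 / (?m + M * (x - s)) \<le> 1 / \<bar>u x\<bar> ^ k" using le[of x] x sub by auto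
    qed (use d in simp)
    then show ?thesis using mono[OF sub] by (rule order_trans)
  next
    case False
    then have sub: "{s-d..s} \<subseteq> {l..t}" using s d by auto
    have "(ln (?m + M * d) - ln ?m) / M \<le> integral {s-d..s} (\<lambda>s. 1 / \<bar>u s\<bar> ^ k)"
    proof (rule has_integral_le[OF integral_inverse_linear_left[OF mp M] integrable_integral[OF int[OF sub]]])
      fix x assume x: "x \<in> {s-d..s}"
      show "1 / (?m + M * (s - x)) \<le> 1 / \<bar>u x\<bar> ^ k" using le[of x] x sub by auto
    qed (use d in simp)
    then show ?thesis using mono[OF sub] by (rule order_trans)
  qed
qed

lemma exp_time_integral_le:
  fixes M e \<sigma>\<^sub>0 :: real
  assumes M: "0 < M" and e: "0 < e" and s0: "0 < \<sigma>\<^sub>0" and k: "1 \<le> (k::nat)"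
  obtains K where "0 < K" and
    "\<And>l t u s. \<sigma>\<^sub>0 \<le> t - l \<Longrightarrow> (\<And>x y. x \<in> {l..t} \<Longrightarrow> y \<in> {l..t} \<Longrightarrow> \<bar>u x - u y\<bar> \<le> M * \<bar>x - y\<bar>)
      \<Longrightarrow> (\<And>x. x \<in> {l..t} \<Longrightarrow> u x \<noteq> 0) \<Longrightarrow> s \<in> {l..t} \<Longrightarrow>
      exp (- e * integral {l..t} (\<lambda>s. 1 / \<bar>u s\<bar> ^ k)) \<le> K * \<bar>u s\<bar> powr (e / M)"
proof -
  define d where "d = min (\<sigma>\<^sub>0 / 2) (1 / (2 * M))"
  have d: "0 < d" "2 * d \<le> \<sigma>\<^sub>0" "M * d \<le> 1/2"
    using M s0 by (auto simp: d_def min_def field_simps)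
  define p where "p = e / M"
  have p: "0 < p" using M e by (simp add: p_def)
  \<comment> \<open>One summand for each regime: for \<open>\<bar>u s\<bar> > 1/2\<close> the
    exponential is at most 1, hence at most \<open>(2 * \<bar>u s\<bar>) powr p\<close>; for
    \<open>\<bar>u s\<bar> \<le> 1/2\<close> exponentiating the logarithmic lower bound gives the
    power of \<open>\<bar>u s\<bar>\<close>.\<close>
  define K where "K = 2 powr p + (1 / (M * d)) powr p"
  have "0 < K" by (simp add: K_def add_pos_nonneg)
  moreover have "exp (- e * integral {l..t} (\<lambda>s. 1 / \<bar>u s\<bar> ^ k)) \<le> K * \<bar>u s\<bar> powr (e / M)"
    if lt: "\<sigma>\<^sub>0 \<le> t - l" and lip: "\<And>x y. x \<in> {l..t} \<Longrightarrow> y \<in> {l..t} \<Longrightarrow> \<bar>u x - u y\<bar> \<le> M * \<bar>x - y\<bar>"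
      and nz: "\<And>x. x \<in> {l..t} \<Longrightarrow> u x \<noteq> 0" and s: "s \<in> {l..t}" for l t s :: real and u :: "real \<Rightarrow> real"
  proof -
    let ?q = "integral {l..t} (\<lambda>s. 1 / \<bar>u s\<bar> ^ k)" and ?m = "\<bar>u s\<bar>"
    have mp: "0 < ?m" using nz s by simp
    have cont: "continuous_on {l..t} u" using lip M by (intro lipschitz_continuous_on[of _ _ M]) auto
    have q0: "0 \<le> ?q"
      by (intro integral_nonneg integrable_continuous_real continuous_on_inverse_power cont nz) auto
    show ?thesis
    proof (cases "?m \<le> 1/2")
      case True
      have "0 < ?m + M * d" using mp M d by (intro add_pos_pos) auto
      then have np: "\<bar>u s\<bar> + M * d \<noteq> 0" "0 < ?m + M * d" by linarith+
      have "(ln (?m + M * d) - ln ?m) / M \<le> ?q"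
        by (rule time_integral_lower_bound[OF M d(1,3) _ lip nz s True k]) (use d lt in auto)
      then have "e * ((ln (?m + M * d) - ln ?m) / M) \<le> e * ?q" using e by (intro mult_left_mono) auto
      then have "- e * ?q \<le> - e * ((ln (?m + M * d) - ln ?m) / M)" by linarith
      also have "\<dots> = p * ln (?m / (?m + M * d))"
        using mp M np by (simp add: p_def ln_div add_pos_pos field_simps)
      finally have "exp (- e * ?q) \<le> exp (p * ln (?m / (?m + M * d)))" by simp
      also have "\<dots> = (?m / (?m + M * d)) powr p" using mp np by (auto simp: powr_def)
      also have "\<dots> \<le> (?m * (1 / (M * d))) powr p"
      proof (rule powr_mono2)
        show "?m / (?m + M * d) \<le> ?m * (1 / (M * d))" using mp M d by (simp add: frac_le add_pos_pos)
      qed (use mp M d p in auto)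
      also have "\<dots> = ?m powr p * (1 / (M * d)) powr p" by (rule powr_mult)
      also have "\<dots> \<le> K * ?m powr p" by (simp add: K_def algebra_simps)
      finally show ?thesis by (simp add: p_def)
    next
      case False
      have "exp (- e * ?q) \<le> 1" using q0 e by simp
      also have "1 \<le> (2 * ?m) powr p" using False p by (simp add: ge_one_powr_ge_zero)
      also have "\<dots> = 2 powr p * ?m powr p" by (simp add: powr_mult)
      also have "\<dots> \<le> K * ?m powr p" by (simp add: K_def algebra_simps)
      finally show ?thesis by (simp add: p_def)
    qed
  qed
  ultimately show ?thesis using that by blast
qed

definition lip_on :: "real set \<Rightarrow> real \<Rightarrow> (real \<Rightarrow> real) \<Rightarrow> bool" where
  "lip_on S M u \<longleftrightarrow> (\<forall>x\<in>S. \<forall>y\<in>S. \<bar>u x - u y\<bar> \<le> M * \<bar>x - y\<bar>)"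

lemma lip_on_subset: "lip_on S M u \<Longrightarrow> T \<subseteq> S \<Longrightarrow> lip_on T M u"
  unfolding lip_on_def by blast

text \<open>Meant for the ratio \<open>x\<close> of two histories, which stays in [0,2] while they
  are close compared with their size; the constant bounds the geometric sum of the powers of
  \<open>x\<close>.\<close>

lemma one_minus_power_le:
  fixes x :: real
  assumes "0 \<le> x" "x \<le> 2"
  shows "\<bar>1 - x ^ k\<bar> \<le> 2 ^ k * k * \<bar>1 - x\<bar>"
proof -
  have "1 - x ^ k = (1 - x) * (\<Sum>i<k. x ^ i)" by (simp add: one_diff_power_eq)
  moreover have S: "\<bar>\<Sum>i<k. x ^ i\<bar> \<le> 2 ^ k * k"
  proof -
    have "\<bar>\<Sum>i<k. x ^ i\<bar> \<le> (\<Sum>i<k. \<bar>x ^ i\<bar>)" by (rule sum_abs)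
    also have "\<dots> \<le> (\<Sum>i<k. 2 ^ k)"
    proof (rule sum_mono)
      fix i assume "i \<in> {..<k}"
      then have "x ^ i \<le> 2 ^ i" "(2::real) ^ i \<le> 2 ^ k" using assms
        by (auto intro: power_mono power_increasing)
      then have "x ^ i \<le> 2 ^ k" by (rule order_trans)
      then show "\<bar>x ^ i\<bar> \<le> 2 ^ k" using assms by simp
    qed
    finally show ?thesis by (simp add: mult.commute)
  qed
  moreover have "\<bar>1 - x\<bar> * \<bar>\<Sum>i<k. x ^ i\<bar> \<le> \<bar>1 - x\<bar> * (2 ^ k * k)"
    using S by (intro mult_left_mono) auto
  ultimately show ?thesis by (simp add: abs_mult mult_ac)
qed

section \<open>Size and moduli of continuity of the delay term\<close>

locale delay_kernel =
  fixes h :: "real \<Rightarrow> real" and k :: nat and M H \<eta> \<sigma>\<^sub>0 :: real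
  assumes M: "0 < M" "M < \<eta>" and s0: "0 < \<sigma>\<^sub>0" and k: "1 \<le> k" and H: "0 < H"
    and h_bound: "\<And>\<tau>. \<bar>h \<tau>\<bar> \<le> H * exp (- \<eta> * \<tau>)"
    and h_deriv: "\<And>\<tau>. (h has_real_derivative deriv h \<tau>) (at \<tau>)"
    and h'_bound: "\<And>\<tau>. \<bar>deriv h \<tau>\<bar> \<le> H * exp (- \<eta> * \<tau>)"
begin

lemma h_lipschitz: "x \<le> y \<Longrightarrow> \<bar>h x - h y\<bar> \<le> H * exp (- \<eta> * x) * (y - x)"
proof (cases "x = y")
  case False
  assume "x \<le> y"
  then obtain z where z: "x < z" "z < y" "h y - h x = (y - x) * deriv h z"
    using MVT2[of x y h "deriv h"] h_deriv False by auto
  have "\<bar>deriv h z\<bar> \<le> H * exp (- \<eta> * x)"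
    using h'_bound[of z] H M z by (auto intro!: order_trans[OF h'_bound[of z]])
  then have "\<bar>deriv h z\<bar> * (y - x) \<le> H * exp (- \<eta> * x) * (y - x)" using z by (intro mult_right_mono) auto
  moreover have "\<bar>h x - h y\<bar> = \<bar>deriv h z\<bar> * (y - x)"
    using z by (subst abs_minus_commute) (simp add: abs_mult)
  ultimately show ?thesis by simp
qed simp

text \<open>An exponent strictly above \<open>1\<close>, leaving room to absorb a factor linear in the time integral.\<close>
definition pexp :: real where "pexp = (\<eta> + M) / 2 / M"

lemma pexp: "1 < pexp" using M by (simp add: pexp_def field_simps)

text \<open>Fixed once by choice, so that later constants are uniform over windows and
  histories.\<close>

definition K0 :: real where
  "K0 = (SOME K. 0 < K \<and> (\<forall>l t u s. \<sigma>\<^sub>0 \<le> t - l \<longrightarrow> lip_on {l..t} M u \<longrightarrow>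
     (\<forall>x\<in>{l..t}. u x \<noteq> 0) \<longrightarrow> s \<in> {l..t} \<longrightarrow>
     exp (- ((\<eta> + M) / 2) * integral {l..t} (\<lambda>s. 1 / \<bar>u s\<bar> ^ k)) \<le> K * \<bar>u s\<bar> powr pexp))"

lemma K0: "0 < K0"
  and exp_time_integral_le_K0: "\<And>l t u s. \<sigma>\<^sub>0 \<le> t - l \<Longrightarrow> lip_on {l..t} M u \<Longrightarrow>
     (\<And>x. x \<in> {l..t} \<Longrightarrow> u x \<noteq> 0) \<Longrightarrow> s \<in> {l..t} \<Longrightarrow>
     exp (- ((\<eta> + M) / 2) * integral {l..t} (\<lambda>s. 1 / \<bar>u s\<bar> ^ k)) \<le> K0 * \<bar>u s\<bar> powr pexp"
proof -
  have "0 < (\<eta> + M) / 2" using M by simp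
  from exp_time_integral_le[OF M(1) this s0 k]
  have "\<exists>K. 0 < K \<and> (\<forall>l t u s. \<sigma>\<^sub>0 \<le> t - l \<longrightarrow> lip_on {l..t} M u \<longrightarrow>
     (\<forall>x\<in>{l..t}. u x \<noteq> 0) \<longrightarrow> s \<in> {l..t} \<longrightarrow>
     exp (- ((\<eta> + M) / 2) * integral {l..t} (\<lambda>s. 1 / \<bar>u s\<bar> ^ k)) \<le> K * \<bar>u s\<bar> powr pexp)"
    unfolding lip_on_def pexp_def by metis
  from someI_ex[OF this] show "0 < K0" 
    "\<And>l t u s. \<sigma>\<^sub>0 \<le> t - l \<Longrightarrow> lip_on {l..t} M u \<Longrightarrow>
     (\<And>x. x \<in> {l..t} \<Longrightarrow> u x \<noteq> 0) \<Longrightarrow> s \<in> {l..t} \<Longrightarrow>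
     exp (- ((\<eta> + M) / 2) * integral {l..t} (\<lambda>s. 1 / \<bar>u s\<bar> ^ k)) \<le> K0 * \<bar>u s\<bar> powr pexp"
    unfolding K0_def[symmetric] by blast+
qed

lemma time_integral_nonneg:
  assumes "lip_on {l..t} M u" "\<And>x. x \<in> {l..t} \<Longrightarrow> u x \<noteq> 0"
  shows "(\<lambda>s. 1 / \<bar>u s\<bar> ^ k) integrable_on {l..t}" "0 \<le> integral {l..t} (\<lambda>s. 1 / \<bar>u s\<bar> ^ k)"
proof -
  have "continuous_on {l..t} u" using assms M
    by (intro lipschitz_continuous_on[of _ _ M]) (auto simp: lip_on_def)
  then show i: "(\<lambda>s. 1 / \<bar>u s\<bar> ^ k) integrable_on {l..t}" using assms(2)
    by (intro integrable_continuous_real continuous_on_inverse_power) auto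
  show "0 \<le> integral {l..t} (\<lambda>s. 1 / \<bar>u s\<bar> ^ k)" using i by (rule integral_nonneg) auto
qed

lemma exp_eta_le:
  assumes "\<sigma>\<^sub>0 \<le> t - l" "lip_on {l..t} M u" "\<And>x. x \<in> {l..t} \<Longrightarrow> u x \<noteq> 0" "s \<in> {l..t}"
  shows "exp (- \<eta> * integral {l..t} (\<lambda>s. 1 / \<bar>u s\<bar> ^ k)) \<le> K0 * \<bar>u s\<bar> powr pexp"
proof -
  let ?q = "integral {l..t} (\<lambda>s. 1 / \<bar>u s\<bar> ^ k)"
  have "0 \<le> ?q" using time_integral_nonneg assms by auto
  then have "((\<eta> + M) / 2) * ?q \<le> \<eta> * ?q" using M by (intro mult_right_mono) auto
  then have "exp (- \<eta> * ?q) \<le> exp (- ((\<eta> + M) / 2) * ?q)" by simp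
  also have "\<dots> \<le> K0 * \<bar>u s\<bar> powr pexp" using exp_time_integral_le_K0 assms by blast
  finally show ?thesis .
qed

text \<open>As \<open>s\<close> may be the present time \<open>t\<close> and
  \<open>pexp > 1\<close>, the delay term is of higher than first order in the present value of
  \<open>u\<close> and does not affect the linearization at the origin.\<close>

lemma hdelay_le:
  assumes "\<sigma>\<^sub>0 \<le> t - l" "lip_on {l..t} M u" "s \<in> {l..t}"
  shows "\<bar>hdelay h k l t u\<bar> \<le> H * K0 * \<bar>u s\<bar> powr pexp"
proof (cases "\<exists>s\<in>{l..t}. u s = 0")
  case True
  then show ?thesis using H K0 by (simp add: hdelay_def)
next
  case False
  let ?q = "integral {l..t} (\<lambda>s. 1 / \<bar>u s\<bar> ^ k)"
  have "\<bar>h ?q\<bar> \<le> H * exp (- \<eta> * ?q)" by (rule h_bound)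
  also have "\<dots> \<le> H * (K0 * \<bar>u s\<bar> powr pexp)"
    using exp_eta_le[of t l u s] assms False H by (intro mult_left_mono) auto
  finally show ?thesis using False by (simp add: hdelay_def mult.assoc)
qed

lemma hdelay_le_H:
  assumes "lip_on {l..t} M u"
  shows "\<bar>hdelay h k l t u\<bar> \<le> H"
proof (cases "\<exists>s\<in>{l..t}. u s = 0")
  case True
  then show ?thesis using H by (simp add: hdelay_def)
next
  case False
  let ?q = "integral {l..t} (\<lambda>s. 1 / \<bar>u s\<bar> ^ k)"
  have "\<bar>h ?q\<bar> \<le> H * exp (- \<eta> * ?q)" by (rule h_bound)
  also have "\<dots> \<le> H * 1"
    using time_integral_nonneg(2)[OF assms] False H M by (intro mult_left_mono) auto
  finally show ?thesis using False by (simp add: hdelay_def mult.assoc)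
qed

text \<open>Splits \<open>\<eta>\<close> into \<open>(\<eta> - M) / 2\<close> and
  \<open>(\<eta> + M) / 2\<close>: the first part absorbs the linear factor through
  \<open>x * exp (- x) \<le> 1\<close>, the second still gives the power \<open>pexp\<close>. The
  linear factor arises when two time integrals are compared, their difference being bounded by a
  multiple of one of them.\<close>

lemma mult_exp_time_integral_le:
  assumes "\<sigma>\<^sub>0 \<le> t - l" "lip_on {l..t} M u" "\<And>x. x \<in> {l..t} \<Longrightarrow> u x \<noteq> 0" "s \<in> {l..t}"
  shows "integral {l..t} (\<lambda>s. 1 / \<bar>u s\<bar> ^ k) * exp (- \<eta> * integral {l..t} (\<lambda>s. 1 / \<bar>u s\<bar> ^ k))
    \<le> 2 / (\<eta> - M) * (K0 * \<bar>u s\<bar> powr pexp)"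
proof -
  let ?q = "integral {l..t} (\<lambda>s. 1 / \<bar>u s\<bar> ^ k)"
  let ?d = "(\<eta> - M) / 2"
  have d: "0 < ?d" using M by simp
  have ex: "exp (- \<eta> * ?q) = exp (- (?d * ?q)) * exp (- ((\<eta> + M) / 2) * ?q)"
    unfolding exp_add[symmetric] by (rule arg_cong[where f=exp]) (simp add: field_simps)
  have "?q * exp (- (?d * ?q)) \<le> 2 / (\<eta> - M)"
  proof -
    have "?d * ?q \<le> exp (?d * ?q)" using exp_ge_add_one_self[of "?d * ?q"] by linarith
    then have "?d * ?q * exp (- (?d * ?q)) \<le> 1" by (simp add: exp_minus field_simps)
    then show ?thesis using M by (simp add: field_simps)
  qed
  moreover have "exp (- ((\<eta> + M) / 2) * ?q) \<le> K0 * \<bar>u s\<bar> powr pexp"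
    using exp_time_integral_le_K0 assms by blast
  ultimately have "?q * exp (- (?d * ?q)) * exp (- ((\<eta> + M) / 2) * ?q) \<le> 2 / (\<eta> - M) * (K0 * \<bar>u s\<bar> powr pexp)"
    using M by (intro mult_mono) auto
  then show ?thesis unfolding ex mult.assoc .
qed

text \<open>The two summands belong to the two cases in the proof of the next Lipschitz estimate:
  the bound for the difference of the histories is larger, or at most, half the minimum of
  \<open>\<bar>u1\<bar>\<close>.\<close>

definition K1 :: real where
  "K1 = H * K0 * (4 + real k * 2 ^ (k + 2) / (\<eta> - M))"

lemma K1: "0 < K1"
  using H K0 M by (auto simp: K1_def intro!: mult_pos_pos add_pos_nonneg)

text \<open>Let \<open>m\<close> be the minimum of \<open>\<bar>u1\<bar>\<close> over the window and
  \<open>q1\<close> the time integral of \<open>u1\<close>. If \<open>m < 2 * X\<close>, both delay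
  terms are at most \<open>H * exp (- \<eta> * q1)\<close>, hence of order
  \<open>m powr pexp\<close>, and one factor \<open>m\<close> is traded for \<open>X\<close>.
  Otherwise \<open>u2\<close> has no zero, and the time integrals differ by at most a multiple of
  \<open>X / m\<close> times \<open>q1\<close>. The last hypothesis makes the delay term of
  \<open>u2\<close> obey the exponential bound of \<open>u1\<close>; it is a normalization by
  symmetry.\<close>

lemma hdelay_lipschitz_aux:
  assumes lt: "\<sigma>\<^sub>0 \<le> t - l" and lip: "lip_on {l..t} M u1" "lip_on {l..t} M u2"
    and X: "\<And>x. x \<in> {l..t} \<Longrightarrow> \<bar>u1 x - u2 x\<bar> \<le> X"
    and nz: "\<And>x. x \<in> {l..t} \<Longrightarrow> u1 x \<noteq> 0"
    and q: "(\<exists>x\<in>{l..t}. u2 x = 0) \<or>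
       integral {l..t} (\<lambda>s. 1 / \<bar>u1 s\<bar> ^ k) \<le> integral {l..t} (\<lambda>s. 1 / \<bar>u2 s\<bar> ^ k)"
  shows "\<bar>hdelay h k l t u1 - hdelay h k l t u2\<bar> \<le> K1 * \<bar>u1 t\<bar> powr (pexp - 1) * X"
proof -
  let ?q1 = "integral {l..t} (\<lambda>s. 1 / \<bar>u1 s\<bar> ^ k)"
  let ?q2 = "integral {l..t} (\<lambda>s. 1 / \<bar>u2 s\<bar> ^ k)"
  have t: "t \<in> {l..t}" using lt s0 by auto
  have cont: "continuous_on {l..t} (\<lambda>x. \<bar>u1 x\<bar>)" using lip M
    by (intro continuous_on_rabs lipschitz_continuous_on[of _ _ M]) (auto simp: lip_on_def)
  then obtain s where s: "s \<in> {l..t}" and smin: "\<And>x. x \<in> {l..t} \<Longrightarrow> \<bar>u1 s\<bar> \<le> \<bar>u1 x\<bar>"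
    using continuous_attains_inf[OF compact_Icc _ cont] t by fastforce
  define m where "m = \<bar>u1 s\<bar>"
  have m: "0 < m" using nz s by (simp add: m_def)
  have mt: "m powr (pexp - 1) \<le> \<bar>u1 t\<bar> powr (pexp - 1)"
    using smin[OF t] pexp m by (intro powr_mono2) (auto simp: m_def)
  have mp: "m powr pexp = m powr (pexp - 1) * m" using m by (simp add: powr_diff)
  have X0: "0 \<le> X" using X[OF t] by linarith
  have e: "exp (- \<eta> * ?q1) \<le> K0 * m powr pexp"
    using exp_eta_le[of t l u1 s] lt lip nz s by (simp add: m_def)
  have q1: "0 \<le> ?q1" using time_integral_nonneg lip nz by blast
  have h1: "hdelay h k l t u1 = h ?q1" using nz by (auto simp: hdelay_def)
  show ?thesis
  proof (cases "2 * X \<le> m")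
    case False
    have "\<bar>hdelay h k l t u2\<bar> \<le> H * exp (- \<eta> * ?q1)"
    proof (cases "\<exists>x\<in>{l..t}. u2 x = 0")
      case True
      then show ?thesis using H by (simp add: hdelay_def)
    next
      case False
      have "\<bar>h ?q2\<bar> \<le> H * exp (- \<eta> * ?q2)" by (rule h_bound)
      also have "\<dots> \<le> H * exp (- \<eta> * ?q1)" using q False H M by auto
      finally show ?thesis using False by (simp add: hdelay_def)
    qed
    then have "\<bar>hdelay h k l t u1 - hdelay h k l t u2\<bar> \<le> 2 * (H * exp (- \<eta> * ?q1))"
      using h_bound[of ?q1] h1 by linarith
    also have "\<dots> \<le> 2 * (H * (K0 * m powr pexp))" using e H by (intro mult_left_mono) auto
    also have "\<dots> = 2 * H * K0 * m powr (pexp - 1) * m" by (simp add: mp)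
    also have "\<dots> \<le> 2 * H * K0 * m powr (pexp - 1) * (2 * X)"
      using False H K0 by (intro mult_left_mono) auto
    also have "\<dots> = (H * K0 * 4) * m powr (pexp - 1) * X" by simp
    also have "\<dots> \<le> K1 * m powr (pexp - 1) * X"
      unfolding K1_def using X0 H K0 M by (intro mult_right_mono mult_left_mono) auto
    also have "\<dots> \<le> K1 * \<bar>u1 t\<bar> powr (pexp - 1) * X"
      using mt K1 X0 by (intro mult_right_mono mult_left_mono) auto
    finally show ?thesis .
  next
    case True
    have half: "\<bar>u1 x\<bar> / 2 \<le> \<bar>u2 x\<bar>" if "x \<in> {l..t}" for x
      using X[OF that] smin[OF that] True by (auto simp: m_def)
    have nz2: "u2 x \<noteq> 0" if "x \<in> {l..t}" for x using half[OF that] nz[OF that] by auto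
    define c where "c = 2 ^ k * real k * (2 * X / m)"
    \<comment> \<open>The relative change of the integrand is \<open>r ^ k - 1\<close> with
      \<open>\<bar>1 - r\<bar> \<le> 2 * X / m\<close>, because
      \<open>\<bar>u2 x\<bar> \<ge> m / 2\<close>; the bound \<open>c\<close> is uniform in
      \<open>x\<close>.\<close>
    have pt: "1 / \<bar>u2 x\<bar> ^ k - 1 / \<bar>u1 x\<bar> ^ k \<le> c * (1 / \<bar>u1 x\<bar> ^ k)" if x: "x \<in> {l..t}" for x
    proof -
      define r where "r = \<bar>u1 x\<bar> / \<bar>u2 x\<bar>"
      have a: "0 < \<bar>u1 x\<bar>" "0 < \<bar>u2 x\<bar>" using nz[OF x] nz2[OF x] by auto
      have r: "0 \<le> r" "r \<le> 2" using half[OF x] a by (auto simp: r_def field_simps)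
      have "1 - r = (\<bar>u2 x\<bar> - \<bar>u1 x\<bar>) / \<bar>u2 x\<bar>" using a by (simp add: r_def diff_divide_distrib)
      then have "\<bar>1 - r\<bar> = \<bar>\<bar>u2 x\<bar> - \<bar>u1 x\<bar>\<bar> / \<bar>u2 x\<bar>" by simp
      also have "\<dots> \<le> X / (m / 2)"
      proof (rule frac_le)
        show "\<bar>\<bar>u2 x\<bar> - \<bar>u1 x\<bar>\<bar> \<le> X" using X[OF x] by linarith
        show "m / 2 \<le> \<bar>u2 x\<bar>" using half[OF x] smin[OF x] by (simp add: m_def)
      qed (use m X0 in auto)
      finally have 1: "\<bar>1 - r\<bar> \<le> 2 * X / m" by (simp add: mult.commute)
      have "r ^ k - 1 \<le> \<bar>1 - r ^ k\<bar>" by simp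
      also have "\<dots> \<le> 2 ^ k * real k * \<bar>1 - r\<bar>" using one_minus_power_le[OF r] .
      also have "\<dots> \<le> c" unfolding c_def using 1 by (intro mult_left_mono) auto
      finally have 2: "(r ^ k - 1) * (1 / \<bar>u1 x\<bar> ^ k) \<le> c * (1 / \<bar>u1 x\<bar> ^ k)" by (rule mult_right_mono) simp
      have "(r ^ k - 1) * (1 / \<bar>u1 x\<bar> ^ k) = 1 / \<bar>u2 x\<bar> ^ k - 1 / \<bar>u1 x\<bar> ^ k"
        using a by (simp add: r_def power_divide field_simps)
      with 2 show ?thesis by simp
    qed
    have i1: "(\<lambda>s. 1 / \<bar>u1 s\<bar> ^ k) integrable_on {l..t}" using time_integral_nonneg lip nz by blast
    have i2: "(\<lambda>s. 1 / \<bar>u2 s\<bar> ^ k) integrable_on {l..t}" using time_integral_nonneg lip nz2 by blast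
    have "?q2 - ?q1 = integral {l..t} (\<lambda>x. 1 / \<bar>u2 x\<bar> ^ k - 1 / \<bar>u1 x\<bar> ^ k)"
      using i1 i2 by (simp add: integral_diff)
    also have "\<dots> \<le> integral {l..t} (\<lambda>x. c * (1 / \<bar>u1 x\<bar> ^ k))"
      by (rule integral_le[OF integrable_diff[OF i2 i1] integrable_on_mult_right[OF i1] pt])
    also have "\<dots> = c * ?q1" by (rule integral_mult_right)
    finally have dq: "?q2 - ?q1 \<le> c * ?q1" .
    have q': "?q1 \<le> ?q2" using q nz2 by auto
    have h2: "hdelay h k l t u2 = h ?q2" using nz2 by (auto simp: hdelay_def)
    have "\<bar>hdelay h k l t u1 - hdelay h k l t u2\<bar> \<le> H * exp (- \<eta> * ?q1) * (?q2 - ?q1)"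
      unfolding h1 h2 using h_lipschitz[OF q'] .
    also have "\<dots> \<le> H * exp (- \<eta> * ?q1) * (c * ?q1)" using dq H by (intro mult_left_mono) auto
    also have "\<dots> = H * c * (?q1 * exp (- \<eta> * ?q1))" by simp
    also have "\<dots> \<le> H * c * (2 / (\<eta> - M) * (K0 * m powr pexp))"
      using mult_exp_time_integral_le[OF lt lip(1) nz s] H m X0
      by (intro mult_left_mono) (auto simp: m_def c_def)
    also have "\<dots> = (H * K0 * (real k * 2 ^ (k + 2) / (\<eta> - M))) * m powr (pexp - 1) * X"
      using m by (simp add: c_def mp field_simps)
    also have "\<dots> \<le> K1 * m powr (pexp - 1) * X"
      unfolding K1_def using X0 H K0 M by (intro mult_right_mono mult_left_mono) auto
    also have "\<dots> \<le> K1 * \<bar>u1 t\<bar> powr (pexp - 1) * X"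
      using mt K1 X0 by (intro mult_right_mono mult_left_mono) auto
    finally show ?thesis .
  qed
qed

lemma hdelay_lipschitz:
  assumes lt: "\<sigma>\<^sub>0 \<le> t - l" and lip: "lip_on {l..t} M u1" "lip_on {l..t} M u2"
    and X: "\<And>x. x \<in> {l..t} \<Longrightarrow> \<bar>u1 x - u2 x\<bar> \<le> X"
    and B: "\<bar>u1 t\<bar> \<le> B" "\<bar>u2 t\<bar> \<le> B"
  shows "\<bar>hdelay h k l t u1 - hdelay h k l t u2\<bar> \<le> K1 * B powr (pexp - 1) * X"
proof -
  have t: "t \<in> {l..t}" using lt s0 by auto
  have X0: "0 \<le> X" using X[OF t] by linarith
  have X': "\<And>x. x \<in> {l..t} \<Longrightarrow> \<bar>u2 x - u1 x\<bar> \<le> X" using X by (simp add: abs_minus_commute)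
  have mono: "K1 * b powr (pexp - 1) * X \<le> K1 * B powr (pexp - 1) * X" if "0 \<le> b" "b \<le> B" for b
    using that K1 X0 pexp by (intro mult_right_mono mult_left_mono powr_mono2) auto
  let ?z = "\<lambda>u. \<exists>x\<in>{l..t}. u x = (0::real)"
  let ?q1 = "integral {l..t} (\<lambda>s. 1 / \<bar>u1 s\<bar> ^ k)"
  let ?q2 = "integral {l..t} (\<lambda>s. 1 / \<bar>u2 s\<bar> ^ k)"
  \<comment> \<open>Unless both functions vanish somewhere, one of them can play the role of
    \<open>u1\<close> in the auxiliary estimate: the one without a zero, and with the smaller
    integral if neither has one.\<close>
  consider "?z u1 \<and> ?z u2" | "\<not> ?z u1 \<and> (?z u2 \<or> ?q1 \<le> ?q2)" | "\<not> ?z u2 \<and> (?z u1 \<or> ?q2 \<le> ?q1)"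
    by linarith
  then show ?thesis
  proof cases
    case 1
    then show ?thesis using K1 X0 by (simp add: hdelay_def)
  next
    case 2
    then show ?thesis
      using hdelay_lipschitz_aux[OF lt lip X] mono[of "\<bar>u1 t\<bar>"] B by force
  next
    case 3
    then show ?thesis
      using hdelay_lipschitz_aux[OF lt lip(2,1) X'] mono[of "\<bar>u2 t\<bar>"] B
      by (force simp: abs_minus_commute)
  qed
qed

text \<open>At a zero of \<open>u\<close> the value is 0, and the power bound at the present time
  squeezes the nearby values. A zero strictly in the past stays in all windows that end nearby, so
  the term is locally constant. Without zeros, Lipschitz continuity keeps \<open>u\<close> away from
  0 for a little longer, and the integral is continuous in its upper end.\<close>

lemma continuous_on_hdelay:
  assumes lip: "lip_on {l..} M u"
  shows "continuous_on {l + \<sigma>\<^sub>0..} (\<lambda>t. hdelay h k l t u)"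
  unfolding continuous_on_def
proof
  fix t assume t: "t \<in> {l + \<sigma>\<^sub>0..}"
  let ?S = "{l + \<sigma>\<^sub>0..}" and ?f = "\<lambda>t. hdelay h k l t u"
  have lip': "lip_on {l..r} M u" for r using lip by (rule lip_on_subset) auto
  have cont: "continuous_on {l..} u" using lip M
    by (intro lipschitz_continuous_on[of _ _ M]) (auto simp: lip_on_def)
  have cont': "continuous_on S u" if "S \<subseteq> {l..}" for S using continuous_on_subset[OF cont that] .
  consider "u t = 0" | "u t \<noteq> 0" "\<exists>x\<in>{l..t}. u x = 0" | "\<forall>x\<in>{l..t}. u x \<noteq> 0" by blast
  then show "(?f \<longlongrightarrow> ?f t) (at t within ?S)"
  proof cases
    case 1
    then have z: "?f t = 0" using t s0 by (auto simp: hdelay_def)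
    have "continuous_on ?S (\<lambda>r. H * K0 * \<bar>u r\<bar> powr pexp)"
      using pexp s0 by (intro continuous_intros continuous_on_powr' cont') auto
    then have "((\<lambda>r. H * K0 * \<bar>u r\<bar> powr pexp) \<longlongrightarrow> H * K0 * \<bar>u t\<bar> powr pexp) (at t within ?S)"
      using t by (auto simp: continuous_on_def)
    then have lim: "((\<lambda>r. H * K0 * \<bar>u r\<bar> powr pexp) \<longlongrightarrow> 0) (at t within ?S)" using 1 by simp
    have "\<forall>\<^sub>F r in at t within ?S. norm (?f r) \<le> H * K0 * \<bar>u r\<bar> powr pexp"
      unfolding eventually_at_filter
      by (rule always_eventually) (use hdelay_le lip' s0 in auto)
    then show ?thesis unfolding z using lim by (rule Lim_null_comparison)
  next
    case 2
    then obtain x where x: "x \<in> {l..t}" "u x = 0" by blast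
    then have "x < t" using 2 by (cases "x = t") auto
    then have "\<forall>\<^sub>F r in at t within ?S. x < r"
      by (rule order_tendstoD(1)[OF tendsto_ident_at])
    then have "\<forall>\<^sub>F r in at t within ?S. ?f t = ?f r"
      by eventually_elim (use x in \<open>auto simp: hdelay_def intro!: bexI[of _ x]\<close>)
    then show ?thesis by (rule Lim_transform_eventually[OF tendsto_const])
  next
    case 3
    have tl: "l \<le> t" using t s0 by auto
    then have ut: "0 < \<bar>u t\<bar>" using 3 by auto
    \<comment> \<open>Within time \<open>\<bar>u t\<bar> / (2 * M)\<close> an
      \<open>M\<close>-Lipschitz function loses at most half of
      \<open>\<bar>u t\<bar>\<close>.\<close>
    define b where "b = t + \<bar>u t\<bar> / (2 * M)"
    have b: "t < b" using ut M by (simp add: b_def)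
    have nz: "u x \<noteq> 0" if x: "x \<in> {l..b}" for x
    proof (cases "x \<le> t")
      case False
      have "\<bar>u x - u t\<bar> \<le> M * \<bar>x - t\<bar>" using lip x tl unfolding lip_on_def by auto
      also have "\<dots> \<le> M * (\<bar>u t\<bar> / (2 * M))" using M x False by (intro mult_left_mono) (auto simp: b_def)
      also have "\<dots> = \<bar>u t\<bar> / 2" using M by simp
      finally show ?thesis using ut by linarith
    qed (use 3 x in auto)
    let ?g = "\<lambda>r. h (integral {l..r} (\<lambda>s. 1 / \<bar>u s\<bar> ^ k))"
    have "continuous_on UNIV h" using h_deriv by (meson DERIV_isCont continuous_at_imp_continuous_on)
    then have "continuous_on {l..b} ?g"
      by (rule continuous_on_compose2)
        (auto intro!: indefinite_integral_continuous_1 time_integral_nonneg lip' nz)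
    then have "(?g \<longlongrightarrow> ?g t) (at t within {l..b})" using tl b by (auto simp: continuous_on_def)
    then have "(?g \<longlongrightarrow> ?g t) (at t within {l + \<sigma>\<^sub>0..b})"
      by (rule tendsto_within_subset) (use s0 in auto)
    moreover have "at t within {l + \<sigma>\<^sub>0..b} = at t within ?S"
      by (rule at_within_nhd[of t "{..<b}"]) (use b in auto)
    ultimately have lim: "(?g \<longlongrightarrow> ?g t) (at t within ?S)" by simp
    have eq: "?g r = ?f r" if "r \<le> b" for r using nz that by (auto simp: hdelay_def)
    have "\<forall>\<^sub>F r in at t within ?S. r < b"
      using b by (rule order_tendstoD(2)[OF tendsto_ident_at])
    then have "\<forall>\<^sub>F r in at t within ?S. ?g r = ?f r"
      by eventually_elim (use eq in auto)
    from Lim_transform_eventually[OF lim this] show ?thesis using eq[of t] b by simp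
  qed
qed

text \<open>No zero enters through \<open>[a, b]\<close>, where
  \<open>\<bar>u\<bar> \<ge> m\<close>; the added part of the integral is at most
  \<open>(b - a) * (1 / m) ^ k\<close>, and \<open>h\<close> is \<open>H\<close>-Lipschitz on
  nonnegative arguments.\<close>

lemma hdelay_extend_window:
  assumes a: "a \<le> b" "b \<le> t" and lip: "lip_on {a..t} M u"
    and m: "0 < m" "\<And>s. s \<in> {a..b} \<Longrightarrow> m \<le> \<bar>u s\<bar>"
  shows "\<bar>hdelay h k a t u - hdelay h k b t u\<bar> \<le> H * ((b - a) * (1 / m) ^ k)"
proof -
  have e0: "0 \<le> H * ((b - a) * (1 / m) ^ k)" using H a m by simp
  have sub: "lip_on {b..t} M u" using lip by (rule lip_on_subset) (use a in auto)
  show ?thesis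
  proof (cases "\<exists>s\<in>{a..t}. u s = 0")
    case True
    then obtain s where s: "s \<in> {a..t}" "u s = 0" by blast
    have "b < s" using m(2)[of s] m(1) s by (cases "s \<le> b") auto
    then have "\<exists>s\<in>{b..t}. u s = 0" using s by (intro bexI[of _ s]) auto
    then show ?thesis using True e0 by (simp add: hdelay_def)
  next
    case False
    then have nb: "\<not> (\<exists>s\<in>{b..t}. u s = 0)" using a by auto
    let ?i = "\<lambda>x y. integral {x..y} (\<lambda>s. 1 / \<bar>u s\<bar> ^ k)"
    have ia: "(\<lambda>s. 1 / \<bar>u s\<bar> ^ k) integrable_on {a..t}" using time_integral_nonneg[OF lip] False by auto
    have ib: "0 \<le> ?i b t" using time_integral_nonneg[OF sub] nb by blast
    have comb: "?i a b + ?i b t = ?i a t" using a ia by (intro Henstock_Kurzweil_Integration.integral_combine) auto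
    have iab: "(\<lambda>s. 1 / \<bar>u s\<bar> ^ k) integrable_on {a..b}" using ia
      by (rule integrable_on_subinterval) (use a in auto)
    have i0: "0 \<le> ?i a b" using iab by (rule integral_nonneg) auto
    have "?i a b \<le> integral {a..b} (\<lambda>s. (1 / m) ^ k)"
    proof (rule integral_le[OF iab integrable_const_ivl])
      fix s assume "s \<in> {a..b}"
      then have "1 / \<bar>u s\<bar> \<le> 1 / m" using m by (intro frac_le) auto
      then have "(1 / \<bar>u s\<bar>) ^ k \<le> (1 / m) ^ k" by (intro power_mono) auto
      then show "1 / \<bar>u s\<bar> ^ k \<le> (1 / m) ^ k" by (simp add: power_divide)
    qed
    then have i1: "?i a b \<le> (b - a) * (1 / m) ^ k" using a by simp
    have "\<bar>h (?i b t) - h (?i a t)\<bar> \<le> H * exp (- \<eta> * ?i b t) * (?i a t - ?i b t)"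
      using comb i0 by (intro h_lipschitz) linarith
    also have "\<dots> \<le> H * 1 * ((b - a) * (1 / m) ^ k)"
      using ib i0 i1 comb H M by (intro mult_mono) auto
    finally show ?thesis using False nb by (simp add: hdelay_def abs_minus_commute)
  qed
qed

text \<open>The radius \<open>d\<close> does not depend on \<open>t\<close> or on the continuation
  \<open>u\<close> of \<psi>, so that the estimate can be used along whole orbits. If
  \<open>\<psi> (- \<sigma>) = 0\<close>, the term whose window starts at \<open>- \<sigma>\<close>
  vanishes and the other is at most of order
  \<open>\<bar>\<psi> (- \<sigma>')\<bar> powr pexp\<close>; otherwise
  \<open>\<bar>\<psi>\<bar>\<close> has a positive lower bound between the two window
  starts.\<close>

lemma hdelay_window_continuous:
  assumes lip: "lip_on {..0} M \<psi>" and s: "\<sigma>\<^sub>0 \<le> \<sigma>" and e: "0 < e"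
  obtains d where "0 < d"
    "\<And>\<sigma>' t u. \<sigma>\<^sub>0 \<le> \<sigma>' \<Longrightarrow> \<bar>\<sigma>' - \<sigma>\<bar> < d \<Longrightarrow> 0 \<le> t \<Longrightarrow> lip_on {..t} M u \<Longrightarrow>
      (\<And>s. s \<le> 0 \<Longrightarrow> u s = \<psi> s) \<Longrightarrow> \<bar>hdelay h k (- \<sigma>) t u - hdelay h k (- \<sigma>') t u\<bar> \<le> e"
proof (cases "\<psi> (- \<sigma>) = 0")
  case True
  \<comment> \<open>Solves \<open>H * K0 * (M * d) powr pexp = e\<close>.\<close>
  define d where "d = (e / (H * K0)) powr (1 / pexp) / M"
  have "0 < d" using e H K0 M by (simp add: d_def)
  moreover have "\<bar>hdelay h k (- \<sigma>) t u - hdelay h k (- \<sigma>') t u\<bar> \<le> e"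
    if "\<sigma>\<^sub>0 \<le> \<sigma>'" "\<bar>\<sigma>' - \<sigma>\<bar> < d" "0 \<le> t" "lip_on {..t} M u" "\<And>s. s \<le> 0 \<Longrightarrow> u s = \<psi> s" for \<sigma>' t u
  proof -
    have "u (- \<sigma>) = 0" using True that(5)[of "- \<sigma>"] s s0 by simp
    then have "hdelay h k (- \<sigma>) t u = 0" using s s0 that(3) by (auto simp: hdelay_def intro!: bexI[of _ "- \<sigma>"])
    moreover have "\<bar>hdelay h k (- \<sigma>') t u\<bar> \<le> H * K0 * \<bar>u (- \<sigma>')\<bar> powr pexp"
      using that s0 by (intro hdelay_le lip_on_subset[OF that(4)]) auto
    moreover have "\<bar>u (- \<sigma>')\<bar> \<le> M * d"
    proof -
      have "\<bar>\<psi> (- \<sigma>') - \<psi> (- \<sigma>)\<bar> \<le> M * \<bar>- \<sigma>' - - \<sigma>\<bar>"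
        using lip[unfolded lip_on_def, rule_format, of "- \<sigma>'" "- \<sigma>"] s s0 that(1) by auto
      also have "\<dots> \<le> M * d" using that(2) M by (intro mult_left_mono) auto
      finally show ?thesis using True that(5)[of "- \<sigma>'"] that(1) s0 by simp
    qed
    then have "\<bar>u (- \<sigma>')\<bar> powr pexp \<le> (M * d) powr pexp" using pexp by (intro powr_mono2) auto
    then have "H * K0 * \<bar>u (- \<sigma>')\<bar> powr pexp \<le> H * K0 * (M * d) powr pexp" using H K0 by (intro mult_left_mono) auto
    moreover have "(M * d) powr pexp = e / (H * K0)"
      using M e H K0 pexp by (simp add: d_def powr_powr)
    ultimately show ?thesis using H K0 by simp
  qed
  ultimately show ?thesis using that by blast
next
  case False
  define m where "m = \<bar>\<psi> (- \<sigma>)\<bar> / 2"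
  have m: "0 < m" using False by (simp add: m_def)
  define d where "d = min (m / M) (e / (H * (1 / m) ^ k))"
  have "0 < d" using m M e H by (simp add: d_def)
  moreover have "\<bar>hdelay h k (- \<sigma>) t u - hdelay h k (- \<sigma>') t u\<bar> \<le> e"
    if "\<sigma>\<^sub>0 \<le> \<sigma>'" "\<bar>\<sigma>' - \<sigma>\<bar> < d" "0 \<le> t" "lip_on {..t} M u" "\<And>s. s \<le> 0 \<Longrightarrow> u s = \<psi> s" for \<sigma>' t u
  proof -
    have big: "m \<le> \<bar>u r\<bar>" if r: "r \<le> 0" "\<bar>r + \<sigma>\<bar> \<le> \<bar>\<sigma>' - \<sigma>\<bar>" for r
    proof -
      have "\<bar>\<psi> r - \<psi> (- \<sigma>)\<bar> \<le> M * \<bar>r - - \<sigma>\<bar>"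
        using lip[unfolded lip_on_def, rule_format, of r "- \<sigma>"] s s0 r by auto
      also have "\<dots> \<le> M * (m / M)" using r \<open>\<bar>\<sigma>' - \<sigma>\<bar> < d\<close> M by (intro mult_left_mono) (auto simp: d_def)
      also have "\<dots> = m" using M by simp
      finally show ?thesis using \<open>\<And>s. s \<le> 0 \<Longrightarrow> u s = \<psi> s\<close>[OF r(1)] unfolding m_def by linarith
    qed
    have lips: "lip_on {r..t} M u" for r using that(4) by (rule lip_on_subset) auto
    have "\<bar>hdelay h k (- \<sigma>) t u - hdelay h k (- \<sigma>') t u\<bar> \<le> H * (\<bar>\<sigma>' - \<sigma>\<bar> * (1 / m) ^ k)"
    proof (cases "\<sigma> \<le> \<sigma>'")
      case True
      have "\<bar>hdelay h k (- \<sigma>') t u - hdelay h k (- \<sigma>) t u\<bar> \<le> H * ((- \<sigma> - - \<sigma>') * (1 / m) ^ k)"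
        using True s s0 that(3) by (intro hdelay_extend_window lips m big) auto
      then show ?thesis using True by (simp add: abs_minus_commute)
    next
      case False
      have "\<bar>hdelay h k (- \<sigma>) t u - hdelay h k (- \<sigma>') t u\<bar> \<le> H * ((- \<sigma>' - - \<sigma>) * (1 / m) ^ k)"
        using False that(1) s0 that(3) by (intro hdelay_extend_window lips m big) auto
      then show ?thesis using False by simp
    qed
    also have "\<dots> = H * (1 / m) ^ k * \<bar>\<sigma>' - \<sigma>\<bar>" by simp
    also have "\<dots> \<le> H * (1 / m) ^ k * (e / (H * (1 / m) ^ k))"
      using that(2) H m by (intro mult_left_mono) (auto simp: d_def)
    also have "\<dots> = e" using H m by simp
    finally show ?thesis .
  qed
  ultimately show ?thesis using that by blast
qed

end

section \<open>The initial value problem\<close>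

lemma C1_map_linearization:
  assumes "C1_map f" "0 < e"
  obtains d where "0 < d" "\<And>x y. norm x \<le> d \<Longrightarrow> norm y \<le> d \<Longrightarrow>
    norm (f x - f y - jacobian f (at 0) *v (x - y)) \<le> e * norm (x - y)"
proof -
  from assms(1) obtain f' where f': "\<And>x. (f has_derivative blinfun_apply (f' x)) (at x)"
    and cont: "continuous_on UNIV f'" unfolding C1_map_def by blast
  have "isCont f' 0" using cont by (simp add: continuous_on_eq_continuous_at)
  then obtain d where d: "0 < d" "\<And>x. dist x 0 < d \<Longrightarrow> dist (f' x) (f' 0) < e"
    unfolding continuous_at_eps_delta using assms(2) by auto
  have jac: "blinfun_apply (f' 0) = (\<lambda>x. jacobian f (at 0) *v x)"
  proof -
    have "f differentiable (at 0)" using f' by (rule differentiableI)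
    then have "(f has_derivative (\<lambda>h. jacobian f (at 0) *v h)) (at 0)" by (simp add: jacobian_works)
    with f'[of 0] show ?thesis by (rule has_derivative_unique)
  qed
  have "norm (f x - f y - jacobian f (at 0) *v (x - y)) \<le> e * norm (x - y)"
    if "norm x \<le> d / 2" "norm y \<le> d / 2" for x y
  proof -
    have "norm (f x - f y - blinfun_apply (f' 0) (x - y)) \<le> norm (x - y) * e"
    proof (rule differentiable_bound_linearization[where S = "cball 0 (d / 2)" and f' = "\<lambda>x. blinfun_apply (f' x)" and ?x0.0 = 0])
      fix t :: real assume "t \<in> {0..1}"
      then show "y + t *\<^sub>R (x - y) \<in> cball 0 (d / 2)"
        using convexD_alt[OF convex_cball, of y 0 "d/2" x t] that
        by (simp add: algebra_simps del: mem_cball_0)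
    next
      fix x assume "x \<in> cball (0::real^2) (d / 2)"
      then have "dist (f' x) (f' 0) < e" using d by (intro d(2)) auto
      then show "onorm (blinfun_apply (f' x) - blinfun_apply (f' 0)) \<le> e"
        by (simp add: dist_norm norm_blinfun.rep_eq minus_blinfun.rep_eq fun_diff_def)
    qed (use d f' in \<open>auto intro: has_derivative_at_withinI\<close>)
    then show ?thesis by (simp add: jac mult.commute)
  qed
  then show ?thesis using that[of "d/2"] d by simp
qed

lemma C1_map_lipschitz_ball:
  assumes "C1_map f"
  obtains L where "0 < L" "\<And>x y. norm x \<le> B \<Longrightarrow> norm y \<le> B \<Longrightarrow> norm (f x - f y) \<le> L * norm (x - y)"
    "\<And>x. norm x \<le> B \<Longrightarrow> norm (f x) \<le> L"
proof -
  from assms(1) obtain f' where f': "\<And>x. (f has_derivative blinfun_apply (f' x)) (at x)"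
    and cont: "continuous_on UNIV f'" unfolding C1_map_def by blast
  have contf: "continuous_on UNIV f" using f' by (meson differentiableI differentiable_imp_continuous_on differentiable_on_def differentiable_at_withinI)
  have "bounded (f' ` cball 0 B)" "bounded (f ` cball 0 B)"
    by (auto intro!: compact_imp_bounded compact_continuous_image continuous_on_subset[OF cont] continuous_on_subset[OF contf])
  then obtain L1 L2 where "\<forall>x\<in>f' ` cball 0 B. norm x \<le> L1" "\<forall>x\<in>f ` cball 0 B. norm x \<le> L2"
    unfolding bounded_iff by blast
  then have L: "\<And>x. norm x \<le> B \<Longrightarrow> norm (f' x) \<le> L1" "\<And>x. norm x \<le> B \<Longrightarrow> norm (f x) \<le> L2"
    by auto
  define L where "L = max 1 (max L1 L2)"
  have "norm (f x - f y) \<le> L * norm (x - y)" if "norm x \<le> B" "norm y \<le> B" for x y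
  proof (rule differentiable_bound[where S = "cball 0 B"])
    fix x assume "x \<in> cball (0::real^2) B"
    then have "norm (f' x) \<le> L" using L(1)[of x] by (simp add: L_def)
    then show "onorm (blinfun_apply (f' x)) \<le> L" by (simp add: norm_blinfun.rep_eq)
  qed (use that f' in \<open>auto intro: has_derivative_at_withinI\<close>)
  moreover have "norm (f x) \<le> L" if "norm x \<le> B" for x using L(2)[OF that] by (simp add: L_def)
  ultimately show ?thesis using that[of L] by (auto simp: L_def)
qed

lemma vector_derivative_bound:
  fixes y :: "real \<Rightarrow> 'a::real_normed_vector"
  assumes ab: "a \<le> b" and S: "{a..b} \<subseteq> S"
    and y: "\<And>x. x \<in> {a..b} \<Longrightarrow> (y has_vector_derivative y' x) (at x within S)"
    and p: "\<And>x. x \<in> {a..b} \<Longrightarrow> (p has_real_derivative p' x) (at x)"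
    and le: "\<And>x. x \<in> {a..b} \<Longrightarrow> norm (y' x) \<le> p' x"
  shows "norm (y b - y a) \<le> p b - p a"
proof (cases "a = b")
  case False
  then have ab: "a < b" using ab by simp
  have y': "(y has_vector_derivative y' x) (at x within {a..b})" if "x \<in> {a..b}" for x
    using y[OF that] S by (rule has_vector_derivative_within_subset)
  show ?thesis
  proof (rule differentiable_bound_general[OF ab, where f' = y' and \<phi>' = p'])
    show "continuous_on {a..b} y" using y' by (rule continuous_on_vector_derivative)
    show "continuous_on {a..b} p" using p by (meson DERIV_isCont continuous_at_imp_continuous_on)
    fix x assume x: "a < x" "x < b"
    then have "(y has_vector_derivative y' x) (at x within {a..b})" using y' by simp
    then show "(y has_vector_derivative y' x) (at x)" using x by (simp add: at_within_Icc_at)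
    show "(p has_vector_derivative p' x) (at x)" using p x
      by (simp add: has_real_derivative_iff_has_vector_derivative[symmetric])
  qed (use le in auto)
qed simp

lemma integral_has_vector_derivative_atLeast:
  fixes f :: "real \<Rightarrow> 'a::banach"
  assumes "continuous_on {0..} f" "0 \<le> t"
  shows "((\<lambda>t. integral {0..t} f) has_vector_derivative f t) (at t within {0..})"
proof -
  have "((\<lambda>t. integral {0..t} f) has_vector_derivative f t) (at t within {0..t + 1})"
    using assms by (intro integral_has_vector_derivative continuous_on_subset[OF assms(1)]) auto
  moreover have "at t within {0..t + 1} = at t within {0..}"
    by (rule at_within_nhd[of t "{..<t + 1}"]) auto
  ultimately show ?thesis by simp
qed

text \<open>The bound on \<open>d'\<close> involves the maximum of \<open>d\<close> over the past,
  so the estimate is obtained by iteration: integrating \<open>L * K * exp (2 * L * x)\<close> gives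
  \<open>K / 2 * exp (2 * L * t)\<close> up to a constant. Each round halves the contribution of the
  a priori bound \<open>C\<close>, while that of the initial value stays at most
  \<open>2 * norm (d 0)\<close>.\<close>

lemma delay_gronwall:
  fixes d :: "real \<Rightarrow> 'a::real_normed_vector"
  assumes L: "0 < L" and T: "0 \<le> T"
    and d: "\<And>t. t \<in> {0..T} \<Longrightarrow> (d has_vector_derivative d' t) (at t within {0..})"
    and le: "\<And>t X. t \<in> {0..T} \<Longrightarrow> (\<And>s. s \<in> {0..t} \<Longrightarrow> norm (d s) \<le> X) \<Longrightarrow> norm (d' t) \<le> L * X"
    and t: "t \<in> {0..T}"
  shows "norm (d t) \<le> 2 * norm (d 0) * exp (2 * L * t)"
proof -
  have "continuous_on {0..T} d"
    by (rule continuous_on_vector_derivative) (rule has_vector_derivative_within_subset[OF d], auto)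
  then have "bounded (d ` {0..T})" by (intro compact_imp_bounded compact_continuous_image) auto
  then obtain C where "\<forall>x\<in>d ` {0..T}. norm x \<le> C" unfolding bounded_iff by blast
  then have C: "\<And>t. t \<in> {0..T} \<Longrightarrow> norm (d t) \<le> C" by blast
  have C0: "0 \<le> C" using C[OF t] norm_ge_zero order_trans by blast
  have *: "\<forall>t\<in>{0..T}. norm (d t) \<le> (2 * norm (d 0) + C / 2 ^ n) * exp (2 * L * t)" for n
  proof (induction n)
    case 0
    show ?case
    proof
      fix t assume t: "t \<in> {0..T}"
      have "norm (d t) \<le> (2 * norm (d 0) + C) * 1" using C[OF t] norm_ge_zero[of "d 0"]
        unfolding mult_1_right by linarith
      also have "\<dots> \<le> (2 * norm (d 0) + C) * exp (2 * L * t)"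
        using t L C0 by (intro mult_left_mono) auto
      finally show "norm (d t) \<le> (2 * norm (d 0) + C / 2 ^ 0) * exp (2 * L * t)" by simp
    qed
  next
    case (Suc n)
    let ?K = "2 * norm (d 0) + C / 2 ^ n"
    have K: "0 \<le> ?K" using C0 by simp
    show ?case
    proof
      fix t assume t: "t \<in> {0..T}"
      have "norm (d t - d 0) \<le> ?K / 2 * exp (2 * L * t) - ?K / 2 * exp (2 * L * 0)"
      proof (rule vector_derivative_bound[where S = "{0..}" and y' = d' and p' = "\<lambda>x. L * (?K * exp (2 * L * x))"])
        fix x assume x: "x \<in> {0..t}"
        show "(d has_vector_derivative d' x) (at x within {0..})" using d x t by auto
        show "((\<lambda>x. ?K / 2 * exp (2 * L * x)) has_real_derivative L * (?K * exp (2 * L * x))) (at x)"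
          by (auto intro!: derivative_eq_intros)
        show "norm (d' x) \<le> L * (?K * exp (2 * L * x))"
        proof (rule le)
          fix s assume s: "s \<in> {0..x}"
          then have "norm (d s) \<le> ?K * exp (2 * L * s)" using Suc x t by auto
          also have "\<dots> \<le> ?K * exp (2 * L * x)" using s L K by (intro mult_left_mono) auto
          finally show "norm (d s) \<le> ?K * exp (2 * L * x)" .
        qed (use x t in auto)
      qed (use t in auto)
      then have "norm (d t) \<le> norm (d 0) + ?K / 2 * exp (2 * L * t) - ?K / 2"
        using norm_triangle_ineq2[of "d t" "d 0"] by simp
      also have "\<dots> \<le> ?K / 2 * exp (2 * L * t)" using C0 by simp
      also have "\<dots> \<le> (2 * norm (d 0) + C / 2 ^ Suc n) * exp (2 * L * t)"
        by (intro mult_right_mono) auto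
      finally show "norm (d t) \<le> (2 * norm (d 0) + C / 2 ^ Suc n) * exp (2 * L * t)" .
    qed
  qed
  have "(\<lambda>n. (2 * norm (d 0) + C * (1 / 2) ^ n) * exp (2 * L * t)) \<longlonglongrightarrow> (2 * norm (d 0) + C * 0) * exp (2 * L * t)"
    by (intro tendsto_intros LIMSEQ_power_zero) auto
  then have "norm (d t) \<le> (2 * norm (d 0) + C * 0) * exp (2 * L * t)"
    by (rule LIMSEQ_le_const) (use * t in \<open>auto simp: power_divide\<close>)
  then show ?thesis by simp
qed

section \<open>Solutions in shifted time: existence, uniqueness, dependence on the initial
  value\<close>

locale delay_system = delay_kernel h k M H \<eta> \<sigma>\<^sub>0
  for h k M H \<eta> \<sigma>\<^sub>0 +
  fixes f g :: "real^2 \<Rightarrow> real^2" and c :: "real^2 \<Rightarrow> real" and lam :: real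
  assumes f: "C1_map f" and g: "C1_map g" and c_lip: "\<exists>L. L-lipschitz_on UNIV c"
    and c01: "\<And>x. 0 \<le> c x" "\<And>x. c x \<le> 1" and lam: "0 < lam"
    and bound: "\<And>t \<phi>. 0 \<le> t \<Longrightarrow> \<phi> \<in> Btilde lam \<Longrightarrow> norm (c (\<phi> 0) *\<^sub>R delay_rhs f g h k t \<phi>) \<le> M"
begin

definition rhs :: "real \<Rightarrow> real \<Rightarrow> (real \<Rightarrow> real^2) \<Rightarrow> real^2" where
  "rhs \<sigma> t y = c (y t) *\<^sub>R (f (y t) + hdelay h k (- \<sigma>) t (\<lambda>s. y s $ 1) *\<^sub>R g (y t))"

definition extends :: "segment \<Rightarrow> (real \<Rightarrow> real^2) \<Rightarrow> bool" where
  "extends \<phi> y \<longleftrightarrow> (\<forall>\<theta>\<le>0. y \<theta> = \<phi> \<theta>)"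

text \<open>Solutions in the time \<open>t - \<sigma>\<close>, so that the initial segment sits on \<open>(-\<infinity>, 0]\<close> and the delay
  integral starts at \<open>-\<sigma>\<close>.\<close>
definition sol :: "real \<Rightarrow> segment \<Rightarrow> (real \<Rightarrow> real^2) \<Rightarrow> bool" where
  "sol \<sigma> \<phi> y \<longleftrightarrow> extends \<phi> y \<and>
     (\<forall>t\<ge>0. (y has_vector_derivative rhs \<sigma> t y) (at t within {0..}))"

text \<open>Only the first component enters the delay term. Requiring the Lipschitz bound for this
  component alone gives a class that contains \<open>\<psi> + w\<close> for every \<open>\<psi>\<close> in the domain of the graph.\<close>
definition hist :: "segment \<Rightarrow> bool" where
  "hist \<phi> \<longleftrightarrow> \<phi> \<in> Btilde lam \<and> lip_on {..0} M (\<lambda>s. \<phi> s $ 1)"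

definition lip_path :: "(real \<Rightarrow> real^2) \<Rightarrow> bool" where
  "lip_path y \<longleftrightarrow> (\<forall>s\<ge>0. \<forall>t\<ge>0. norm (y s - y t) \<le> M * \<bar>s - t\<bar>)"

lemma extends_continuous:
  assumes "\<phi> \<in> Btilde lam" "extends \<phi> y" "continuous_on {0..} y"
  shows "continuous_on UNIV y"
proof -
  have "continuous_on {..0} \<phi>" using assms(1) by (simp add: Btilde_def)
  then have "continuous_on {..0} y" by (rule continuous_on_eq) (use assms(2) in \<open>auto simp: extends_def\<close>)
  then have "continuous_on ({..0} \<union> {0..}) y" using assms(3) by (intro continuous_on_closed_Un) auto
  moreover have "{..0} \<union> {0..} = (UNIV :: real set)" by auto
  ultimately show ?thesis by simp
qed

lemma seg_Btilde:
  assumes phi: "\<phi> \<in> Btilde lam" and y: "extends \<phi> y" "continuous_on {0..} y" and t: "0 \<le> t"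
  shows "seg y t \<in> Btilde lam"
proof -
  have cont: "continuous_on UNIV y" using extends_continuous assms by blast
  have 1: "continuous_on {..0} (seg y t)"
  proof -
    have "continuous_on {..0} (\<lambda>\<theta>. y (t + \<theta>))"
      by (intro continuous_on_compose2[OF cont] continuous_intros) auto
    then show ?thesis by (rule continuous_on_eq) (auto simp: seg_def)
  qed
  have "bounded (y ` {0..t})"
    by (intro compact_imp_bounded compact_continuous_image continuous_on_subset[OF cont]) auto
  then obtain B where "\<forall>x\<in>y ` {0..t}. norm x \<le> B" unfolding bounded_iff by blast
  then have B: "\<And>s. s \<in> {0..t} \<Longrightarrow> norm (y s) \<le> B" by blast
  have B0: "0 \<le> B" using order_trans[OF norm_ge_zero B[of 0]] t by simp
  from phi obtain K where K: "\<And>\<theta>. \<theta> \<le> 0 \<Longrightarrow> exp (lam * \<theta>) * norm (\<phi> \<theta>) \<le> K"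
    unfolding Btilde_def bdd_above_def by auto
  have K0: "0 \<le> K" using order_trans[OF norm_ge_zero, of "\<phi> 0" K] K[of 0] by simp
  have "exp (lam * \<theta>) * norm (y (t + \<theta>)) \<le> B + K" if th: "\<theta> \<le> 0" for \<theta>
  proof (cases "t + \<theta> \<le> 0")
    case True
    have "exp (lam * \<theta>) * norm (y (t + \<theta>)) = exp (- (lam * t)) * (exp (lam * (t + \<theta>)) * norm (\<phi> (t + \<theta>)))"
      using y(1) True by (simp add: extends_def algebra_simps flip: exp_add)
    also have "\<dots> \<le> 1 * K" using K[OF True] K0 lam t by (intro mult_mono) auto
    finally show ?thesis using B0 by simp
  next
    case False
    have "exp (lam * \<theta>) * norm (y (t + \<theta>)) \<le> 1 * B"
      using B[of "t + \<theta>"] False th lam B0 by (intro mult_mono) (auto simp: mult_nonneg_nonpos)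
    then show ?thesis using K0 by simp
  qed
  then have "bdd_above ((\<lambda>\<theta>. exp (lam * \<theta>) * norm (seg y t \<theta>)) ` {..0})"
    by (intro bdd_aboveI[of _ "B + K"]) (auto simp: seg_def)
  with 1 show ?thesis by (simp add: Btilde_def seg_def)
qed

lemma hdelay_shift:
  "hdelay h k (a + s) (b + s) u = hdelay h k a b (\<lambda>r. u (r + s))"
proof -
  have "(\<exists>x\<in>{a + s..b + s}. u x = 0) = (\<exists>x\<in>{a..b}. u (x + s) = 0)"
  proof
    assume "\<exists>x\<in>{a + s..b + s}. u x = 0"
    then obtain x where "x \<in> {a + s..b + s}" "u x = 0" by blast
    then show "\<exists>x\<in>{a..b}. u (x + s) = 0" by (intro bexI[of _ "x - s"]) auto
  qed auto
  moreover have "integral {a + s..b + s} (\<lambda>r. 1 / \<bar>u r\<bar> ^ k) = integral {a..b} (\<lambda>r. 1 / \<bar>u (r + s)\<bar> ^ k)"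
    using integral_shift_Icc_real[of a b "\<lambda>r. 1 / \<bar>u r\<bar> ^ k" s] by (simp add: o_def add.commute)
  ultimately show ?thesis by (simp add: hdelay_def)
qed

lemma hdelay_cong: "(\<And>s. s \<in> {l..t} \<Longrightarrow> u s = v s) \<Longrightarrow> hdelay h k l t u = hdelay h k l t v"
proof -
  assume eq: "\<And>s. s \<in> {l..t} \<Longrightarrow> u s = v s"
  then have "integral {l..t} (\<lambda>s. 1 / \<bar>u s\<bar> ^ k) = integral {l..t} (\<lambda>s. 1 / \<bar>v s\<bar> ^ k)"
    by (intro integral_cong) auto
  with eq show ?thesis by (auto simp: hdelay_def)
qed

lemma delay_rhs_seg:
  "delay_rhs f g h k s (seg x t) = f (x t) + hdelay h k (t - s) t (\<lambda>r. x r $ 1) *\<^sub>R g (x t)"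
proof -
  have "delay_rhs f g h k s (seg x t) = f (x t) + hdelay h k (- s) 0 (\<lambda>r. seg x t r $ 1) *\<^sub>R g (x t)"
    by (simp add: delay_rhs_def hdelay_def seg_def)
  also have "hdelay h k (- s) 0 (\<lambda>r. seg x t r $ 1) = hdelay h k (- s) 0 (\<lambda>r. x (r + t) $ 1)"
    by (rule hdelay_cong) (auto simp: seg_def add.commute)
  also have "\<dots> = hdelay h k (t - s) t (\<lambda>r. x r $ 1)"
    using hdelay_shift[of "- s" t 0 "\<lambda>r. x r $ 1"] by simp
  finally show ?thesis .
qed

lemma rhs_eq: "rhs \<sigma> t y = c (seg y t 0) *\<^sub>R delay_rhs f g h k (\<sigma> + t) (seg y t)"
  by (simp add: delay_rhs_seg rhs_def) (simp add: seg_def)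

lemma rhs_le_M:
  assumes "\<phi> \<in> Btilde lam" "extends \<phi> y" "continuous_on {0..} y" "0 \<le> t" "0 \<le> \<sigma>"
  shows "norm (rhs \<sigma> t y) \<le> M"
  unfolding rhs_eq using assms by (intro bound seg_Btilde) auto

lemma lip_path_continuous: "lip_path y \<Longrightarrow> continuous_on {0..} y"
  using M unfolding lip_path_def by (intro lipschitz_continuous_on[of _ _ M]) auto

lemma lip_on_UNIV:
  assumes "hist \<phi>" "extends \<phi> y" "lip_path y"
  shows "lip_on UNIV M (\<lambda>s. y s $ 1)"
proof -
  have neg: "\<bar>y a $ 1 - y b $ 1\<bar> \<le> M * \<bar>a - b\<bar>" if "a \<le> 0" "b \<le> 0" for a b
    using assms(1,2) that by (auto simp: hist_def lip_on_def extends_def)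
  have pos: "\<bar>y a $ 1 - y b $ 1\<bar> \<le> M * \<bar>a - b\<bar>" if "0 \<le> a" "0 \<le> b" for a b
    using assms(3)[unfolded lip_path_def, rule_format, OF that] component_le_norm_cart[of "y a - y b" 1]
    by (simp add: vector_minus_component)
  have mix: "\<bar>y a $ 1 - y b $ 1\<bar> \<le> M * \<bar>a - b\<bar>" if "a \<le> 0" "0 \<le> b" for a b
  proof -
    have "\<bar>y a $ 1 - y b $ 1\<bar> \<le> M * \<bar>a - 0\<bar> + M * \<bar>0 - b\<bar>"
      using neg[of a 0] pos[of 0 b] that by auto
    also have "\<dots> = M * \<bar>a - b\<bar>" using that by (simp add: algebra_simps)
    finally show ?thesis .
  qed
  have "\<bar>y a $ 1 - y b $ 1\<bar> \<le> M * \<bar>a - b\<bar>" for a b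
  proof (cases "a \<le> 0"; cases "b \<le> 0")
    assume "\<not> a \<le> 0" "b \<le> 0"
    then show ?thesis using mix[of b a] by (simp add: abs_minus_commute)
  qed (use neg mix pos in auto)
  then show ?thesis unfolding lip_on_def by blast
qed

lemma lip_path_norm_le:
  assumes "extends \<phi> y" "lip_path y" "0 \<le> t"
  shows "norm (y t) \<le> norm (\<phi> 0) + M * t"
proof -
  have "norm (y t - y 0) \<le> M * \<bar>t - 0\<bar>" using assms unfolding lip_path_def by blast
  then show ?thesis using assms(1,3) norm_triangle_ineq2[of "y t" "y 0"] by (simp add: extends_def)
qed

lemma rhs_continuous:
  assumes "hist \<phi>" "extends \<phi> y" "lip_path y" "\<sigma>\<^sub>0 \<le> \<sigma>"
  shows "continuous_on {0..} (\<lambda>t. rhs \<sigma> t y)"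
proof -
  have y: "continuous_on {0..} y" using assms lip_path_continuous by blast
  obtain L where "L-lipschitz_on UNIV c" using c_lip by blast
  then have "continuous_on UNIV c" by (rule lipschitz_on_continuous_on)
  moreover have "continuous_on UNIV f" "continuous_on UNIV g"
    using f g unfolding C1_map_def
    by (meson differentiableI differentiable_imp_continuous_on differentiable_on_def differentiable_at_withinI)+
  moreover have "continuous_on {0..} (\<lambda>t. hdelay h k (- \<sigma>) t (\<lambda>s. y s $ 1))"
    by (rule continuous_on_subset[OF continuous_on_hdelay])
      (use lip_on_UNIV[OF assms(1-3)] assms(4) in \<open>auto intro: lip_on_subset\<close>)
  ultimately show ?thesis unfolding rhs_def
    by (intro continuous_intros continuous_on_compose2[OF _ y]) auto
qed

definition rhs_lip :: "real \<Rightarrow> real \<Rightarrow> bool" where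
  "rhs_lip B L \<longleftrightarrow> 0 < L \<and> (\<forall>\<sigma> t y1 y2 X. \<sigma>\<^sub>0 \<le> t + \<sigma> \<longrightarrow>
      lip_on {- \<sigma>..t} M (\<lambda>s. y1 s $ 1) \<longrightarrow> lip_on {- \<sigma>..t} M (\<lambda>s. y2 s $ 1) \<longrightarrow>
      norm (y1 t) \<le> B \<longrightarrow> norm (y2 t) \<le> B \<longrightarrow> norm (y1 t - y2 t) \<le> X \<longrightarrow>
      (\<forall>s\<in>{- \<sigma>..t}. \<bar>y1 s $ 1 - y2 s $ 1\<bar> \<le> X) \<longrightarrow> norm (rhs \<sigma> t y1 - rhs \<sigma> t y2) \<le> L * X)"

lemma rhs_lipD:
  assumes "rhs_lip B L"
  shows "0 < L" "\<sigma>\<^sub>0 \<le> t + \<sigma> \<Longrightarrow> lip_on {- \<sigma>..t} M (\<lambda>s. y1 s $ 1) \<Longrightarrow> lip_on {- \<sigma>..t} M (\<lambda>s. y2 s $ 1) \<Longrightarrow>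
      norm (y1 t) \<le> B \<Longrightarrow> norm (y2 t) \<le> B \<Longrightarrow> norm (y1 t - y2 t) \<le> X \<Longrightarrow>
      (\<And>s. s \<in> {- \<sigma>..t} \<Longrightarrow> \<bar>y1 s $ 1 - y2 s $ 1\<bar> \<le> X) \<Longrightarrow> norm (rhs \<sigma> t y1 - rhs \<sigma> t y2) \<le> L * X"
  using assms unfolding rhs_lip_def by blast+

lemma rhs_lipschitz:
  fixes B :: real
  assumes "0 \<le> B"
  obtains L where "rhs_lip B L"
proof -
  obtain Lf where Lf: "0 < Lf" "\<And>x y. norm x \<le> B \<Longrightarrow> norm y \<le> B \<Longrightarrow> norm (f x - f y) \<le> Lf * norm (x - y)"
    "\<And>x. norm x \<le> B \<Longrightarrow> norm (f x) \<le> Lf" using C1_map_lipschitz_ball[OF f] by blast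
  obtain Lg where Lg: "0 < Lg" "\<And>x y. norm x \<le> B \<Longrightarrow> norm y \<le> B \<Longrightarrow> norm (g x - g y) \<le> Lg * norm (x - y)"
    "\<And>x. norm x \<le> B \<Longrightarrow> norm (g x) \<le> Lg" using C1_map_lipschitz_ball[OF g] by blast
  obtain Lc where "Lc-lipschitz_on UNIV c" using c_lip by blast
  then have Lc: "0 \<le> Lc" "\<And>x y. \<bar>c x - c y\<bar> \<le> Lc * norm (x - y)"
    by (auto simp: lipschitz_on_def dist_norm)
  define Kh where "Kh = K1 * B powr (pexp - 1)"
  have Kh: "0 \<le> Kh" using K1 by (simp add: Kh_def)
  \<comment> \<open>Product rule: \<open>Lf + H * Lg\<close> bounds the bracket in
    \<open>rhs\<close> and multiplies the Lipschitz constant of \<open>c\<close>; the second group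
    is the Lipschitz constant of the bracket, with \<open>Kh\<close> from the delay term.\<close>
  define L where "L = Lc * (Lf + H * Lg) + (Lf + (Kh * Lg + H * Lg))"
  have "0 \<le> Lc * (Lf + H * Lg)" "0 \<le> Kh * Lg" "0 \<le> H * Lg" using Lf(1) Lg(1) Lc(1) H Kh by auto
  then have "0 < L" using Lf(1) unfolding L_def by linarith
  moreover have "norm (rhs \<sigma> t y1 - rhs \<sigma> t y2) \<le> L * X"
    if t: "\<sigma>\<^sub>0 \<le> t + \<sigma>" and lip: "lip_on {- \<sigma>..t} M (\<lambda>s. y1 s $ 1)" "lip_on {- \<sigma>..t} M (\<lambda>s. y2 s $ 1)"
      and B: "norm (y1 t) \<le> B" "norm (y2 t) \<le> B" and X: "norm (y1 t - y2 t) \<le> X"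
      and X1: "\<forall>s\<in>{- \<sigma>..t}. \<bar>y1 s $ 1 - y2 s $ 1\<bar> \<le> X" for \<sigma> t y1 y2 X
  proof -
    let ?h = "\<lambda>y::real \<Rightarrow> real^2. hdelay h k (- \<sigma>) t (\<lambda>s. y s $ 1)"
    let ?F = "\<lambda>y. f (y t) + ?h y *\<^sub>R g (y t)"
    have X0: "0 \<le> X" using X norm_ge_zero order_trans by blast
    have h1: "\<bar>?h y1\<bar> \<le> H" "\<bar>?h y2\<bar> \<le> H" using hdelay_le_H lip by blast+
    have h2: "\<bar>?h y1 - ?h y2\<bar> \<le> Kh * X" unfolding Kh_def
      using B component_le_norm_cart[of "y1 t" 1] component_le_norm_cart[of "y2 t" 1] t
      by (intro hdelay_lipschitz lip X1[rule_format]) auto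
    have F1: "norm (?F y1) \<le> Lf + H * Lg"
    proof -
      have "norm (?F y1) \<le> norm (f (y1 t)) + \<bar>?h y1\<bar> * norm (g (y1 t))"
        by (rule norm_triangle_le) simp
      also have "\<dots> \<le> Lf + H * Lg" using Lf(3)[OF B(1)] Lg(3)[OF B(1)] h1 H by (intro add_mono mult_mono) auto
      finally show ?thesis .
    qed
    have dX: "K * norm (y1 t - y2 t) \<le> K * X" if "0 \<le> K" for K using X that by (rule mult_left_mono)
    have f2: "norm (f (y1 t) - f (y2 t)) \<le> Lf * X" using Lf(2)[OF B] dX[of Lf] Lf(1) by linarith
    have g2: "norm (g (y1 t) - g (y2 t)) \<le> Lg * X" using Lg(2)[OF B] dX[of Lg] Lg(1) by linarith
    have c2: "\<bar>c (y1 t) - c (y2 t)\<bar> \<le> Lc * X" using Lc(2)[of "y1 t" "y2 t"] dX[of Lc] Lc(1) by linarith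
    have F2: "norm (?F y1 - ?F y2) \<le> Lf * X + (Kh * X * Lg + H * (Lg * X))"
    proof -
      have "?F y1 - ?F y2 = (f (y1 t) - f (y2 t)) + ((?h y1 - ?h y2) *\<^sub>R g (y1 t) + ?h y2 *\<^sub>R (g (y1 t) - g (y2 t)))"
        by (simp add: algebra_simps)
      then have "norm (?F y1 - ?F y2) \<le> norm (f (y1 t) - f (y2 t)) +
          (\<bar>?h y1 - ?h y2\<bar> * norm (g (y1 t)) + \<bar>?h y2\<bar> * norm (g (y1 t) - g (y2 t)))"
        by (simp only:) (rule order_trans[OF norm_triangle_ineq add_left_mono[OF order_trans[OF norm_triangle_ineq]]], simp)
      also have "\<dots> \<le> Lf * X + (Kh * X * Lg + H * (Lg * X))"
        using f2 g2 h1 h2 Lg(3)[OF B(1)] H Kh X0 by (intro add_mono mult_mono) auto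
      finally show ?thesis .
    qed
    have "rhs \<sigma> t y1 - rhs \<sigma> t y2 = (c (y1 t) - c (y2 t)) *\<^sub>R ?F y1 + c (y2 t) *\<^sub>R (?F y1 - ?F y2)"
      by (simp add: rhs_def algebra_simps)
    then have "norm (rhs \<sigma> t y1 - rhs \<sigma> t y2) \<le> \<bar>c (y1 t) - c (y2 t)\<bar> * norm (?F y1) + \<bar>c (y2 t)\<bar> * norm (?F y1 - ?F y2)"
      by (simp only:) (rule order_trans[OF norm_triangle_ineq], simp)
    also have "\<dots> \<le> Lc * X * (Lf + H * Lg) + 1 * (Lf * X + (Kh * X * Lg + H * (Lg * X)))"
      using c2 F1 F2 c01 Lc(1) X0 by (intro add_mono mult_mono) auto
    also have "\<dots> = L * X" by (simp add: L_def algebra_simps)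
    finally show ?thesis .
  qed
  ultimately have "rhs_lip B L" unfolding rhs_lip_def by blast
  then show ?thesis by (rule that)
qed

text \<open>The derivative of \<open>y\<close> is the field along a possibly different path
  \<open>x\<close>, so that Picard iterates and solutions (\<open>x = y\<close>) are covered
  together; the bound on the speed is the global one provided by the cut-off.\<close>

lemma lip_path_of_derivative:
  assumes phi: "hist \<phi>" and s: "0 \<le> \<sigma>" and x: "extends \<phi> x" "continuous_on {0..} x"
    and d: "\<And>t. 0 \<le> t \<Longrightarrow> (y has_vector_derivative rhs \<sigma> t x) (at t within {0..})"
  shows "lip_path y"
proof -
  have le: "norm (y q - y p) \<le> M * (q - p)" if "0 \<le> p" "p \<le> q" for p q
  proof -
    have "norm (y q - y p) \<le> M * q - M * p"
    proof (rule vector_derivative_bound[where S = "{0..}" and y' = "\<lambda>t. rhs \<sigma> t x" and p' = "\<lambda>_. M"])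
      fix t assume t: "t \<in> {p..q}"
      show "(y has_vector_derivative rhs \<sigma> t x) (at t within {0..})" using d t that by auto
      show "((*) M has_real_derivative M) (at t)" by (auto intro!: derivative_eq_intros)
      show "norm (rhs \<sigma> t x) \<le> M"
        by (rule rhs_le_M[OF _ x]) (use phi t that s in \<open>auto simp: hist_def\<close>)
    qed (use that in auto)
    then show ?thesis by (simp add: algebra_simps)
  qed
  show ?thesis unfolding lip_path_def
  proof (intro allI impI)
    fix s t :: real assume "0 \<le> s" "0 \<le> t"
    then show "norm (y s - y t) \<le> M * \<bar>s - t\<bar>"
      using le[of s t] le[of t s] by (cases "s \<le> t") (auto simp: norm_minus_commute)
  qed
qed

lemma sol_lip_path:
  assumes phi: "hist \<phi>" and s: "0 \<le> \<sigma>" and y: "sol \<sigma> \<phi> y"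
  shows "lip_path y"
proof (rule lip_path_of_derivative[OF phi s])
  show d: "(y has_vector_derivative rhs \<sigma> t y) (at t within {0..})" if "0 \<le> t" for t
    using y that by (simp add: sol_def)
  show "continuous_on {0..} y"
    by (rule continuous_on_vector_derivative) (use d in auto)
qed (use y in \<open>simp add: sol_def\<close>)

text \<open>Histories that agree in the first component are exactly the ones compared in shooting.
  Their delay terms differ only through the solutions after time 0, so the Gronwall inequality
  applies with the distance of the present values at time 0 as its initial datum.\<close>

lemma sol_dependence:
  assumes s: "\<sigma>\<^sub>0 \<le> \<sigma>" and T: "0 \<le> T" and B0: "0 \<le> B0"
  obtains L where "0 < L"
    "\<And>\<phi>1 \<phi>2 y1 y2 t. hist \<phi>1 \<Longrightarrow> hist \<phi>2 \<Longrightarrow> sol \<sigma> \<phi>1 y1 \<Longrightarrow> sol \<sigma> \<phi>2 y2 \<Longrightarrow>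
      (\<And>s. s \<le> 0 \<Longrightarrow> \<phi>1 s $ 1 = \<phi>2 s $ 1) \<Longrightarrow> norm (\<phi>1 0) \<le> B0 \<Longrightarrow> norm (\<phi>2 0) \<le> B0 \<Longrightarrow>
      t \<in> {0..T} \<Longrightarrow> norm (y1 t - y2 t) \<le> 2 * norm (\<phi>1 0 - \<phi>2 0) * exp (2 * L * t)"
proof -
  have "0 \<le> B0 + M * T" using T B0 M by simp
  then obtain L where L: "rhs_lip (B0 + M * T) L" using rhs_lipschitz by blast
  note L = rhs_lipD[OF L]
  have "norm (y1 t - y2 t) \<le> 2 * norm (\<phi>1 0 - \<phi>2 0) * exp (2 * L * t)"
    if h: "hist \<phi>1" "hist \<phi>2" and y: "sol \<sigma> \<phi>1 y1" "sol \<sigma> \<phi>2 y2"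
      and eq: "\<And>s. s \<le> 0 \<Longrightarrow> \<phi>1 s $ 1 = \<phi>2 s $ 1" and B: "norm (\<phi>1 0) \<le> B0" "norm (\<phi>2 0) \<le> B0"
      and t: "t \<in> {0..T}" for \<phi>1 \<phi>2 y1 y2 t
  proof -
    have lp: "lip_path y1" "lip_path y2" using sol_lip_path h y s s0 by (meson less_imp_le order_trans)+
    have ext: "extends \<phi>1 y1" "extends \<phi>2 y2" using y by (auto simp: sol_def)
    have lips: "lip_on S M (\<lambda>s. y1 s $ 1)" "lip_on S M (\<lambda>s. y2 s $ 1)" for S
      using lip_on_UNIV h ext lp lip_on_subset by blast+
    have "norm (y1 t - y2 t) \<le> 2 * norm (y1 0 - y2 0) * exp (2 * L * t)"
    proof (rule delay_gronwall[where d = "\<lambda>t. y1 t - y2 t" and d' = "\<lambda>t. rhs \<sigma> t y1 - rhs \<sigma> t y2", OF L(1) T _ _ t])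
      fix t assume "t \<in> {0..T}"
      then show "((\<lambda>t. y1 t - y2 t) has_vector_derivative rhs \<sigma> t y1 - rhs \<sigma> t y2) (at t within {0..})"
        using y by (intro has_vector_derivative_diff) (auto simp: sol_def)
    next
      fix t X assume t: "t \<in> {0..T}" and X: "\<And>s. s \<in> {0..t} \<Longrightarrow> norm (y1 s - y2 s) \<le> X"
      have X0: "0 \<le> X" using order_trans[OF norm_ge_zero X[of t]] t by simp
      have MT: "M * t \<le> M * T" using t M by simp
      show "norm (rhs \<sigma> t y1 - rhs \<sigma> t y2) \<le> L * X"
      proof (rule L(2)[OF _ lips])
        show "norm (y1 t) \<le> B0 + M * T" using lip_path_norm_le[OF ext(1) lp(1), of t] t MT B by simp
        show "norm (y2 t) \<le> B0 + M * T" using lip_path_norm_le[OF ext(2) lp(2), of t] t MT B by simp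
        show "norm (y1 t - y2 t) \<le> X" using X t by auto
        fix s assume s: "s \<in> {- \<sigma>..t}"
        show "\<bar>y1 s $ 1 - y2 s $ 1\<bar> \<le> X"
        proof (cases "s \<le> 0")
          case True
          then show ?thesis using ext eq[OF True] X0 by (simp add: extends_def)
        next
          case False
          then show ?thesis using X[of s] s component_le_norm_cart[of "y1 s - y2 s" 1] by auto
        qed
      qed (use s t in auto)
    qed
    then show ?thesis using ext by (simp add: extends_def)
  qed
  with L(1) show ?thesis using that by blast
qed

lemma sol_unique:
  assumes "hist \<phi>" "\<sigma>\<^sub>0 \<le> \<sigma>" "sol \<sigma> \<phi> y1" "sol \<sigma> \<phi> y2"
  shows "y1 = y2"
proof
  fix t
  show "y1 t = y2 t"
  proof (cases "t \<le> 0")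
    case True
    then show ?thesis using assms(3,4) by (simp add: sol_def extends_def)
  next
    case False
    then have T: "0 \<le> t" by simp
    obtain L where "0 < L" and le:
      "\<And>\<phi>1 \<phi>2 y1 y2 s. hist \<phi>1 \<Longrightarrow> hist \<phi>2 \<Longrightarrow> sol \<sigma> \<phi>1 y1 \<Longrightarrow> sol \<sigma> \<phi>2 y2 \<Longrightarrow>
      (\<And>s. s \<le> 0 \<Longrightarrow> \<phi>1 s $ 1 = \<phi>2 s $ 1) \<Longrightarrow> norm (\<phi>1 0) \<le> norm (\<phi> 0) \<Longrightarrow> norm (\<phi>2 0) \<le> norm (\<phi> 0) \<Longrightarrow>
      s \<in> {0..t} \<Longrightarrow> norm (y1 s - y2 s) \<le> 2 * norm (\<phi>1 0 - \<phi>2 0) * exp (2 * L * s)"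
      using sol_dependence[OF assms(2) T norm_ge_zero[of "\<phi> 0"]] by blast
    from le[OF assms(1,1,3,4), of t] T show ?thesis by simp
  qed
qed

primrec picard :: "real \<Rightarrow> segment \<Rightarrow> nat \<Rightarrow> real \<Rightarrow> real^2" where
  "picard \<sigma> \<phi> 0 = (\<lambda>t. if t \<le> 0 then \<phi> t else \<phi> 0)"
| "picard \<sigma> \<phi> (Suc n) = (\<lambda>t. if t \<le> 0 then \<phi> t else \<phi> 0 + integral {0..t} (\<lambda>s. rhs \<sigma> s (picard \<sigma> \<phi> n)))"

lemma integral_path:
  assumes h: "hist \<phi>" and s: "\<sigma>\<^sub>0 \<le> \<sigma>" and x: "extends \<phi> x" "lip_path x"
    and y: "y = (\<lambda>t. if t \<le> 0 then \<phi> t else \<phi> 0 + integral {0..t} (\<lambda>s. rhs \<sigma> s x))"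
  shows "extends \<phi> y" "lip_path y"
    "\<And>t. 0 \<le> t \<Longrightarrow> (y has_vector_derivative rhs \<sigma> t x) (at t within {0..})"
proof -
  show "extends \<phi> y" by (simp add: y extends_def)
  have cont: "continuous_on {0..} (\<lambda>t. rhs \<sigma> t x)" using rhs_continuous[OF h x s] .
  have d: "(y has_vector_derivative rhs \<sigma> t x) (at t within {0..})" if t: "0 \<le> t" for t
  proof (rule has_vector_derivative_transform)
    show "((\<lambda>t. \<phi> 0 + integral {0..t} (\<lambda>s. rhs \<sigma> s x)) has_vector_derivative rhs \<sigma> t x) (at t within {0..})"
      using has_vector_derivative_add[OF has_vector_derivative_const[of "\<phi> 0"] integral_has_vector_derivative_atLeast[OF cont t]] by simp
  qed (use t in \<open>auto simp: y\<close>)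
  then show "\<And>t. 0 \<le> t \<Longrightarrow> (y has_vector_derivative rhs \<sigma> t x) (at t within {0..})" .
  show "lip_path y"
    using s s0 by (intro lip_path_of_derivative[OF h _ x(1) lip_path_continuous[OF x(2)] d]) auto
qed

lemma picard_path:
  assumes h: "hist \<phi>" and s: "\<sigma>\<^sub>0 \<le> \<sigma>"
  shows "extends \<phi> (picard \<sigma> \<phi> n) \<and> lip_path (picard \<sigma> \<phi> n)"
proof (induction n)
  case 0
  then show ?case using M by (auto simp: extends_def lip_path_def)
next
  case (Suc n)
  then show ?case using integral_path(1,2)[OF h s _ _ picard.simps(2)] by blast
qed

lemma picard_derivative:
  assumes h: "hist \<phi>" and s: "\<sigma>\<^sub>0 \<le> \<sigma>" and "0 \<le> t"
  shows "(picard \<sigma> \<phi> (Suc n) has_vector_derivative rhs \<sigma> t (picard \<sigma> \<phi> n)) (at t within {0..})"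
  using integral_path(3)[OF h s _ _ picard.simps(2) assms(3)] picard_path[OF h s] by blast

text \<open>Integration is a contraction with factor 1/2 for the weight
  \<open>exp (- 2 * L * t)\<close>, so Picard iteration converges on any interval
  \<open>[0, T]\<close> without subdividing it. \<open>L\<close> belongs to a ball that
  \<open>M\<close>-Lipschitz paths from \<open>\<phi> 0\<close> cannot leave before
  \<open>T\<close>.\<close>

lemma path_difference:
  assumes h: "hist \<phi>" and s: "\<sigma>\<^sub>0 \<le> \<sigma>" and x: "extends \<phi> x1" "lip_path x1" "extends \<phi> x2" "lip_path x2"
    and L: "rhs_lip (norm (\<phi> 0) + M * T) L"
    and y1: "y1 0 = \<phi> 0" "\<And>t. 0 \<le> t \<Longrightarrow> (y1 has_vector_derivative rhs \<sigma> t x1) (at t within {0..})"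
    and y2: "y2 0 = \<phi> 0" "\<And>t. 0 \<le> t \<Longrightarrow> (y2 has_vector_derivative rhs \<sigma> t x2) (at t within {0..})"
    and K: "0 \<le> K" "\<And>t. t \<in> {0..T} \<Longrightarrow> norm (x1 t - x2 t) \<le> K * exp (2 * L * t)"
    and t: "t \<in> {0..T}"
  shows "norm (y1 t - y2 t) \<le> K / 2 * exp (2 * L * t)"
proof -
  note L = rhs_lipD[OF L]
  have lips: "lip_on S M (\<lambda>s. x1 s $ 1)" "lip_on S M (\<lambda>s. x2 s $ 1)" for S
    using lip_on_UNIV h x lip_on_subset by blast+
  have "norm ((y1 t - y2 t) - (y1 0 - y2 0)) \<le> K / 2 * exp (2 * L * t) - K / 2 * exp (2 * L * 0)"
  proof (rule vector_derivative_bound[where S = "{0..}" and y = "\<lambda>t. y1 t - y2 t" and y' = "\<lambda>t. rhs \<sigma> t x1 - rhs \<sigma> t x2"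
        and p' = "\<lambda>x. L * (K * exp (2 * L * x))"])
    fix r assume r: "r \<in> {0..t}"
    show "((\<lambda>t. y1 t - y2 t) has_vector_derivative rhs \<sigma> r x1 - rhs \<sigma> r x2) (at r within {0..})"
      using r y1 y2 by (intro has_vector_derivative_diff) auto
    show "((\<lambda>x. K / 2 * exp (2 * L * x)) has_real_derivative L * (K * exp (2 * L * r))) (at r)"
      by (auto intro!: derivative_eq_intros)
    have MT: "M * r \<le> M * T" using r t M by simp
    have le: "norm (x1 s - x2 s) \<le> K * exp (2 * L * r)" if "0 \<le> s" "s \<le> r" for s
    proof -
      have "norm (x1 s - x2 s) \<le> K * exp (2 * L * s)" using K(2)[of s] that r t by auto
      also have "\<dots> \<le> K * exp (2 * L * r)" using K(1) L(1) that by (intro mult_left_mono) auto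
      finally show ?thesis .
    qed
    show "norm (rhs \<sigma> r x1 - rhs \<sigma> r x2) \<le> L * (K * exp (2 * L * r))"
    proof (rule L(2)[OF _ lips])
      show "norm (x1 r) \<le> norm (\<phi> 0) + M * T" using lip_path_norm_le[OF x(1,2), of r] r MT by simp
      show "norm (x2 r) \<le> norm (\<phi> 0) + M * T" using lip_path_norm_le[OF x(3,4), of r] r MT by simp
      show "norm (x1 r - x2 r) \<le> K * exp (2 * L * r)" using le r by auto
      fix s assume s: "s \<in> {- \<sigma>..r}"
      show "\<bar>x1 s $ 1 - x2 s $ 1\<bar> \<le> K * exp (2 * L * r)"
      proof (cases "s \<le> 0")
        case True
        then show ?thesis using x K(1) by (simp add: extends_def)
      next
        case False
        then show ?thesis using le[of s] s component_le_norm_cart[of "x1 s - x2 s" 1] by auto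
      qed
    qed (use s r in auto)
  qed (use t in auto)
  then show ?thesis using y1(1) y2(1) K(1) by simp
qed

lemma sol_exists:
  assumes h: "hist \<phi>" and s: "\<sigma>\<^sub>0 \<le> \<sigma>"
  obtains y where "sol \<sigma> \<phi> y"
proof -
  let ?x = "picard \<sigma> \<phi>"
  have ext: "extends \<phi> (?x n)" and lp: "lip_path (?x n)" for n using picard_path[OF h s] by auto
  have x0: "?x n 0 = \<phi> 0" for n using ext by (simp add: extends_def)
  \<comment> \<open>The limit is written as a telescoping series: one function for all time, whereas
    the constants of convergence depend on \<open>T\<close>.\<close>
  define y where "y t = (\<Sum>n. ?x (Suc n) t - ?x n t) + ?x 0 t" for t
  have unif: "\<exists>L. rhs_lip (norm (\<phi> 0) + M * T) L
    \<and> uniform_limit {0..T} ?x y sequentially" if T: "0 \<le> T" for T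
  proof -
    define B where "B = norm (\<phi> 0) + M * T"
    have B: "0 \<le> B" using T M by (simp add: B_def)
    obtain L where L: "rhs_lip (norm (\<phi> 0) + M * T) L"
      using rhs_lipschitz[OF B] unfolding B_def by blast
    have step: "\<forall>t\<in>{0..T}. norm (?x (Suc n) t - ?x n t) \<le> 2 * B / 2 ^ n * exp (2 * L * t)" for n
    proof (induction n)
      case 0
      show ?case
      proof
        fix t assume t: "t \<in> {0..T}"
        have Mt: "M * t \<le> M * T" using t M by simp
        have "norm (?x n t) \<le> B" for n using lip_path_norm_le[OF ext lp, of t n] t Mt by (simp add: B_def)
        then have "norm (?x (Suc 0) t - ?x 0 t) \<le> B + B"
          by (intro norm_triangle_le_diff add_mono)
        also have "\<dots> \<le> 2 * B * exp (2 * L * t)"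
          using mult_left_mono[of 1 "exp (2 * L * t)" "2 * B"] B rhs_lipD(1)[OF L] t by simp
        finally show "norm (?x (Suc 0) t - ?x 0 t) \<le> 2 * B / 2 ^ 0 * exp (2 * L * t)" by simp
      qed
    next
      case (Suc n)
      show ?case
      proof
        fix t assume t: "t \<in> {0..T}"
        have "norm (?x (Suc (Suc n)) t - ?x (Suc n) t) \<le> 2 * B / 2 ^ n / 2 * exp (2 * L * t)"
        proof (rule path_difference[where ?x1.0 = "?x (Suc n)" and ?x2.0 = "?x n" and ?y1.0 = "?x (Suc (Suc n))"
              and ?y2.0 = "?x (Suc n)", OF h s ext lp ext lp L x0 _ x0 _ _ _ t])
          show "\<And>t. t \<in> {0..T} \<Longrightarrow> norm (?x (Suc n) t - ?x n t) \<le> 2 * B / 2 ^ n * exp (2 * L * t)"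
            using Suc by blast
        qed (use B picard_derivative[OF h s] in \<open>auto simp del: picard.simps\<close>)
        then show "norm (?x (Suc (Suc n)) t - ?x (Suc n) t) \<le> 2 * B / 2 ^ Suc n * exp (2 * L * t)" by simp
      qed
    qed
    have "uniform_limit {0..T} (\<lambda>n t. \<Sum>i<n. ?x (Suc i) t - ?x i t) (\<lambda>t. \<Sum>i. ?x (Suc i) t - ?x i t) sequentially"
    proof (rule Weierstrass_m_test)
      fix n t assume t: "t \<in> {0..T}"
      have "norm (?x (Suc n) t - ?x n t) \<le> 2 * B / 2 ^ n * exp (2 * L * t)" using step t by blast
      also have "\<dots> \<le> 2 * B / 2 ^ n * exp (2 * L * T)" using B t rhs_lipD(1)[OF L] by (intro mult_left_mono) auto
      also have "\<dots> = 2 * B * exp (2 * L * T) * (1 / 2) ^ n" by (simp add: power_divide)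
      finally show "norm (?x (Suc n) t - ?x n t) \<le> 2 * B * exp (2 * L * T) * (1 / 2) ^ n" .
    qed (intro summable_mult summable_geometric, simp)
    then have "uniform_limit {0..T} (\<lambda>n t. (\<Sum>i<n. ?x (Suc i) t - ?x i t) + ?x 0 t) y sequentially"
      unfolding y_def by (intro uniform_limit_add uniform_limit_const)
    moreover have "(\<Sum>i<n. ?x (Suc i) t - ?x i t) + ?x 0 t = ?x n t" for n t
      using sum_lessThan_telescope[of "\<lambda>n. ?x n t" n] by simp
    ultimately have "uniform_limit {0..T} ?x y sequentially" by simp
    with L show ?thesis by blast
  qed
  have lim: "(\<lambda>n. ?x n t) \<longlonglongrightarrow> y t" if "0 \<le> t" for t
    using unif[OF that] tendsto_uniform_limitI[where S = "{0..t}"] that by fastforce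
  have exty: "extends \<phi> y" using ext by (auto simp: extends_def y_def)
  have lpy: "lip_path y" unfolding lip_path_def
  proof (intro allI impI)
    fix a b :: real assume ab: "0 \<le> a" "0 \<le> b"
    have "(\<lambda>n. norm (?x n a - ?x n b)) \<longlonglongrightarrow> norm (y a - y b)"
      using lim ab by (intro tendsto_intros) auto
    then show "norm (y a - y b) \<le> M * \<bar>a - b\<bar>"
      by (rule LIMSEQ_le_const2) (use lp ab in \<open>auto simp: lip_path_def\<close>)
  qed
  \<comment> \<open>One further integration of the limit: the iterates converge to \<open>z\<close>
    as well, so \<open>y\<close> satisfies the integral equation.\<close>
  define z where "z = (\<lambda>t. if t \<le> 0 then \<phi> t else \<phi> 0 + integral {0..t} (\<lambda>s. rhs \<sigma> s y))"
  note z = integral_path[OF h s exty lpy z_def]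
  have "z t = y t" for t
  proof (cases "t \<le> 0")
    case True
    then show ?thesis using exty by (simp add: z_def extends_def)
  next
    case False
    then have t: "0 \<le> t" by simp
    obtain L where L: "rhs_lip (norm (\<phi> 0) + M * t) L"
      and ul: "uniform_limit {0..t} ?x y sequentially"
      using unif[OF t] by blast
    have "(\<lambda>n. ?x (Suc n) t) \<longlonglongrightarrow> z t"
    proof (rule metric_LIMSEQ_I)
      fix e :: real assume e: "0 < e"
      define K where "K = e / exp (2 * L * t)"
      have K: "0 < K" using e by (simp add: K_def)
      obtain N where N: "\<And>n r. N \<le> n \<Longrightarrow> r \<in> {0..t} \<Longrightarrow> dist (?x n r) (y r) < K"
        using ul K unfolding uniform_limit_sequentially_iff by blast
      have "dist (?x (Suc n) t) (z t) < e" if n: "N \<le> n" for n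
      proof -
        have "norm (?x (Suc n) t - z t) \<le> K / 2 * exp (2 * L * t)"
        proof (rule path_difference[where ?x1.0 = "?x n" and ?x2.0 = y and ?y1.0 = "?x (Suc n)" and ?y2.0 = z, OF h s ext lp exty lpy L x0])
          fix r assume r: "r \<in> {0..t}"
          then have "norm (?x n r - y r) \<le> K * 1" using N[OF n r] by (simp add: dist_norm)
          also have "\<dots> \<le> K * exp (2 * L * r)" using r rhs_lipD(1)[OF L] K by (intro mult_left_mono) auto
          finally show "norm (?x n r - y r) \<le> K * exp (2 * L * r)" .
        qed (use K t z_def z(3) picard_derivative[OF h s] in auto)
        also have "\<dots> < e" using e by (simp add: K_def)
        finally show ?thesis by (simp add: dist_norm)
      qed
      then show "\<exists>N. \<forall>n\<ge>N. dist (?x (Suc n) t) (z t) < e" by blast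
    qed
    moreover have "(\<lambda>n. ?x (Suc n) t) \<longlonglongrightarrow> y t" using lim[OF t] by (rule LIMSEQ_Suc)
    ultimately show ?thesis by (rule LIMSEQ_unique)
  qed
  then have "z = y" by blast
  then have "sol \<sigma> \<phi> y" using z exty by (simp add: sol_def)
  then show ?thesis by (rule that)
qed

end

section \<open>Spectral data when the unstable space is the vertical axis\<close>

lemma vec2_eq_iff: "(x::'a^2) = y \<longleftrightarrow> x $ 1 = y $ 1 \<and> x $ 2 = y $ 2"
  by (simp add: vec_eq_iff forall_2)

lemma cmat_mult_nth: "(cmat A *v y) $ i = of_real (A $ i $ 1) * y $ 1 + of_real (A $ i $ 2) * y $ 2"
  by (simp add: matrix_vector_mult_def cmat_def sum_2)

lemma cvec_mult: "cvec (A *v x) = cmat A *v cvec x"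
  by (simp add: vec_eq_iff forall_2 cvec_def matrix_vector_mult_def cmat_def sum_2)

lemma mem_gen_eigenspace_1: "cmat A *v y = z *s y \<Longrightarrow> y \<in> gen_eigenspace A z"
  unfolding gen_eigenspace_def by (intro CollectI exI[of _ 1]) simp

lemma mult_mem_gen_eigenspace:
  assumes "y \<in> gen_eigenspace A z"
  shows "cmat A *v y \<in> gen_eigenspace A z"
proof -
  let ?N = "\<lambda>y. cmat A *v y - z *s y"
  have comm: "?N (cmat A *v y) = cmat A *v ?N y" for y
    by (simp add: matrix_vector_mult_diff_distrib vector_scalar_commute)
  from assms obtain k where k: "(?N ^^ k) y = 0" unfolding gen_eigenspace_def by blast
  have "(?N ^^ k) (cmat A *v y) = cmat A *v ((?N ^^ k) y)" for k
    by (induction k) (simp_all add: comm)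
  then have "(?N ^^ k) (cmat A *v y) = 0" using k by simp
  then show ?thesis unfolding gen_eigenspace_def by blast
qed

text \<open>Each generalised eigenspace is invariant, hence so is their span. Applied to the second
  axis, this is what makes the matrix lower triangular.\<close>

lemma mult_mem_unstable_space:
  assumes "x \<in> unstable_space A"
  shows "A *v x \<in> unstable_space A"
proof -
  let ?S = "\<Union>z\<in>{z. Re z > 0}. gen_eigenspace A z"
  have "cmat A *v y \<in> vec.span ?S" if "y \<in> vec.span ?S" for y
  proof (rule vec.span_induct[OF that])
    show "vec.subspace {y. cmat A *v y \<in> vec.span ?S}"
      by (auto simp: vec.subspace_def vec.span_zero vec.span_add vec.span_scale matrix_vector_right_distrib vector_scalar_commute)
    show "cmat A *v y \<in> vec.span ?S" if "y \<in> ?S" for y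
      using that by (auto intro!: vec.span_base mult_mem_gen_eigenspace)
  qed
  then show ?thesis using assms by (simp add: unstable_space_def cvec_mult)
qed

text \<open>A left eigenvector with eigenvalue \<open>\<mu> \<noteq> z\<close> annihilates the generalised eigenspace of \<open>z\<close>.\<close>
lemma gen_eigenspace_annihilated:
  assumes y: "y \<in> gen_eigenspace A z"
    and l: "\<And>y. p * (cmat A *v y) $ 1 + q * (cmat A *v y) $ 2 = \<mu> * (p * y $ 1 + q * y $ 2)"
    and z: "z \<noteq> \<mu>"
  shows "p * y $ 1 + q * y $ 2 = 0"
proof -
  let ?N = "\<lambda>y. cmat A *v y - z *s y"
  from y obtain k where k: "(?N ^^ k) y = 0" unfolding gen_eigenspace_def by blast
  have "p * (?N y) $ 1 + q * (?N y) $ 2 = (\<mu> - z) * (p * y $ 1 + q * y $ 2)" for y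
    using l[of y] by (simp add: algebra_simps)
  then have "p * ((?N ^^ k) y) $ 1 + q * ((?N ^^ k) y) $ 2 = (\<mu> - z) ^ k * (p * y $ 1 + q * y $ 2)" for k
    by (induction k) simp_all
  from this[of k] k z show ?thesis by simp
qed

section \<open>Lower triangular form of a hyperbolic matrix with vertical unstable space\<close>

locale unstable_axis =
  fixes A :: "real^2^2"
  assumes hyp: "\<And>z. eigenvalue_of A z \<Longrightarrow> Re z \<noteq> 0" and unst: "unstable_space A = {x. x $ 1 = 0}"
begin

lemma A12: "A $ 1 $ 2 = 0"
proof -
  have "axis 2 1 \<in> unstable_space A" by (simp add: unst axis_def)
  then have "A *v axis 2 1 \<in> unstable_space A" by (rule mult_mem_unstable_space)
  then show ?thesis by (simp add: unst matrix_vector_mult_def sum_2 axis_def)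
qed

lemma cmat_mult_1: "(cmat A *v y) $ 1 = of_real (A $ 1 $ 1) * y $ 1"
  by (simp add: cmat_mult_nth A12)

lemma A22_nonzero: "A $ 2 $ 2 \<noteq> 0"
proof -
  have "cmat A *v axis 2 1 = of_real (A $ 2 $ 2) *s axis 2 1"
    by (simp add: vec2_eq_iff cmat_mult_nth A12 axis_def)
  then have "eigenvalue_of A (of_real (A $ 2 $ 2))" unfolding eigenvalue_of_def
    by (intro exI[of _ "axis 2 1"]) (auto simp: axis_eq_0_iff)
  then show ?thesis using hyp by fastforce
qed

lemma unstable_span_base: "cvec x \<in> gen_eigenspace A z \<Longrightarrow> 0 < Re z \<Longrightarrow> x \<in> unstable_space A"
  unfolding unstable_space_def by (auto intro!: vec.span_base)

text \<open>Otherwise the entry is a positive eigenvalue, and an eigenvector off the vertical axis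
  lies in the unstable space. If the two diagonal entries coincide there may be no such eigenvector,
  but the first axis is a generalised one, killed by the square of the nilpotent part.\<close>

lemma A11: "A $ 1 $ 1 < 0"
proof (rule ccontr)
  assume "\<not> A $ 1 $ 1 < 0"
  show False
  proof (cases "A $ 1 $ 1 = A $ 2 $ 2")
    case True
    then have pos: "0 < A $ 1 $ 1" using A22_nonzero \<open>\<not> A $ 1 $ 1 < 0\<close> by simp
    let ?x = "axis 1 1 :: real^2"
    have "((\<lambda>y. cmat A *v y - of_real (A $ 1 $ 1) *s y) ^^ 2) (cvec ?x) = 0"
      by (simp add: numeral_2_eq_2 vec2_eq_iff cmat_mult_nth A12 cvec_def axis_def True)
    then have "cvec ?x \<in> gen_eigenspace A (of_real (A $ 1 $ 1))" unfolding gen_eigenspace_def by blast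
    then have "?x \<in> unstable_space A" by (rule unstable_span_base) (use pos in simp)
    then show False by (simp add: unst axis_def)
  next
    case False
    let ?x = "vector [A $ 1 $ 1 - A $ 2 $ 2, A $ 2 $ 1] :: real^2"
    have ev: "cmat A *v cvec ?x = of_real (A $ 1 $ 1) *s cvec ?x"
      by (simp add: vec2_eq_iff cmat_mult_nth A12 cvec_def algebra_simps)
    moreover have "cvec ?x \<noteq> 0" using False by (simp add: vec2_eq_iff cvec_def flip: of_real_diff)
    ultimately have "eigenvalue_of A (of_real (A $ 1 $ 1))" unfolding eigenvalue_of_def by blast
    then have "A $ 1 $ 1 \<noteq> 0" using hyp by fastforce
    then have pos: "0 < A $ 1 $ 1" using \<open>\<not> A $ 1 $ 1 < 0\<close> by simp
    have "?x \<in> unstable_space A"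
      by (rule unstable_span_base[OF mem_gen_eigenspace_1[OF ev]]) (use pos in simp)
    then show False using False by (simp add: unst)
  qed
qed

text \<open>The row \<open>(A $ 2 $ 1, A $ 2 $ 2 - A $ 1 $ 1)\<close> is a left eigenvector for
  \<open>A $ 2 $ 2\<close>; its kernel turns out to be the stable line.\<close>

lemma left_eigenvector_2:
  "of_real (A $ 2 $ 1) * (cmat A *v y) $ 1 + of_real (A $ 2 $ 2 - A $ 1 $ 1) * (cmat A *v y) $ 2
    = of_real (A $ 2 $ 2) * (of_real (A $ 2 $ 1) * y $ 1 + of_real (A $ 2 $ 2 - A $ 1 $ 1) * y $ 2)"
  by (simp add: cmat_mult_nth A12 algebra_simps)

text \<open>If the entry were negative, both eigenvalues would be, all generalised eigenspaces for
  positive real part would be trivial, and the unstable space could not contain the second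
  axis.\<close>

lemma A22: "0 < A $ 2 $ 2"
proof (rule ccontr)
  assume "\<not> 0 < A $ 2 $ 2"
  then have neg: "A $ 2 $ 2 < 0" using A22_nonzero by simp
  have "y = 0" if y: "y \<in> gen_eigenspace A z" and z: "0 < Re z" for y z
  proof -
    have y1: "1 * y $ 1 + 0 * y $ 2 = 0"
      by (rule gen_eigenspace_annihilated[OF y, where \<mu> = "of_real (A $ 1 $ 1)"])
        (use z A11 in \<open>auto simp: cmat_mult_1\<close>)
    let ?N = "\<lambda>y. cmat A *v y - z *s y"
    from y obtain k where k: "(?N ^^ k) y = 0" unfolding gen_eigenspace_def by blast
    have "(?N ^^ k) y $ 1 = 0 \<and> (?N ^^ k) y $ 2 = (of_real (A $ 2 $ 2) - z) ^ k * y $ 2" for k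
      using y1 by (induction k) (auto simp: cmat_mult_nth A12 algebra_simps)
    from this[of k] k have "(of_real (A $ 2 $ 2) - z) ^ k * y $ 2 = 0" by simp
    moreover have "z \<noteq> of_real (A $ 2 $ 2)" using z neg by auto
    ultimately have "y $ 2 = 0" by simp
    with y1 show ?thesis by (simp add: vec2_eq_iff)
  qed
  then have "(\<Union>z\<in>{z. Re z > 0}. gen_eigenspace A z) \<subseteq> {0}" by auto
  then have "vec.span (\<Union>z\<in>{z. Re z > 0}. gen_eigenspace A z) \<subseteq> {0}"
    by (rule vec.span_minimal) (rule vec.subspace_single_0)
  moreover have "axis 2 1 \<in> unstable_space A" by (simp add: unst axis_def)
  ultimately have "cvec (axis 2 1) = 0" unfolding unstable_space_def by blast
  then show False by (simp add: vec2_eq_iff cvec_def axis_def)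
qed

text \<open>Chosen so that \<open>(1, slope)\<close> is an eigenvector for \<open>A $ 1 $ 1\<close>;
  the diagonal entries have opposite signs, so the denominator is positive.\<close>

definition slope :: real where "slope = - (A $ 2 $ 1) / (A $ 2 $ 2 - A $ 1 $ 1)"

lemma slope_eq: "A $ 2 $ 1 + (A $ 2 $ 2 - A $ 1 $ 1) * slope = 0"
  using A11 A22 by (simp add: slope_def)

text \<open>The left eigenvector for the positive eigenvalue annihilates all stable generalised
  eigenvectors, which gives one inclusion; multiples of the eigenvector \<open>(1, slope)\<close>
  give the other.\<close>

lemma stable_space_eq: "stable_space A = {x. x $ 2 = slope * x $ 1}"
proof (intro equalityI subsetI CollectI)
  fix x assume "x \<in> stable_space A"
  then have x: "cvec x \<in> vec.span (\<Union>z\<in>{z. Re z < 0}. gen_eigenspace A z)" by (simp add: stable_space_def)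
  let ?p = "complex_of_real (A $ 2 $ 1)" and ?q = "complex_of_real (A $ 2 $ 2 - A $ 1 $ 1)"
  have "vec.span (\<Union>z\<in>{z. Re z < 0}. gen_eigenspace A z) \<subseteq> {y :: complex^2. ?p * y $ 1 + ?q * y $ 2 = 0}"
  proof (rule vec.span_minimal)
    show "(\<Union>z\<in>{z. Re z < 0}. gen_eigenspace A z) \<subseteq> {y :: complex^2. ?p * y $ 1 + ?q * y $ 2 = 0}"
    proof
      fix y assume "y \<in> (\<Union>z\<in>{z. Re z < 0}. gen_eigenspace A z)"
      then obtain z where z: "Re z < 0" "y \<in> gen_eigenspace A z" by blast
      then have "z \<noteq> of_real (A $ 2 $ 2)" using A22 by auto
      then show "y \<in> {y :: complex^2. ?p * y $ 1 + ?q * y $ 2 = 0}"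
        using gen_eigenspace_annihilated[OF z(2) left_eigenvector_2] by simp
    qed
    show "vec.subspace {y :: complex^2. ?p * y $ 1 + ?q * y $ 2 = 0}"
      unfolding vec.subspace_def
    proof (intro conjI ballI allI)
      fix a b :: "complex^2" assume "a \<in> {y :: complex^2. ?p * y $ 1 + ?q * y $ 2 = 0}" "b \<in> {y :: complex^2. ?p * y $ 1 + ?q * y $ 2 = 0}"
      then have "(?p * a $ 1 + ?q * a $ 2) + (?p * b $ 1 + ?q * b $ 2) = 0" by simp
      then show "a + b \<in> {y :: complex^2. ?p * y $ 1 + ?q * y $ 2 = 0}" by (simp add: algebra_simps)
    next
      fix c and a :: "complex^2" assume "a \<in> {y :: complex^2. ?p * y $ 1 + ?q * y $ 2 = 0}"
      then have "c * (?p * a $ 1 + ?q * a $ 2) = 0" by simp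
      then show "c *s a \<in> {y :: complex^2. ?p * y $ 1 + ?q * y $ 2 = 0}" by (simp add: algebra_simps)
    qed simp
  qed
  then have "?p * cvec x $ 1 + ?q * cvec x $ 2 = 0" using x by blast
  then have "complex_of_real (A $ 2 $ 1 * x $ 1 + (A $ 2 $ 2 - A $ 1 $ 1) * x $ 2) = 0" by (simp add: cvec_def)
  then have "A $ 2 $ 1 * x $ 1 + (A $ 2 $ 2 - A $ 1 $ 1) * x $ 2 = 0" by (simp only: of_real_eq_0_iff)
  then show "x $ 2 = slope * x $ 1" using A11 A22 unfolding slope_def by (simp add: field_simps)
next
  fix x :: "real^2" assume "x \<in> {x. x $ 2 = slope * x $ 1}"
  then have x2: "x $ 2 = slope * x $ 1" by simp
  have "A $ 2 $ 1 * x $ 1 + A $ 2 $ 2 * x $ 2 = A $ 1 $ 1 * x $ 2"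
  proof -
    have "(A $ 2 $ 1 + (A $ 2 $ 2 - A $ 1 $ 1) * slope) * x $ 1 = 0" by (simp add: slope_eq)
    then show ?thesis unfolding x2 by (simp add: algebra_simps)
  qed
  then have "A *v x = A $ 1 $ 1 *\<^sub>R x"
    by (simp add: vec2_eq_iff matrix_vector_mult_def sum_2 A12)
  then have "cvec (A *v x) = cvec (A $ 1 $ 1 *\<^sub>R x)" by simp
  then have "cmat A *v cvec x = of_real (A $ 1 $ 1) *s cvec x"
    unfolding cvec_mult by (simp add: vec2_eq_iff cvec_def)
  then have "cvec x \<in> gen_eigenspace A (of_real (A $ 1 $ 1))" by (rule mem_gen_eigenspace_1)
  then show "x \<in> stable_space A" unfolding stable_space_def using A11
    by (intro CollectI vec.span_base UN_I[of "of_real (A $ 1 $ 1)"]) auto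
qed

lemma P_u_eq: "P_u A x = vector [0, x $ 2 - slope * x $ 1]"
  unfolding P_u_def by (rule the_equality) (auto simp: unst stable_space_eq vec2_eq_iff)

end

lemma exp_mat_eigenvector:
  assumes "A *v x = \<mu> *\<^sub>R x"
  shows "exp_mat A t x = exp (\<mu> * t) *\<^sub>R x"
proof -
  have pow: "((*v) A ^^ n) x = \<mu> ^ n *\<^sub>R x" for n
    by (induction n) (simp_all add: matrix_vector_mult_scaleR assms)
  have "exp_mat A t x = (\<Sum>n. ((\<mu> * t) ^ n /\<^sub>R fact n) *\<^sub>R x)"
    unfolding exp_mat_def pow by (intro suminf_cong) (simp add: power_mult_distrib field_simps)
  also have "\<dots> = exp (\<mu> * t) *\<^sub>R x"
    unfolding exp_def by (rule suminf_scaleR_left[symmetric]) (rule summable_exp_generic)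
  finally show ?thesis .
qed

context unstable_axis
begin

lemma exp_mat_unstable: "x $ 1 = 0 \<Longrightarrow> exp_mat A t x = exp (A $ 2 $ 2 * t) *\<^sub>R x"
  by (rule exp_mat_eigenvector) (simp add: vec2_eq_iff matrix_vector_mult_def sum_2 A12)

lemma exp_mat_stable:
  assumes "x $ 2 = slope * x $ 1"
  shows "exp_mat A t x = exp (A $ 1 $ 1 * t) *\<^sub>R x"
proof (rule exp_mat_eigenvector)
  have "(A $ 2 $ 1 + (A $ 2 $ 2 - A $ 1 $ 1) * slope) * x $ 1 = 0" by (simp add: slope_eq)
  then have "A $ 2 $ 1 * x $ 1 + A $ 2 $ 2 * x $ 2 = A $ 1 $ 1 * x $ 2" unfolding assms by (simp add: algebra_simps)
  then show "A *v x = A $ 1 $ 1 *\<^sub>R x" by (simp add: vec2_eq_iff matrix_vector_mult_def sum_2 A12)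
qed

end

section \<open>The weighted norm, and the given decay rate against the eigenvalue and the
  weight\<close>

lemma Bnorm_le: "(\<And>\<theta>. \<theta> \<le> 0 \<Longrightarrow> exp (lam * \<theta>) * norm (\<phi> \<theta>) \<le> B) \<Longrightarrow> Bnorm lam \<phi> \<le> B"
  unfolding Bnorm_def by (rule cSUP_least) auto

lemma Bnorm_ge: "\<phi> \<in> Btilde lam \<Longrightarrow> \<theta> \<le> 0 \<Longrightarrow> exp (lam * \<theta>) * norm (\<phi> \<theta>) \<le> Bnorm lam \<phi>"
  unfolding Bnorm_def Btilde_def by (rule cSUP_upper) auto

lemma Bnorm_ge_0: "\<phi> \<in> Btilde lam \<Longrightarrow> norm (\<phi> 0) \<le> Bnorm lam \<phi>"
  using Bnorm_ge[of \<phi> lam 0] by simp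

lemma exp_rate_le:
  fixes a b C :: real
  assumes "0 < C" "\<And>t. 0 \<le> t \<Longrightarrow> exp (- b * t) \<le> C * exp (- a * t)"
  shows "a \<le> b"
proof (rule ccontr)
  assume "\<not> a \<le> b"
  define t where "t = C / (a - b)"
  have ab: "0 < a - b" using \<open>\<not> a \<le> b\<close> by simp
  then have t: "0 \<le> t" "(a - b) * t = C" using assms(1) by (auto simp: t_def)
  have "exp ((a - b) * t) = exp (- b * t) * exp (a * t)" unfolding exp_add[symmetric] by (simp add: algebra_simps)
  also have "\<dots> \<le> C * exp (- a * t) * exp (a * t)" using assms(2)[OF t(1)] by (intro mult_right_mono) auto
  also have "\<dots> = C" by (simp add: mult.assoc flip: exp_add)
  finally show False using t exp_ge_add_one_self[of C] by simp
qed

context unstable_axis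
begin

text \<open>Tests the semigroup estimate on the constant segment \<open>(1, slope)\<close>. At
  \<theta> = 0 its image decays like \<open>exp (A $ 1 $ 1 * t)\<close>; at \<theta> = -t it still
  has the initial value, seen with weight \<open>exp (- lam * t)\<close>. Neither can be slower than
  \<open>exp (- \<alpha> * t)\<close>.\<close>

lemma rate_le:
  assumes C: "0 < C" and lam: "0 < lam" and M: "0 < M"
    and V: "\<And>t \<phi>. 0 \<le> t \<Longrightarrow> \<phi> \<in> Es lam M A \<Longrightarrow> Bnorm lam (V A t \<phi>) \<le> C * exp (- \<alpha> * t) * Bnorm lam \<phi>"
  shows "\<alpha> \<le> - A $ 1 $ 1" "\<alpha> \<le> lam"
proof -
  define e where "e = (vector [1, slope] :: real^2)"
  have e2: "e $ 2 = slope * e $ 1" by (simp add: e_def)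
  have e0: "0 < norm e" by (simp add: e_def vec2_eq_iff)
  define \<phi> where "\<phi> = (\<lambda>\<theta>::real. if \<theta> \<le> 0 then e else 0)"
  have "continuous_on {..0} \<phi>" by (rule continuous_on_eq[OF continuous_on_const[of _ e]]) (simp add: \<phi>_def)
  moreover have "bdd_above ((\<lambda>\<theta>. exp (lam * \<theta>) * norm (\<phi> \<theta>)) ` {..0})"
    using lam e0 by (intro bdd_aboveI[of _ "norm e"]) (auto simp: \<phi>_def mult_nonneg_nonpos mult_le_cancel_right1)
  ultimately have phi: "\<phi> \<in> Es lam M A" using M e2
    by (auto simp: Es_def Bspace_def Btilde_def \<phi>_def stable_space_eq)
  have n: "Bnorm lam \<phi> \<le> norm e"
    using lam e0 by (intro Bnorm_le) (auto simp: \<phi>_def mult_nonneg_nonpos mult_le_cancel_right1)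
  have a: "A $ 1 $ 1 < 0" by (rule A11)
  have Vt: "V A t \<phi> \<theta> = (if \<theta> > 0 then 0 else if \<theta> < - t then e else exp (A $ 1 $ 1 * (t + \<theta>)) *\<^sub>R e)" if "0 \<le> t" for t \<theta>
    using that e2 by (auto simp: V_def \<phi>_def exp_mat_stable)
  have le: "exp (lam * \<theta>) * norm (V A t \<phi> \<theta>) \<le> C * exp (- \<alpha> * t) * norm e" if t: "0 \<le> t" and th: "\<theta> \<le> 0" for t \<theta>
  proof -
    have "bdd_above ((\<lambda>\<theta>. exp (lam * \<theta>) * norm (V A t \<phi> \<theta>)) ` {..0})"
    proof (rule bdd_aboveI[of _ "norm e"], clarsimp)
      fix \<theta> :: real assume th: "\<theta> \<le> 0"
      have "norm (V A t \<phi> \<theta>) \<le> norm e"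
      proof (cases "\<theta> < - t")
        case False
        then have "exp (A $ 1 $ 1 * (t + \<theta>)) \<le> 1" using a by (simp add: mult_nonpos_nonneg)
        then show ?thesis using Vt[OF t, of \<theta>] th False by (simp add: mult_left_le_one_le)
      qed (use Vt[OF t, of \<theta>] th in simp)
      then have "exp (lam * \<theta>) * norm (V A t \<phi> \<theta>) \<le> 1 * norm e"
        using lam th by (intro mult_mono) (auto simp: mult_nonneg_nonpos)
      then show "exp (lam * \<theta>) * norm (V A t \<phi> \<theta>) \<le> norm e" by simp
    qed
    then have "exp (lam * \<theta>) * norm (V A t \<phi> \<theta>) \<le> Bnorm lam (V A t \<phi>)"
      unfolding Bnorm_def by (rule cSUP_upper[rotated]) (use th in auto)
    also have "\<dots> \<le> C * exp (- \<alpha> * t) * Bnorm lam \<phi>" using V[OF t phi] .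
    also have "\<dots> \<le> C * exp (- \<alpha> * t) * norm e" using n C by (intro mult_left_mono) auto
    finally show ?thesis .
  qed
  have "exp (- (- A $ 1 $ 1) * t) \<le> C * exp (- \<alpha> * t)" if t: "0 \<le> t" for t
    using le[OF t, of 0] Vt[OF t, of 0] t e0 by simp
  then show "\<alpha> \<le> - A $ 1 $ 1" by (rule exp_rate_le[OF C])
  have "exp (- lam * t) \<le> C * exp (- \<alpha> * t)" if t: "0 \<le> t" for t
    using le[OF t, of "- t"] Vt[OF t, of "- t"] t e0 by simp
  then show "\<alpha> \<le> lam" by (rule exp_rate_le[OF C])
qed

end

section \<open>Perturbed planar saddles\<close>

lemma nondecreasing_on_derivative:
  fixes w :: "real \<Rightarrow> real"
  assumes "a \<le> b" "{a..b} \<subseteq> S"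
    and "\<And>t. t \<in> {a..b} \<Longrightarrow> (w has_real_derivative w' t) (at t within S)"
    and "\<And>t. t \<in> {a..b} \<Longrightarrow> 0 \<le> w' t"
  shows "w a \<le> w b"
proof -
  have "\<exists>x\<in>{a..b}. w b - w a = w' x * (b - a)"
  proof (rule mvt_very_simple[OF assms(1)])
    fix x assume "a \<le> x" "x \<le> b"
    then have "(w has_real_derivative w' x) (at x within {a..b})"
      using assms(2,3) DERIV_subset by (metis atLeastAtMost_iff)
    then show "(w has_derivative (*) (w' x)) (at x within {a..b})" by (simp add: has_field_derivative_def)
  qed
  then obtain x where "x \<in> {a..b}" "w b - w a = w' x * (b - a)" by blast
  moreover have "0 \<le> w' x * (b - a)" using assms(1,4) \<open>x \<in> {a..b}\<close> by (intro mult_nonneg_nonneg) auto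
  ultimately show ?thesis by linarith
qed

text \<open>Without perturbation the right-hand side is
  \<open>2 * b * z\<^sup>2 + 2 * a * k\<^sup>2 * u\<^sup>2\<close>. In the scaled variables
  \<open>k * \<bar>u\<bar>\<close> and \<open>\<bar>z\<bar>\<close> the perturbation costs at most
  \<open>4 * e / k\<close> times the sum of squares, hence at most \<open>min a b\<close> times it,
  so half of the guaranteed growth remains.\<close>

lemma cone_derivative_bound:
  fixes a b e k u z r1 r2 :: real
  assumes k: "0 < k" "k \<le> 1" and e: "0 \<le> e" "4 * e \<le> k * min a b"
    and r: "\<bar>r1\<bar> \<le> e * (\<bar>u\<bar> + \<bar>z\<bar>)" "\<bar>r2\<bar> \<le> e * (\<bar>u\<bar> + \<bar>z\<bar>)"
  shows "min a b * (z\<^sup>2 + k\<^sup>2 * u\<^sup>2) \<le> 2 * z * (b * z + r2) - k\<^sup>2 * (2 * u * (- a * u + r1))"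
proof -
  define p q where "p = k * \<bar>u\<bar>" and "q = \<bar>z\<bar>"
  have pq: "0 \<le> p" "0 \<le> q" using k by (auto simp: p_def q_def)
  have "4 * e / k \<le> min a b" using e(2) k by (simp only: pos_divide_le_eq mult.commute)
  then have ke: "e / k * 4 \<le> min a b" by (simp only: times_divide_eq_left mult.commute)
  have r': "\<bar>u\<bar> + \<bar>z\<bar> \<le> (p + q) / k"
  proof -
    have "k * \<bar>z\<bar> \<le> 1 * \<bar>z\<bar>" using k by (intro mult_right_mono) auto
    then have "k * (\<bar>u\<bar> + \<bar>z\<bar>) \<le> p + q" by (simp add: p_def q_def algebra_simps)
    then show ?thesis using k by (simp add: field_simps)
  qed
  have R: "e * (\<bar>u\<bar> + \<bar>z\<bar>) \<le> e / k * (p + q)" using mult_left_mono[OF r' e(1)] by simp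
  have 1: "z * r2 \<ge> - (q * (e / k * (p + q)))"
  proof -
    have "\<bar>z * r2\<bar> \<le> q * (e / k * (p + q))" unfolding abs_mult q_def[symmetric]
      using r(2) R pq by (intro mult_left_mono) auto
    then show ?thesis by linarith
  qed
  have 2: "k\<^sup>2 * (u * r1) \<le> p * (e / k * (p + q))"
  proof -
    have "\<bar>k\<^sup>2 * (u * r1)\<bar> = k * (p * \<bar>r1\<bar>)" using k by (simp add: abs_mult p_def power2_eq_square)
    also have "\<dots> \<le> 1 * (p * (e / k * (p + q)))"
      using r(1) R pq k by (intro mult_mono mult_left_mono) auto
    finally show ?thesis by linarith
  qed
  have gen: "c + d - 2 * P - 2 * Q \<le> c + d + 2 * X - 2 * Y" if "- P \<le> X" "Y \<le> Q" for c d X Y P Q :: real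
    using that by linarith
  have sq: "z\<^sup>2 = q\<^sup>2" "k\<^sup>2 * u\<^sup>2 = p\<^sup>2" by (auto simp: p_def q_def power_mult_distrib)
  have "2 * (e / k) * (p + q)\<^sup>2 \<le> 2 * (e / k) * (2 * (p\<^sup>2 + q\<^sup>2))"
  proof (rule mult_left_mono)
    have "0 \<le> (p - q)\<^sup>2" by simp
    then show "(p + q)\<^sup>2 \<le> 2 * (p\<^sup>2 + q\<^sup>2)" by (simp add: power2_eq_square algebra_simps)
  qed (use e k in auto)
  also have "\<dots> = e / k * 4 * (p\<^sup>2 + q\<^sup>2)" by simp
  also have "\<dots> \<le> min a b * (p\<^sup>2 + q\<^sup>2)" using ke by (intro mult_right_mono) auto
  finally have 3: "2 * (e / k) * (p + q)\<^sup>2 \<le> min a b * (p\<^sup>2 + q\<^sup>2)" .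
  have 4: "min a b * p\<^sup>2 \<le> a * p\<^sup>2" "min a b * q\<^sup>2 \<le> b * q\<^sup>2" by (auto intro: mult_right_mono)
  have "2 * z * (b * z + r2) - k\<^sup>2 * (2 * u * (- a * u + r1)) = 2 * (b * z\<^sup>2) + 2 * (a * (k\<^sup>2 * u\<^sup>2)) + 2 * (z * r2) - 2 * (k\<^sup>2 * (u * r1))"
    by (simp add: power2_eq_square algebra_simps)
  also have "\<dots> \<ge> 2 * (b * q\<^sup>2) + 2 * (a * p\<^sup>2) - 2 * (q * (e / k * (p + q))) - 2 * (p * (e / k * (p + q)))"
    unfolding sq by (rule gen[OF 1 2])
  also have "2 * (b * q\<^sup>2) + 2 * (a * p\<^sup>2) - 2 * (q * (e / k * (p + q))) - 2 * (p * (e / k * (p + q)))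
     = 2 * (b * q\<^sup>2) + 2 * (a * p\<^sup>2) - 2 * (e / k) * (p + q)\<^sup>2"
    by (simp add: power2_eq_square algebra_simps add_divide_distrib)
  also have "\<dots> \<ge> 2 * (b * q\<^sup>2) + 2 * (a * p\<^sup>2) - min a b * (p\<^sup>2 + q\<^sup>2)" using 3 by linarith
  finally have "2 * (b * q\<^sup>2) + 2 * (a * p\<^sup>2) - min a b * (p\<^sup>2 + q\<^sup>2) \<le> 2 * z * (b * z + r2) - k\<^sup>2 * (2 * u * (- a * u + r1))" .
  then show ?thesis using 4 unfolding sq by (simp add: algebra_simps)
qed

locale saddle =
  fixes a b :: real and u z r1 r2 :: "real \<Rightarrow> real"
  assumes a: "0 < a" and b: "0 < b"
    and u': "\<And>t. 0 \<le> t \<Longrightarrow> (u has_real_derivative - a * u t + r1 t) (at t within {0..})"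
    and z': "\<And>t. 0 \<le> t \<Longrightarrow> (z has_real_derivative b * z t + r2 t) (at t within {0..})"
begin

lemma cone_derivative:
  "0 \<le> t \<Longrightarrow> ((\<lambda>t. (z t)\<^sup>2 - k\<^sup>2 * (u t)\<^sup>2) has_real_derivative
     2 * z t * (b * z t + r2 t) - k\<^sup>2 * (2 * u t * (- a * u t + r1 t))) (at t within {0..})"
  using u' z' by (auto intro!: derivative_eq_intros)

lemma cone_nondecreasing:
  assumes k: "0 < k" "k \<le> 1" and e: "0 \<le> e" "4 * e \<le> k * min a b" and st: "0 \<le> s" "s \<le> t"
    and r: "\<And>x. x \<in> {s..t} \<Longrightarrow> \<bar>r1 x\<bar> \<le> e * (\<bar>u x\<bar> + \<bar>z x\<bar>)" "\<And>x. x \<in> {s..t} \<Longrightarrow> \<bar>r2 x\<bar> \<le> e * (\<bar>u x\<bar> + \<bar>z x\<bar>)"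
  shows "(z s)\<^sup>2 - k\<^sup>2 * (u s)\<^sup>2 \<le> (z t)\<^sup>2 - k\<^sup>2 * (u t)\<^sup>2"
proof (rule nondecreasing_on_derivative[OF st(2) _ cone_derivative])
  fix x assume x: "x \<in> {s..t}"
  have "0 \<le> min a b * ((z x)\<^sup>2 + k\<^sup>2 * (u x)\<^sup>2)" using a b by simp
  also have "\<dots> \<le> 2 * z x * (b * z x + r2 x) - k\<^sup>2 * (2 * u x * (- a * u x + r1 x))"
    using cone_derivative_bound[OF k e r[OF x]] .
  finally show "0 \<le> 2 * z x * (b * z x + r2 x) - k\<^sup>2 * (2 * u x * (- a * u x + r1 x))" .
qed (use st in auto)

text \<open>Outside the cone the quadratic form grows without bound, so bounded orbits stay inside.\<close>
lemma bounded_in_cone: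
  assumes k: "0 < k" "k \<le> 1" and e: "0 \<le> e" "4 * e \<le> k * min a b"
    and r: "\<And>x. 0 \<le> x \<Longrightarrow> \<bar>r1 x\<bar> \<le> e * (\<bar>u x\<bar> + \<bar>z x\<bar>)" "\<And>x. 0 \<le> x \<Longrightarrow> \<bar>r2 x\<bar> \<le> e * (\<bar>u x\<bar> + \<bar>z x\<bar>)"
    and B: "\<And>x. 0 \<le> x \<Longrightarrow> \<bar>z x\<bar> \<le> B" and s: "0 \<le> s"
  shows "\<bar>z s\<bar> \<le> k * \<bar>u s\<bar>"
proof (rule ccontr)
  let ?w = "\<lambda>t. (z t)\<^sup>2 - k\<^sup>2 * (u t)\<^sup>2"
  let ?g = "min a b"
  assume "\<not> \<bar>z s\<bar> \<le> k * \<bar>u s\<bar>"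
  then have "(k * \<bar>u s\<bar>)\<^sup>2 < \<bar>z s\<bar>\<^sup>2" using k by (intro power_strict_mono) auto
  then have w0: "0 < ?w s" by (simp add: power_mult_distrib)
  have g: "0 < ?g" using a b by simp
  \<comment> \<open>The form is nondecreasing, so its derivative stays above \<open>min a b\<close>
    times its value at \<open>s\<close>: at least linear growth.\<close>
  have grow: "?w s + ?g * ?w s * (t - s) \<le> ?w t" if t: "s \<le> t" for t
  proof -
    let ?v = "\<lambda>t. ?w t - ?g * ?w s * t"
    have "?v s \<le> ?v t"
    proof (rule nondecreasing_on_derivative[OF t, where S = "{0..}"])
      fix x assume x: "x \<in> {s..t}"
      then have x0: "0 \<le> x" using s by simp
      show "(?v has_real_derivative 2 * z x * (b * z x + r2 x) - k\<^sup>2 * (2 * u x * (- a * u x + r1 x)) - ?g * ?w s) (at x within {0..})"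
        by (rule DERIV_diff[OF cone_derivative[OF x0]]) (auto intro!: derivative_eq_intros)
      have "?w s \<le> ?w x" using x s by (intro cone_nondecreasing[OF k e] r) auto
      also have "?w x \<le> (z x)\<^sup>2 + k\<^sup>2 * (u x)\<^sup>2" by simp
      finally have "?g * ?w s \<le> ?g * ((z x)\<^sup>2 + k\<^sup>2 * (u x)\<^sup>2)" using g by (intro mult_left_mono) auto
      then show "0 \<le> 2 * z x * (b * z x + r2 x) - k\<^sup>2 * (2 * u x * (- a * u x + r1 x)) - ?g * ?w s"
        using cone_derivative_bound[OF k e r[OF x0 ]] x0 by linarith
    qed (use s in auto)
    then show ?thesis by (simp add: algebra_simps)
  qed
  \<comment> \<open>The time at which the linear lower bound exceeds
    \<open>B\<^sup>2\<close>.\<close>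
  define t where "t = s + B\<^sup>2 / (?g * ?w s)"
  have gw: "0 < ?g * ?w s" using g w0 by simp
  have "s \<le> t" using gw by (simp add: t_def)
  then have "?w s + ?g * ?w s * (t - s) \<le> ?w t" by (rule grow)
  also have "?g * ?w s * (t - s) = B\<^sup>2" using nonzero_mult_div_cancel_left[of "?g * ?w s" "B\<^sup>2"] gw unfolding t_def
    by (metis add_diff_cancel_left' less_irrefl times_divide_eq_right)
  also have "?w t \<le> (z t)\<^sup>2" by simp
  also have "(z t)\<^sup>2 \<le> B\<^sup>2" using B[of t] s \<open>s \<le> t\<close> by (intro abs_le_square_iff[THEN iffD1]) auto
  finally show False using w0 by simp
qed

text \<open>Inside the cone the perturbation is at most \<open>2 * e * \<bar>u\<bar>\<close>, so
  \<open>exp (2 * m * t) * u\<^sup>2\<close> with \<open>m = a - 2 * e\<close> is nonincreasing;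
  working with the square avoids differentiating \<open>\<bar>u\<bar>\<close> at zeros.\<close>

lemma decay_in_cone:
  assumes e: "0 \<le> e" and st: "0 \<le> s" "s \<le> t"
    and r: "\<And>x. x \<in> {s..t} \<Longrightarrow> \<bar>r1 x\<bar> \<le> e * (\<bar>u x\<bar> + \<bar>z x\<bar>)"
    and cone: "\<And>x. x \<in> {s..t} \<Longrightarrow> \<bar>z x\<bar> \<le> \<bar>u x\<bar>"
  shows "\<bar>u t\<bar> \<le> exp (- (a - 2 * e) * (t - s)) * \<bar>u s\<bar>"
proof -
  define m where "m = a - 2 * e"
  have "- (exp (2 * m * s) * (u s)\<^sup>2) \<le> - (exp (2 * m * t) * (u t)\<^sup>2)"
  proof (rule nondecreasing_on_derivative[OF st(2), where S = "{0..}" and w = "\<lambda>t. - (exp (2 * m * t) * (u t)\<^sup>2)"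
       and w' = "\<lambda>t. exp (2 * m * t) * (- (2 * m * (u t)\<^sup>2 + 2 * u t * (- a * u t + r1 t)))"])
    fix x assume x: "x \<in> {s..t}"
    then have "0 \<le> x" using st by simp
    from u'[OF this] show "((\<lambda>t. - (exp (2 * m * t) * (u t)\<^sup>2)) has_real_derivative
        exp (2 * m * x) * (- (2 * m * (u x)\<^sup>2 + 2 * u x * (- a * u x + r1 x)))) (at x within {0..})"
      by (auto intro!: derivative_eq_intros simp: algebra_simps power2_eq_square)
    have "\<bar>r1 x\<bar> \<le> e * (\<bar>u x\<bar> + \<bar>u x\<bar>)"
      using r[OF x] mult_left_mono[OF add_left_mono[OF cone[OF x]] e] by (rule order_trans)
    then have "\<bar>u x\<bar> * \<bar>r1 x\<bar> \<le> \<bar>u x\<bar> * (e * (\<bar>u x\<bar> + \<bar>u x\<bar>))" by (intro mult_left_mono) auto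
    also have "\<dots> = 2 * e * (u x)\<^sup>2" by (simp add: power2_eq_square algebra_simps flip: abs_mult)
    finally have "u x * r1 x \<le> 2 * e * (u x)\<^sup>2" using abs_le_D1[of "u x * r1 x"] by (simp add: abs_mult)
    then have "2 * m * (u x)\<^sup>2 + 2 * u x * (- a * u x + r1 x) \<le> 0"
      by (simp add: m_def power2_eq_square algebra_simps)
    then show "0 \<le> exp (2 * m * x) * (- (2 * m * (u x)\<^sup>2 + 2 * u x * (- a * u x + r1 x)))"
      by (intro mult_nonneg_nonneg) auto
  qed (use st in auto)
  then have "exp (2 * m * t) * (u t)\<^sup>2 \<le> exp (2 * m * s) * (u s)\<^sup>2" by simp
  then have "(exp (m * t) * \<bar>u t\<bar>)\<^sup>2 \<le> (exp (m * s) * \<bar>u s\<bar>)\<^sup>2"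
    by (simp add: power_mult_distrib mult.assoc flip: exp_double)
  then have "exp (m * t) * \<bar>u t\<bar> \<le> exp (m * s) * \<bar>u s\<bar>" by (rule power2_le_imp_le) simp
  then have "exp (- m * t) * (exp (m * t) * \<bar>u t\<bar>) \<le> exp (- m * t) * (exp (m * s) * \<bar>u s\<bar>)" by (intro mult_left_mono) auto
  then have "\<bar>u t\<bar> \<le> exp (- m * (t - s)) * \<bar>u s\<bar>"
    by (simp add: mult.assoc[symmetric] exp_add[symmetric]) (simp add: algebra_simps)
  then show ?thesis by (simp add: m_def)
qed

lemma stable_bound:
  assumes r: "\<And>x. x \<in> {0..t} \<Longrightarrow> \<bar>r1 x\<bar> \<le> B" and t: "0 \<le> t"
  shows "\<bar>u t\<bar> \<le> \<bar>u 0\<bar> + B / a"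
proof -
  have B: "0 \<le> B" using r[of 0] t by simp
  have "norm (exp (a * t) * u t - exp (a * 0) * u 0) \<le> B / a * exp (a * t) - B / a * exp (a * 0)"
  proof (rule vector_derivative_bound[where S = "{0..}" and y = "\<lambda>t. exp (a * t) * u t" and y' = "\<lambda>t. exp (a * t) * r1 t" and p' = "\<lambda>t. B * exp (a * t)"])
    fix x assume x: "x \<in> {0..t}"
    then have "0 \<le> x" by simp
    from u'[OF this] have "((\<lambda>t. exp (a * t) * u t) has_real_derivative exp (a * x) * r1 x) (at x within {0..})"
      by (auto intro!: derivative_eq_intros simp: algebra_simps)
    then show "((\<lambda>t. exp (a * t) * u t) has_vector_derivative exp (a * x) * r1 x) (at x within {0..})"
      by (simp add: has_real_derivative_iff_has_vector_derivative)
    show "((\<lambda>t. B / a * exp (a * t)) has_real_derivative B * exp (a * x)) (at x)"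
      using a by (auto intro!: derivative_eq_intros)
    show "norm (exp (a * x) * r1 x) \<le> B * exp (a * x)" using r[OF x] by (simp add: abs_mult)
  qed (use t in auto)
  then have "exp (a * t) * \<bar>u t\<bar> \<le> \<bar>u 0\<bar> + B / a * exp (a * t)"
  proof -
    assume *: "norm (exp (a * t) * u t - exp (a * 0) * u 0) \<le> B / a * exp (a * t) - B / a * exp (a * 0)"
    have "\<bar>exp (a * t) * u t\<bar> \<le> \<bar>u 0\<bar> + norm (exp (a * t) * u t - exp (a * 0) * u 0)" by simp
    also have "\<dots> \<le> \<bar>u 0\<bar> + B / a * exp (a * t)"
      using order_trans[OF *, of "B / a * exp (a * t)"] B a by simp
    finally show ?thesis by (simp add: abs_mult)
  qed
  also have "\<dots> \<le> \<bar>u 0\<bar> * exp (a * t) + B / a * exp (a * t)"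
    using a t mult_left_mono[of 1 "exp (a * t)" "\<bar>u 0\<bar>"] by simp
  also have "\<dots> = exp (a * t) * (\<bar>u 0\<bar> + B / a)" by (simp add: algebra_simps)
  finally show ?thesis by simp
qed

text \<open>Variation of constants, solved backwards from \<open>t\<close>: the unstable component
  at \<open>s\<close> is determined up to the perturbation by its later value, which enters with an
  exponentially small factor.\<close>

lemma unstable_backward:
  assumes r: "\<And>x. x \<in> {s..t} \<Longrightarrow> \<bar>r2 x\<bar> \<le> B" and st: "0 \<le> s" "s \<le> t"
  shows "\<bar>z s - exp (- b * (t - s)) * z t\<bar> \<le> B / b * (1 - exp (- b * (t - s)))"
proof -
  have "norm (exp (- b * t) * z t - exp (- b * s) * z s) \<le> - (B / b) * exp (- b * t) - - (B / b) * exp (- b * s)"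
  proof (rule vector_derivative_bound[where S = "{0..}" and y = "\<lambda>t. exp (- b * t) * z t" and y' = "\<lambda>t. exp (- b * t) * r2 t" and p' = "\<lambda>t. B * exp (- b * t)"])
    fix x assume x: "x \<in> {s..t}"
    then have "0 \<le> x" using st by simp
    from z'[OF this] have "((\<lambda>t. exp (- b * t) * z t) has_real_derivative exp (- b * x) * r2 x) (at x within {0..})"
      by (auto intro!: derivative_eq_intros simp: algebra_simps)
    then show "((\<lambda>t. exp (- b * t) * z t) has_vector_derivative exp (- b * x) * r2 x) (at x within {0..})"
      by (simp add: has_real_derivative_iff_has_vector_derivative)
    show "((\<lambda>t. - (B / b) * exp (- b * t)) has_real_derivative B * exp (- b * x)) (at x)"
      using b by (auto intro!: derivative_eq_intros)
    show "norm (exp (- b * x) * r2 x) \<le> B * exp (- b * x)" using r[OF x] by (simp add: abs_mult)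
  qed (use st in auto)
  then have le: "\<bar>exp (- b * s) * z s - exp (- b * t) * z t\<bar> \<le> B / b * (exp (- b * s) - exp (- b * t))"
    by (simp add: abs_minus_commute algebra_simps)
  have e: "exp (b * s) * exp (- b * t) = exp (- b * (t - s))" "exp (b * s) * exp (- b * s) = 1"
    by (simp_all add: exp_add[symmetric] algebra_simps)
  have "z s - exp (- b * (t - s)) * z t = exp (b * s) * (exp (- b * s) * z s - exp (- b * t) * z t)"
    unfolding right_diff_distrib mult.assoc[symmetric] e by simp
  then have "\<bar>z s - exp (- b * (t - s)) * z t\<bar> = exp (b * s) * \<bar>exp (- b * s) * z s - exp (- b * t) * z t\<bar>"
    by (simp only: abs_mult abs_exp_cancel)
  also have "\<dots> \<le> exp (b * s) * (B / b * (exp (- b * s) - exp (- b * t)))" using le by (intro mult_left_mono) auto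
  also have "\<dots> = B / b * (exp (b * s) * exp (- b * s) - exp (b * s) * exp (- b * t))" by (simp add: algebra_simps)
  also have "\<dots> = B / b * (1 - exp (- b * (t - s)))" unfolding e ..
  finally show ?thesis .
qed

text \<open>Weaker for long times, but with a bound free of \<open>b\<close>, so that the growth can
  be set against the weight \<open>exp (lam * \<theta>)\<close> of the norm.\<close>

lemma unstable_backward_linear:
  assumes r: "\<And>x. x \<in> {s..t} \<Longrightarrow> \<bar>r2 x\<bar> \<le> B" and st: "0 \<le> s" "s \<le> t"
  shows "\<bar>z s - exp (- b * (t - s)) * z t\<bar> \<le> B * (t - s)"
proof -
  have B: "0 \<le> B" using r[of s] st by simp
  have "1 - exp (- b * (t - s)) \<le> b * (t - s)" using exp_ge_add_one_self[of "- b * (t - s)"] by simp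
  then have "B / b * (1 - exp (- b * (t - s))) \<le> B / b * (b * (t - s))" using B b by (intro mult_left_mono) auto
  also have "\<dots> = B * (t - s)" using b by simp
  finally show ?thesis using unstable_backward[OF r st] by linarith
qed

text \<open>Boundedness for all time removes the homogeneous term of the backward formula in the
  limit. This is what determines the unstable component of a bounded orbit.\<close>

lemma unstable_bound:
  assumes r: "\<And>x. 0 \<le> x \<Longrightarrow> \<bar>r2 x\<bar> \<le> B" and K: "\<And>x. 0 \<le> x \<Longrightarrow> \<bar>z x\<bar> \<le> K" and s: "0 \<le> s"
  shows "\<bar>z s\<bar> \<le> B / b"
proof -
  have B: "0 \<le> B" using r[of 0] by simp
  have le: "\<bar>z s\<bar> \<le> B / b + exp (- b * real n) * K" for n
  proof -
    have "\<bar>z s - exp (- b * (s + real n - s)) * z (s + real n)\<bar> \<le> B / b * (1 - exp (- b * (s + real n - s)))"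
      using s r by (intro unstable_backward) auto
    also have "\<dots> \<le> B / b" using B b by (simp add: field_simps)
    finally have "\<bar>z s\<bar> \<le> B / b + \<bar>exp (- b * real n) * z (s + real n)\<bar>" by simp
    also have "\<dots> \<le> B / b + exp (- b * real n) * K" using K[of "s + real n"] s by (simp add: abs_mult)
    finally show ?thesis .
  qed
  have "(\<lambda>n. B / b + exp (- b) ^ n * K) \<longlonglongrightarrow> B / b + 0 * K"
    using b by (intro tendsto_intros LIMSEQ_power_zero) auto
  then have "(\<lambda>n. B / b + exp (- b * real n) * K) \<longlonglongrightarrow> B / b"
    by (simp add: exp_of_nat_mult[symmetric] mult.commute)
  then show ?thesis by (rule LIMSEQ_le_const) (use le in auto)
qed

end

section \<open>Small orbits of the delay equation\<close>

locale stable_setting = delay_system h k M H \<eta> \<sigma>\<^sub>0 f g c lam + unstable_axis "jacobian f (at 0)"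
  for h k M H \<eta> \<sigma>\<^sub>0 f g c lam +
  assumes f0: "f 0 = 0" and c1: "\<exists>d>0. \<forall>x. norm x < d \<longrightarrow> c x = 1"
begin

abbreviation J :: "real^2^2" where "J \<equiv> jacobian f (at 0)"

definition a :: real where "a = - J $ 1 $ 1"
definition b :: real where "b = J $ 2 $ 2"

text \<open>The coordinate along the unstable direction, so that \<open>x = x\<^sub>1 (1, slope) + zc x (0, 1)\<close>.\<close>
definition zc :: "real^2 \<Rightarrow> real" where "zc x = x $ 2 - slope * x $ 1"

text \<open>Comparison constant between the Euclidean norm and the coordinates \<open>x $ 1\<close>
  and \<open>zc x\<close>.\<close>

definition S :: real where "S = 1 + \<bar>slope\<bar>"

lemma a: "0 < a" and b: "0 < b" using A11 A22 by (auto simp: a_def b_def)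

lemma S: "1 \<le> S" by (simp add: S_def)

lemma zc_simps: "zc (x + y) = zc x + zc y" "zc (x - y) = zc x - zc y" "zc 0 = 0"
  by (simp_all add: zc_def algebra_simps)

lemma bounded_linear_zc: "bounded_linear zc"
  unfolding zc_def by (intro bounded_linear_sub bounded_linear_const_mult bounded_linear_vec_nth)

lemma A_mult: "(J *v x) $ 1 = - a * x $ 1" "zc (J *v x) = b * zc x"
proof -
  show "(J *v x) $ 1 = - a * x $ 1" by (simp add: matrix_vector_mult_def sum_2 A12 a_def)
  have "(J $ 2 $ 1 + (J $ 2 $ 2 - J $ 1 $ 1) * slope) * x $ 1 = 0" by (simp add: slope_eq)
  then show "zc (J *v x) = b * zc x"
    by (simp add: zc_def matrix_vector_mult_def sum_2 A12 b_def algebra_simps)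
qed

lemma comp_le_norm: "\<bar>x $ 1\<bar> \<le> norm x" for x :: "real^2"
  using component_le_norm_cart by blast

lemma zc_le_norm: "\<bar>zc x\<bar> \<le> S * norm x"
proof -
  have "\<bar>zc x\<bar> \<le> \<bar>x $ 2\<bar> + \<bar>slope\<bar> * \<bar>x $ 1\<bar>" unfolding zc_def abs_mult[symmetric] by (rule abs_triangle_ineq4)
  also have "\<dots> \<le> norm x + \<bar>slope\<bar> * norm x" by (intro add_mono mult_left_mono component_le_norm_cart) auto
  finally show ?thesis by (simp add: S_def algebra_simps)
qed

lemma norm_le_coords: "norm x \<le> S * \<bar>x $ 1\<bar> + \<bar>zc x\<bar>"
proof -
  have "norm x \<le> \<bar>x $ 1\<bar> + \<bar>x $ 2\<bar>" using norm_le_l1_cart[of x] by (simp add: sum_2)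
  moreover have "\<bar>x $ 2\<bar> \<le> \<bar>zc x\<bar> + \<bar>slope\<bar> * \<bar>x $ 1\<bar>"
    using abs_triangle_ineq[of "zc x" "slope * x $ 1"] by (simp add: zc_def abs_mult)
  ultimately show ?thesis by (simp add: S_def algebra_simps)
qed

lemma saddle_of_derivative:
  assumes "\<And>t. 0 \<le> t \<Longrightarrow> (y has_vector_derivative J *v y t + R t) (at t within {0..})"
  shows "saddle a b (\<lambda>t. y t $ 1) (\<lambda>t. zc (y t)) (\<lambda>t. R t $ 1) (\<lambda>t. zc (R t))"
proof
  fix t :: real assume t: "0 \<le> t"
  have "((\<lambda>t. y t $ 1) has_vector_derivative (J *v y t + R t) $ 1) (at t within {0..})"
    using bounded_linear.has_vector_derivative[OF bounded_linear_vec_nth assms[OF t]] .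
  then show "((\<lambda>t. y t $ 1) has_real_derivative - a * y t $ 1 + R t $ 1) (at t within {0..})"
    by (simp add: has_real_derivative_iff_has_vector_derivative A_mult)
  have "((\<lambda>t. zc (y t)) has_vector_derivative zc (J *v y t + R t)) (at t within {0..})"
    using bounded_linear.has_vector_derivative[OF bounded_linear_zc assms[OF t]] .
  then show "((\<lambda>t. zc (y t)) has_real_derivative b * zc (y t) + zc (R t)) (at t within {0..})"
    by (simp add: has_real_derivative_iff_has_vector_derivative A_mult zc_simps)
qed (use a b in auto)

definition Res :: "real \<Rightarrow> real \<Rightarrow> (real \<Rightarrow> real^2) \<Rightarrow> real^2" where
  "Res \<sigma> t y = rhs \<sigma> t y - J *v y t"

text \<open>The residual collects the nonlinearity and the delay term; within radius
  \<open>d\<close> it is small relative to the present value and \<open>e\<close>-Lipschitz in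
  present value and history. The predicate is used with several \<open>e\<close>: one for the
  construction of the graph, others for tangency and for the decay rates.\<close>

definition good :: "real \<Rightarrow> real \<Rightarrow> bool" where
  "good e d \<longleftrightarrow> 0 < d \<and> d \<le> 1 \<and>
     (\<forall>\<sigma> t y. \<sigma>\<^sub>0 \<le> t + \<sigma> \<longrightarrow> lip_on {- \<sigma>..t} M (\<lambda>s. y s $ 1) \<longrightarrow> norm (y t) \<le> d \<longrightarrow>
        norm (Res \<sigma> t y) \<le> e * norm (y t)) \<and>
     (\<forall>\<sigma> t y1 y2 X. \<sigma>\<^sub>0 \<le> t + \<sigma> \<longrightarrow> lip_on {- \<sigma>..t} M (\<lambda>s. y1 s $ 1) \<longrightarrow> lip_on {- \<sigma>..t} M (\<lambda>s. y2 s $ 1) \<longrightarrow>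
        norm (y1 t) \<le> d \<longrightarrow> norm (y2 t) \<le> d \<longrightarrow> (\<forall>s\<in>{- \<sigma>..t}. \<bar>y1 s $ 1 - y2 s $ 1\<bar> \<le> X) \<longrightarrow>
        norm (Res \<sigma> t y1 - Res \<sigma> t y2) \<le> e * (norm (y1 t - y2 t) + X))"

lemma good_pos: "good e d \<Longrightarrow> 0 < d" "good e d \<Longrightarrow> d \<le> 1"
  by (simp_all add: good_def)

text \<open>The linearization error of \<open>f\<close> gets one half of \<open>e\<close>, the delay
  term the other: near the origin it is of relative size \<open>d powr (pexp - 1)\<close>, which
  tends to 0 with \<open>d\<close> because \<open>pexp > 1\<close>. The radius also stays in the
  region where the cut-off is 1.\<close>

lemma good_exists:
  assumes e: "0 < e"
  obtains d where "good e d"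
proof -
  obtain d1 where d1: "0 < d1" "\<And>x y. norm x \<le> d1 \<Longrightarrow> norm y \<le> d1 \<Longrightarrow>
      norm (f x - f y - J *v (x - y)) \<le> e / 2 * norm (x - y)"
    using C1_map_linearization[OF f, of "e / 2"] e by auto
  obtain d2 where d2: "0 < d2" "\<And>x. norm x < d2 \<Longrightarrow> c x = 1" using c1 by blast
  obtain G where G: "0 < G" "\<And>x y. norm x \<le> 1 \<Longrightarrow> norm y \<le> 1 \<Longrightarrow> norm (g x - g y) \<le> G * norm (x - y)"
    "\<And>x. norm x \<le> 1 \<Longrightarrow> norm (g x) \<le> G" using C1_map_lipschitz_ball[OF g] by blast
  define K where "K = (H * K0 + K1) * G"
  have K: "0 < K" unfolding K_def using H K0 K1 G(1) by (intro mult_pos_pos add_pos_pos)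
  \<comment> \<open>Solves \<open>K * d3 powr (pexp - 1) = e / 2\<close>.\<close>
  define d3 where "d3 = (e / (2 * K)) powr (1 / (pexp - 1))"
  have d3: "0 < d3" using e K by (simp add: d3_def)
  define d where "d = min (min d1 (d2 / 2)) (min 1 d3)"
  have d: "0 < d" "d \<le> 1" "d \<le> d1" "d < d2" "d \<le> d3" using d1 d2 d3 by (auto simp: d_def)
  have dp: "K * d powr (pexp - 1) \<le> e / 2"
  proof -
    have "d powr (pexp - 1) \<le> d3 powr (pexp - 1)" using d pexp by (intro powr_mono2) auto
    also have "\<dots> = e / (2 * K)" using e K pexp by (simp add: d3_def powr_powr)
    finally have "K * d powr (pexp - 1) \<le> K * (e / (2 * K))" using K by (intro mult_left_mono) auto
    then show ?thesis using K by simp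
  qed
  have parts: "H * K0 * G * d powr (pexp - 1) + K1 * G * d powr (pexp - 1) \<le> e / 2"
    using dp by (simp add: K_def algebra_simps)
  have nn: "0 \<le> H * K0 * G * d powr (pexp - 1)" "0 \<le> K1 * G * d powr (pexp - 1)" using H K0 K1 G by auto
  let ?h = "\<lambda>\<sigma> t y. hdelay h k (- \<sigma>) t (\<lambda>s. (y s :: real^2) $ 1)"
  have Res: "Res \<sigma> t y = (f (y t) - f 0 - J *v (y t - 0)) + ?h \<sigma> t y *\<^sub>R g (y t)" if "norm (y t) \<le> d" for \<sigma> t y
    using d2(2)[of "y t"] that d by (simp add: Res_def rhs_def f0)
  have hle: "\<bar>?h \<sigma> t y\<bar> * G \<le> e / 2 * norm (y t)" "\<bar>?h \<sigma> t y\<bar> * G \<le> H * K0 * G * d powr (pexp - 1)"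
    if "\<sigma>\<^sub>0 \<le> t + \<sigma>" "lip_on {- \<sigma>..t} M (\<lambda>s. y s $ 1)" "norm (y t) \<le> d" for \<sigma> t and y :: "real \<Rightarrow> real^2"
  proof -
    let ?u = "\<bar>y t $ 1\<bar>"
    have u: "?u \<le> d" "?u \<le> norm (y t)" using comp_le_norm[of "y t"] that by auto
    have "?u powr pexp = ?u powr (pexp - 1) * ?u" by (cases "?u = 0") (auto simp: powr_diff)
    also have "\<dots> \<le> d powr (pexp - 1) * norm (y t)" using u pexp by (intro mult_mono powr_mono2) auto
    finally have up: "?u powr pexp \<le> d powr (pexp - 1) * norm (y t)" .
    have "\<bar>?h \<sigma> t y\<bar> \<le> H * K0 * ?u powr pexp" using that s0 by (intro hdelay_le) auto
    also have "\<dots> \<le> H * K0 * (d powr (pexp - 1) * norm (y t))" using up H K0 by (intro mult_left_mono) auto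
    finally have "\<bar>?h \<sigma> t y\<bar> * G \<le> H * K0 * (d powr (pexp - 1) * norm (y t)) * G" using G by (intro mult_right_mono) auto
    also have "\<dots> = H * K0 * G * d powr (pexp - 1) * norm (y t)" by simp
    finally have 1: "\<bar>?h \<sigma> t y\<bar> * G \<le> H * K0 * G * d powr (pexp - 1) * norm (y t)" .
    also have "\<dots> \<le> e / 2 * norm (y t)" using parts nn by (intro mult_right_mono) auto
    finally show "\<bar>?h \<sigma> t y\<bar> * G \<le> e / 2 * norm (y t)" .
    have "H * K0 * G * d powr (pexp - 1) * norm (y t) \<le> H * K0 * G * d powr (pexp - 1) * 1"
      using nn(1) that(3) d by (intro mult_left_mono) auto
    then show "\<bar>?h \<sigma> t y\<bar> * G \<le> H * K0 * G * d powr (pexp - 1)" using 1 by simp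
  qed
  have "good e d" unfolding good_def
  proof (intro conjI allI impI)
    fix \<sigma> t and y :: "real \<Rightarrow> real^2" assume *: "\<sigma>\<^sub>0 \<le> t + \<sigma>" "lip_on {- \<sigma>..t} M (\<lambda>s. y s $ 1)" "norm (y t) \<le> d"
    have "norm (Res \<sigma> t y) \<le> norm (f (y t) - f 0 - J *v (y t - 0)) + \<bar>?h \<sigma> t y\<bar> * norm (g (y t))"
      unfolding Res[where y = y and t = t, OF *(3)] by (rule norm_triangle_le) simp
    also have "\<dots> \<le> e / 2 * norm (y t - 0) + \<bar>?h \<sigma> t y\<bar> * G"
    proof (intro add_mono mult_left_mono)
      show "norm (f (y t) - f 0 - J *v (y t - 0)) \<le> e / 2 * norm (y t - 0)"
        using * d d1(1) by (intro d1(2)) auto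
    qed (use * d G in auto)
    also have "\<dots> \<le> e * norm (y t)" using hle(1)[OF *] by simp
    finally show "norm (Res \<sigma> t y) \<le> e * norm (y t)" .
  next
    fix \<sigma> t X and y1 y2 :: "real \<Rightarrow> real^2"
    assume t: "\<sigma>\<^sub>0 \<le> t + \<sigma>" and lip: "lip_on {- \<sigma>..t} M (\<lambda>s. y1 s $ 1)" "lip_on {- \<sigma>..t} M (\<lambda>s. y2 s $ 1)"
      and n: "norm (y1 t) \<le> d" "norm (y2 t) \<le> d" and X: "\<forall>s\<in>{- \<sigma>..t}. \<bar>y1 s $ 1 - y2 s $ 1\<bar> \<le> X"
    have X0: "0 \<le> X" using X[rule_format, of t] t s0 by auto
    have eq: "Res \<sigma> t y1 - Res \<sigma> t y2 = (f (y1 t) - f (y2 t) - J *v (y1 t - y2 t)) +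
        ((?h \<sigma> t y1 - ?h \<sigma> t y2) *\<^sub>R g (y1 t) + ?h \<sigma> t y2 *\<^sub>R (g (y1 t) - g (y2 t)))"
      unfolding Res[where y = y1 and t = t, OF n(1)] Res[where y = y2 and t = t, OF n(2)] by (simp add: algebra_simps matrix_vector_mult_diff_distrib)
    have h2: "\<bar>?h \<sigma> t y1 - ?h \<sigma> t y2\<bar> \<le> K1 * d powr (pexp - 1) * X"
      using n comp_le_norm[of "y1 t"] comp_le_norm[of "y2 t"] t
      by (intro hdelay_lipschitz lip X[rule_format]) auto
    have "norm (Res \<sigma> t y1 - Res \<sigma> t y2) \<le> norm (f (y1 t) - f (y2 t) - J *v (y1 t - y2 t)) +
        (\<bar>?h \<sigma> t y1 - ?h \<sigma> t y2\<bar> * norm (g (y1 t)) + \<bar>?h \<sigma> t y2\<bar> * norm (g (y1 t) - g (y2 t)))"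
      unfolding eq
      by (rule order_trans[OF norm_triangle_ineq add_left_mono[OF order_trans[OF norm_triangle_ineq]]]) simp
    also have "\<dots> \<le> e / 2 * norm (y1 t - y2 t) + (K1 * d powr (pexp - 1) * X * G + \<bar>?h \<sigma> t y2\<bar> * (G * norm (y1 t - y2 t)))"
      using n d G h2 X0 K1 by (intro add_mono mult_mono d1(2)) auto
    also have "\<dots> = e / 2 * norm (y1 t - y2 t) + (K1 * G * d powr (pexp - 1) * X + \<bar>?h \<sigma> t y2\<bar> * G * norm (y1 t - y2 t))" by simp
    also have "\<dots> \<le> e / 2 * norm (y1 t - y2 t) + (e * X + e / 2 * norm (y1 t - y2 t))"
      using hle(2)[OF t lip(2) n(2)] parts nn X0 by (intro add_mono mult_right_mono) auto
    also have "\<dots> = e * (norm (y1 t - y2 t) + X)" by (simp add: algebra_simps)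
    finally show "norm (Res \<sigma> t y1 - Res \<sigma> t y2) \<le> e * (norm (y1 t - y2 t) + X)" .
  qed (use d in auto)
  then show ?thesis by (rule that)
qed

lemma rhs_window_bound:
  obtains G where "0 < G" "\<And>\<sigma> \<sigma>' t y. norm (y t) \<le> 1 \<Longrightarrow> norm (rhs \<sigma> t y - rhs \<sigma>' t y) \<le>
    \<bar>hdelay h k (- \<sigma>) t (\<lambda>s. y s $ 1) - hdelay h k (- \<sigma>') t (\<lambda>s. y s $ 1)\<bar> * G"
proof -
  obtain G where G: "0 < G" "\<And>x. norm x \<le> 1 \<Longrightarrow> norm (g x) \<le> G"
    by (rule C1_map_lipschitz_ball[OF g, of 1]) blast
  have "norm (rhs \<sigma> t y - rhs \<sigma>' t y) \<le> \<bar>hdelay h k (- \<sigma>) t (\<lambda>s. y s $ 1) - hdelay h k (- \<sigma>') t (\<lambda>s. y s $ 1)\<bar> * G"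
    if n: "norm (y t) \<le> 1" for \<sigma> \<sigma>' t y
  proof -
    let ?dh = "hdelay h k (- \<sigma>) t (\<lambda>s. y s $ 1) - hdelay h k (- \<sigma>') t (\<lambda>s. y s $ 1)"
    have eq: "rhs \<sigma> t y - rhs \<sigma>' t y = c (y t) *\<^sub>R (?dh *\<^sub>R g (y t))" by (simp add: rhs_def algebra_simps)
    have "norm (rhs \<sigma> t y - rhs \<sigma>' t y) = c (y t) * (\<bar>?dh\<bar> * norm (g (y t)))" unfolding eq using c01 by (simp add: abs_mult)
    also have "\<dots> \<le> 1 * (\<bar>?dh\<bar> * G)" using c01 G(2)[OF n] by (intro mult_mono mult_left_mono) auto
    finally show ?thesis by simp
  qed
  with G(1) show ?thesis using that by blast
qed

lemma sol_saddle:
  assumes "sol \<sigma> \<phi> y"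
  shows "saddle a b (\<lambda>t. y t $ 1) (\<lambda>t. zc (y t)) (\<lambda>t. Res \<sigma> t y $ 1) (\<lambda>t. zc (Res \<sigma> t y))"
  by (rule saddle_of_derivative) (use assms in \<open>auto simp: sol_def Res_def\<close>)

lemma sol_lip_on:
  assumes "hist \<phi>" "\<sigma>\<^sub>0 \<le> \<sigma>" "sol \<sigma> \<phi> y"
  shows "lip_on X M (\<lambda>s. y s $ 1)"
proof -
  have "lip_path y" using sol_lip_path[OF assms(1) _ assms(3)] assms(2) s0 by simp
  then have "lip_on UNIV M (\<lambda>s. y s $ 1)" using lip_on_UNIV assms by (simp add: sol_def)
  then show ?thesis by (rule lip_on_subset) simp
qed

lemma sol_continuous:
  assumes "hist \<phi>" "\<sigma>\<^sub>0 \<le> \<sigma>" "sol \<sigma> \<phi> y"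
  shows "continuous_on UNIV y"
proof -
  have "lip_path y" using sol_lip_path[OF assms(1) _ assms(3)] assms(2) s0 by simp
  then show ?thesis using extends_continuous lip_path_continuous assms by (auto simp: hist_def sol_def)
qed

lemma small_residual:
  assumes y: "hist \<phi>" "\<sigma>\<^sub>0 \<le> \<sigma>" "sol \<sigma> \<phi> y" and gd: "good e d" and e: "0 \<le> e" and t: "0 \<le> t" "norm (y t) \<le> d"
  shows "\<bar>Res \<sigma> t y $ 1\<bar> \<le> S\<^sup>2 * e * (\<bar>y t $ 1\<bar> + \<bar>zc (y t)\<bar>)"
    "\<bar>zc (Res \<sigma> t y)\<bar> \<le> S\<^sup>2 * e * (\<bar>y t $ 1\<bar> + \<bar>zc (y t)\<bar>)"
proof -
  have "norm (Res \<sigma> t y) \<le> e * norm (y t)"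
    using gd sol_lip_on[OF y] t y(2) unfolding good_def by auto
  also have "\<dots> \<le> e * (S * (\<bar>y t $ 1\<bar> + \<bar>zc (y t)\<bar>))"
  proof (rule mult_left_mono[OF _ e])
    have "1 * \<bar>zc (y t)\<bar> \<le> S * \<bar>zc (y t)\<bar>" using S by (intro mult_right_mono) auto
    then show "norm (y t) \<le> S * (\<bar>y t $ 1\<bar> + \<bar>zc (y t)\<bar>)" using norm_le_coords[of "y t"] by (simp add: algebra_simps)
  qed
  finally have n: "norm (Res \<sigma> t y) \<le> e * (S * (\<bar>y t $ 1\<bar> + \<bar>zc (y t)\<bar>))" .
  have "S * norm (Res \<sigma> t y) \<le> S * (e * (S * (\<bar>y t $ 1\<bar> + \<bar>zc (y t)\<bar>)))" using n S by (intro mult_left_mono) auto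
  then have Sn: "S * norm (Res \<sigma> t y) \<le> S\<^sup>2 * e * (\<bar>y t $ 1\<bar> + \<bar>zc (y t)\<bar>)" by (simp add: power2_eq_square algebra_simps)
  show "\<bar>zc (Res \<sigma> t y)\<bar> \<le> S\<^sup>2 * e * (\<bar>y t $ 1\<bar> + \<bar>zc (y t)\<bar>)" using zc_le_norm Sn by (rule order_trans)
  have "1 * norm (Res \<sigma> t y) \<le> S * norm (Res \<sigma> t y)" using S by (intro mult_right_mono) auto
  then show "\<bar>Res \<sigma> t y $ 1\<bar> \<le> S\<^sup>2 * e * (\<bar>y t $ 1\<bar> + \<bar>zc (y t)\<bar>)"
    using comp_le_norm[of "Res \<sigma> t y"] Sn by linarith
qed

text \<open>The smallest admissible width \<open>q\<close> of the cone is proportional to the size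
  \<open>e\<close> of the residual: width 1 is enough for decay, arbitrarily small widths give
  tangency.\<close>

lemma small_cone:
  assumes y: "hist \<phi>" "\<sigma>\<^sub>0 \<le> \<sigma>" "sol \<sigma> \<phi> y" and gd: "good e d" and e: "0 \<le> e" "4 * (S\<^sup>2 * e) \<le> q * min a b"
    and q: "0 < q" "q \<le> 1" and n: "\<And>t. 0 \<le> t \<Longrightarrow> norm (y t) \<le> d" and t: "0 \<le> t"
  shows "\<bar>zc (y t)\<bar> \<le> q * \<bar>y t $ 1\<bar>"
proof -
  interpret saddle a b "\<lambda>t. y t $ 1" "\<lambda>t. zc (y t)" "\<lambda>t. Res \<sigma> t y $ 1" "\<lambda>t. zc (Res \<sigma> t y)"
    using sol_saddle[OF y(3)] .
  show ?thesis
  proof (rule bounded_in_cone[OF q _ e(2) _ _ _ t])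
    fix x :: real assume x: "0 \<le> x"
    show "\<bar>zc (y x)\<bar> \<le> S * d"
      using zc_le_norm[of "y x"] mult_left_mono[OF n[OF x], of S] S by linarith
  qed (use small_residual[OF y gd e(1)] n e(1) in auto)
qed

lemma small_decay:
  assumes y: "hist \<phi>" "\<sigma>\<^sub>0 \<le> \<sigma>" "sol \<sigma> \<phi> y" and gd: "good e d" and e: "0 \<le> e" and st: "0 \<le> s" "s \<le> t"
    and n: "\<And>r. r \<in> {s..t} \<Longrightarrow> norm (y r) \<le> d" and cone: "\<And>r. r \<in> {s..t} \<Longrightarrow> \<bar>zc (y r)\<bar> \<le> \<bar>y r $ 1\<bar>"
  shows "\<bar>y t $ 1\<bar> \<le> exp (- (a - 2 * (S\<^sup>2 * e)) * (t - s)) * \<bar>y s $ 1\<bar>"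
proof -
  interpret saddle a b "\<lambda>t. y t $ 1" "\<lambda>t. zc (y t)" "\<lambda>t. Res \<sigma> t y $ 1" "\<lambda>t. zc (Res \<sigma> t y)"
    using sol_saddle[OF y(3)] .
  show ?thesis
    by (rule decay_in_cone[OF _ st _ cone]) (use small_residual[OF y gd e] n e st in auto)
qed

text \<open>Along two bounded orbits the supremum of the difference is controlled by the difference of the
  histories and of the delay windows only: the unstable component is determined by boundedness.\<close>
lemma two_solutions:
  assumes y1: "hist \<phi>1" "\<sigma>\<^sub>0 \<le> \<sigma>1" "sol \<sigma>1 \<phi>1 y1" and y2: "hist \<phi>2" "\<sigma>\<^sub>0 \<le> \<sigma>2" "sol \<sigma>2 \<phi>2 y2"
    and gd: "good e d" and e: "0 \<le> e" "2 * (S * e * (S + 2)) \<le> min a b"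
    and n: "\<And>t. 0 \<le> t \<Longrightarrow> norm (y1 t) \<le> d" "\<And>t. 0 \<le> t \<Longrightarrow> norm (y2 t) \<le> d"
    and D0: "\<And>s. s \<in> {- \<sigma>1..0} \<Longrightarrow> \<bar>\<phi>1 s $ 1 - \<phi>2 s $ 1\<bar> \<le> D0"
    and W: "\<And>t. 0 \<le> t \<Longrightarrow> norm (rhs \<sigma>1 t y2 - rhs \<sigma>2 t y2) \<le> W"
  shows "\<bar>zc (\<phi>1 0) - zc (\<phi>2 0)\<bar> \<le> 3 * D0 + 2 * S * W / min a b"
proof -
  let ?R = "\<lambda>t. Res \<sigma>1 t y1 - Res \<sigma>2 t y2" and ?y = "\<lambda>t. y1 t - y2 t" and ?m = "min a b"
  have m: "0 < ?m" using a b by simp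
  then have m0: "?m \<noteq> 0" by (rule less_imp_neq[symmetric])
  have ext: "extends \<phi>1 y1" "extends \<phi>2 y2" using y1 y2 by (auto simp: sol_def)
  interpret saddle a b "\<lambda>t. ?y t $ 1" "\<lambda>t. zc (?y t)" "\<lambda>t. ?R t $ 1" "\<lambda>t. zc (?R t)"
  proof (rule saddle_of_derivative)
    fix t :: real assume t: "0 \<le> t"
    have "(?y has_vector_derivative rhs \<sigma>1 t y1 - rhs \<sigma>2 t y2) (at t within {0..})"
      using t y1 y2 by (intro has_vector_derivative_diff) (auto simp: sol_def)
    then show "(?y has_vector_derivative J *v ?y t + ?R t) (at t within {0..})"
      by (simp add: Res_def matrix_vector_mult_diff_distrib)
  qed
  define F where "F t = max \<bar>?y t $ 1\<bar> \<bar>zc (?y t)\<bar>" for t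
  have Fle: "F t \<le> S * (2 * d)" if t: "0 \<le> t" for t
  proof -
    have "norm (?y t) \<le> 2 * d" using norm_triangle_ineq4[of "y1 t" "y2 t"] n[OF t] by linarith
    then have "S * norm (?y t) \<le> S * (2 * d)" using S by (intro mult_left_mono) auto
    moreover have "1 * norm (?y t) \<le> S * norm (?y t)" using S by (intro mult_right_mono) auto
    ultimately show ?thesis using comp_le_norm[of "?y t"] zc_le_norm[of "?y t"] by (simp add: F_def)
  qed
  \<comment> \<open>Finite because both orbits stay in a bounded ball for all time.\<close>
  define X where "X = (SUP t\<in>{0..}. F t)"
  have FX: "F t \<le> X" if "0 \<le> t" for t
    unfolding X_def by (rule cSUP_upper) (use that Fle in \<open>auto intro!: bdd_aboveI[of _ "S * (2 * d)"]\<close>)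
  have X0: "0 \<le> X" using order_trans[OF abs_ge_zero, of "?y 0 $ 1" X] FX[of 0] by (simp add: F_def)
  have D00: "0 \<le> D0" using D0[of 0] y1(2) s0 by simp
  define B where "B = S * (e * ((S + 1) * X + (X + D0)) + W)"
  have Rle: "norm (?R t) \<le> e * ((S + 1) * X + (X + D0)) + W" if t: "0 \<le> t" for t
  proof -
    have c: "\<bar>?y t $ 1\<bar> \<le> X" "\<bar>zc (?y t)\<bar> \<le> X" using FX[OF t] by (simp_all add: F_def)
    have "S * \<bar>?y t $ 1\<bar> \<le> S * X" using c S by (intro mult_left_mono) auto
    then have n1: "norm (?y t) \<le> (S + 1) * X" using norm_le_coords[of "?y t"] c by (simp add: algebra_simps)
    have "norm (Res \<sigma>1 t y1 - Res \<sigma>1 t y2) \<le> e * (norm (?y t) + (X + D0))"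
    proof -
      have "\<forall>s\<in>{- \<sigma>1..t}. \<bar>y1 s $ 1 - y2 s $ 1\<bar> \<le> X + D0"
      proof
        fix s assume s: "s \<in> {- \<sigma>1..t}"
        show "\<bar>y1 s $ 1 - y2 s $ 1\<bar> \<le> X + D0"
        proof (cases "s \<le> 0")
          case True
          then show ?thesis using D0[of s] s ext X0 by (simp add: extends_def)
        next
          case False
          then show ?thesis using FX[of s] D00 by (simp add: F_def)
        qed
      qed
      then show ?thesis using gd sol_lip_on[OF y1] sol_lip_on[OF y2] n[OF t] t y1(2) unfolding good_def by auto
    qed
    also have "\<dots> \<le> e * ((S + 1) * X + (X + D0))" using n1 e(1) by (intro mult_left_mono) auto
    finally have 1: "norm (Res \<sigma>1 t y1 - Res \<sigma>1 t y2) \<le> e * ((S + 1) * X + (X + D0))" .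
    \<comment> \<open>\<open>y2\<close> is regarded as a solution for the window of
      \<open>\<sigma>1\<close> with a defect of at most \<open>W\<close>.\<close>
    have "?R t = (Res \<sigma>1 t y1 - Res \<sigma>1 t y2) + (rhs \<sigma>1 t y2 - rhs \<sigma>2 t y2)" by (simp add: Res_def)
    then have "norm (?R t) \<le> norm (Res \<sigma>1 t y1 - Res \<sigma>1 t y2) + norm (rhs \<sigma>1 t y2 - rhs \<sigma>2 t y2)"
      by (simp only: norm_triangle_ineq)
    then show ?thesis using 1 W[OF t] by linarith
  qed
  have W0: "0 \<le> W" using order_trans[OF norm_ge_zero W[of 0]] by simp
  have SR: "S * norm (?R t) \<le> B" if "0 \<le> t" for t
    unfolding B_def using Rle[OF that] S by (intro mult_left_mono) auto
  have r2: "\<bar>zc (?R t)\<bar> \<le> B" if "0 \<le> t" for t using order_trans[OF zc_le_norm SR[OF that]] .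
  have r1: "\<bar>?R t $ 1\<bar> \<le> B" if "0 \<le> t" for t
  proof -
    have "1 * norm (?R t) \<le> S * norm (?R t)" using S by (intro mult_right_mono) auto
    then show ?thesis using comp_le_norm[of "?R t"] SR[OF that] by linarith
  qed
  have B0: "0 \<le> B" using r1[of 0] by simp
  have Bm: "B / a \<le> B / ?m" "B / b \<le> B / ?m" using B0 m a b by (auto intro!: divide_left_mono)
  have "F t \<le> D0 + B / ?m" if t: "0 \<le> t" for t
  proof -
    have "\<bar>?y t $ 1\<bar> \<le> \<bar>?y 0 $ 1\<bar> + B / a" using r1 t by (intro stable_bound) auto
    moreover have "\<bar>?y 0 $ 1\<bar> \<le> D0" using D0[of 0] y1(2) s0 ext by (simp add: extends_def)
    moreover have "\<bar>zc (?y t)\<bar> \<le> B / b"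
    proof (rule unstable_bound[OF r2 _ t])
      show "\<bar>zc (?y x)\<bar> \<le> X" if "0 \<le> x" for x using FX[OF that] by (simp add: F_def)
    qed
    ultimately show ?thesis using Bm D00 by (simp add: F_def)
  qed
  then have XB: "X \<le> D0 + B / ?m" unfolding X_def by (intro cSUP_least) auto
  have "B \<le> S * e * (S + 2) * (X + D0) + S * W"
  proof -
    have "(S + 1) * X + (X + D0) \<le> (S + 2) * (X + D0)" using S D00 by (simp add: algebra_simps add_nonneg_nonneg)
    then have "e * ((S + 1) * X + (X + D0)) \<le> e * ((S + 2) * (X + D0))" using e by (intro mult_left_mono) auto
    then have "S * (e * ((S + 1) * X + (X + D0)) + W) \<le> S * (e * ((S + 2) * (X + D0)) + W)" using S by (intro mult_left_mono) auto
    then show ?thesis unfolding B_def by (simp add: algebra_simps)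
  qed
  \<comment> \<open>By the smallness of \<open>e\<close> the supremum \<open>X\<close> returns with
    factor 1/2 and can be absorbed; this is the origin of the factors 3 and 2 in the claim.\<close>
  also have "\<dots> \<le> ?m / 2 * (X + D0) + S * W" using e(2) X0 D00 by (intro add_right_mono mult_right_mono) auto
  finally have "B / ?m \<le> (?m / 2 * (X + D0) + S * W) / ?m" using m by (intro divide_right_mono) auto
  also have "\<dots> = (X + D0) / 2 + S * W / ?m" using m0 by (simp add: add_divide_distrib)
  finally have BW: "B / ?m \<le> (X + D0) / 2 + S * W / ?m" .
  have "X \<le> 3 * D0 + 2 * Y" if "P \<le> (X + D0) / 2 + Y" "X \<le> D0 + P" for P Y :: real
    using that by argo
  from this[OF BW XB] have "X \<le> 3 * D0 + 2 * (S * W / ?m)" .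
  moreover have "\<bar>zc (\<phi>1 0) - zc (\<phi>2 0)\<bar> \<le> X" using FX[of 0] ext by (simp add: F_def extends_def zc_simps)
  ultimately show ?thesis by (simp add: mult.assoc)
qed

section \<open>Shooting along the unstable direction\<close>

definition pert :: "segment \<Rightarrow> real \<Rightarrow> segment" where
  "pert \<psi> \<zeta> = (\<lambda>\<theta>. if \<theta> \<le> 0 then \<psi> \<theta> + (\<zeta> * exp (b * \<theta>)) *\<^sub>R axis 2 1 else 0)"

lemma axis2: "(axis 2 1 :: real^2) $ 1 = 0" "zc (r *\<^sub>R axis 2 1) = r" "norm (axis 2 1 :: real^2) = 1"
  by (simp_all add: zc_def axis_def norm_axis_1[unfolded axis_def])

lemma pert_1: "\<theta> \<le> 0 \<Longrightarrow> pert \<psi> \<zeta> \<theta> $ 1 = \<psi> \<theta> $ 1"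
  by (simp add: pert_def axis2)

lemma pert_0: "pert \<psi> \<zeta> 0 = \<psi> 0 + \<zeta> *\<^sub>R axis 2 1"
  by (simp add: pert_def)

text \<open>The added term has no first component, so the Lipschitz condition in \<open>hist\<close>
  is unaffected by the size of \<open>\<zeta>\<close>.\<close>

lemma hist_pert:
  assumes "hist \<psi>"
  shows "hist (pert \<psi> \<zeta>)"
proof -
  from assms have psi: "\<psi> \<in> Btilde lam" and lip: "lip_on {..0} M (\<lambda>s. \<psi> s $ 1)" by (auto simp: hist_def)
  from psi obtain K where K: "\<And>\<theta>. \<theta> \<le> 0 \<Longrightarrow> exp (lam * \<theta>) * norm (\<psi> \<theta>) \<le> K"
    unfolding Btilde_def bdd_above_def by auto
  have "continuous_on {..0} (\<lambda>\<theta>. \<psi> \<theta> + (\<zeta> * exp (b * \<theta>)) *\<^sub>R axis 2 1)"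
    using psi by (intro continuous_intros) (auto simp: Btilde_def)
  then have 1: "continuous_on {..0} (pert \<psi> \<zeta>)" by (rule continuous_on_eq) (simp add: pert_def)
  have "exp (lam * \<theta>) * norm (pert \<psi> \<zeta> \<theta>) \<le> K + \<bar>\<zeta>\<bar>" if th: "\<theta> \<le> 0" for \<theta>
  proof -
    have e: "exp (lam * \<theta>) \<le> 1" "exp (b * \<theta>) \<le> 1" using lam b th by (auto simp: mult_nonneg_nonpos)
    have "norm (pert \<psi> \<zeta> \<theta>) \<le> norm (\<psi> \<theta>) + \<bar>\<zeta>\<bar> * exp (b * \<theta>)"
      using th by (auto simp: pert_def axis2 abs_mult intro!: norm_triangle_le)
    then have "exp (lam * \<theta>) * norm (pert \<psi> \<zeta> \<theta>) \<le> exp (lam * \<theta>) * (norm (\<psi> \<theta>) + \<bar>\<zeta>\<bar> * exp (b * \<theta>))"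
      by (intro mult_left_mono) auto
    also have "\<dots> = exp (lam * \<theta>) * norm (\<psi> \<theta>) + exp (lam * \<theta>) * (\<bar>\<zeta>\<bar> * exp (b * \<theta>))" by (simp add: algebra_simps)
    also have "\<dots> \<le> K + 1 * (\<bar>\<zeta>\<bar> * 1)" using K[OF th] e by (intro add_mono mult_mono) auto
    finally show ?thesis by simp
  qed
  then have "bdd_above ((\<lambda>\<theta>. exp (lam * \<theta>) * norm (pert \<psi> \<zeta> \<theta>)) ` {..0})" by (intro bdd_aboveI[of _ "K + \<bar>\<zeta>\<bar>"]) auto
  with 1 have "pert \<psi> \<zeta> \<in> Btilde lam" by (simp add: Btilde_def pert_def)
  moreover have "lip_on {..0} M (\<lambda>s. pert \<psi> \<zeta> s $ 1)" using lip by (simp add: lip_on_def pert_1)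
  ultimately show ?thesis by (simp add: hist_def)
qed

definition soln :: "real \<Rightarrow> segment \<Rightarrow> real \<Rightarrow> real^2" where
  "soln \<sigma> \<phi> = (THE y. sol \<sigma> \<phi> y)"

lemma soln_eqI: "hist \<phi> \<Longrightarrow> \<sigma>\<^sub>0 \<le> \<sigma> \<Longrightarrow> sol \<sigma> \<phi> y \<Longrightarrow> soln \<sigma> \<phi> = y"
  unfolding soln_def using sol_unique by blast

lemma sol_soln: "hist \<phi> \<Longrightarrow> \<sigma>\<^sub>0 \<le> \<sigma> \<Longrightarrow> sol \<sigma> \<phi> (soln \<sigma> \<phi>)"
  using sol_exists soln_eqI by metis

lemma soln_0: "hist \<phi> \<Longrightarrow> \<sigma>\<^sub>0 \<le> \<sigma> \<Longrightarrow> \<theta> \<le> 0 \<Longrightarrow> soln \<sigma> \<phi> \<theta> = \<phi> \<theta>"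
  using sol_soln by (simp add: sol_def extends_def)

text \<open>The history may be non-trivial: once the first component vanishes, the delay term stays zero.\<close>
lemma soln_zero:
  assumes h: "hist \<phi>" and s: "\<sigma>\<^sub>0 \<le> \<sigma>" and z: "\<phi> 0 = 0" and t: "0 \<le> t"
  shows "soln \<sigma> \<phi> t = 0"
proof -
  let ?y = "\<lambda>t. if t \<le> 0 then \<phi> t else 0"
  have y0: "?y t = 0" if "0 \<le> t" for t using that z by auto
  have "sol \<sigma> \<phi> ?y" unfolding sol_def extends_def
  proof (intro conjI allI impI)
    fix t :: real assume t: "0 \<le> t"
    have "\<exists>s\<in>{- \<sigma>..t}. ?y s $ 1 = 0" using t s s0 z by (intro bexI[of _ 0]) auto
    then have "hdelay h k (- \<sigma>) t (\<lambda>s. ?y s $ 1) = 0" by (simp only: hdelay_def if_True)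
    then have "rhs \<sigma> t ?y = 0" using y0[OF t] by (simp add: rhs_def f0)
    moreover have "(?y has_vector_derivative 0) (at t within {0..})"
      by (rule has_vector_derivative_transform[OF _ _ has_vector_derivative_const]) (use t y0 in auto)
    ultimately show "(?y has_vector_derivative rhs \<sigma> t ?y) (at t within {0..})" by simp
  qed simp
  then show ?thesis using soln_eqI[OF h s] y0[OF t] by simp
qed

text \<open>The orbit has to stay in the ball of radius \<open>d\<close> until it is outside the
  cone, because only in that ball is the equation a small perturbation of the saddle. The sign
  \<epsilon> selects the side; strict inequalities make the set open.\<close>

definition exits :: "real \<Rightarrow> segment \<Rightarrow> real \<Rightarrow> real \<Rightarrow> real set" where
  "exits \<sigma> \<psi> d \<epsilon> = {\<zeta>. \<exists>t\<ge>0. (\<forall>s\<in>{0..t}. norm (soln \<sigma> (pert \<psi> \<zeta>) s) < d) \<and>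
     \<bar>soln \<sigma> (pert \<psi> \<zeta>) t $ 1\<bar> < \<epsilon> * zc (soln \<sigma> (pert \<psi> \<zeta>) t)}"

lemma open_exits:
  assumes h: "hist \<psi>" and s: "\<sigma>\<^sub>0 \<le> \<sigma>" and eps: "\<bar>\<epsilon>\<bar> = 1"
  shows "open (exits \<sigma> \<psi> d \<epsilon>)"
  unfolding open_dist
proof
  fix \<zeta> assume "\<zeta> \<in> exits \<sigma> \<psi> d \<epsilon>"
  then obtain t where t: "0 \<le> t" and small: "\<And>r. r \<in> {0..t} \<Longrightarrow> norm (soln \<sigma> (pert \<psi> \<zeta>) r) < d"
    and ex: "\<bar>soln \<sigma> (pert \<psi> \<zeta>) t $ 1\<bar> < \<epsilon> * zc (soln \<sigma> (pert \<psi> \<zeta>) t)"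
    unfolding exits_def by blast
  let ?y = "\<lambda>\<zeta>. soln \<sigma> (pert \<psi> \<zeta>)"
  have hp: "hist (pert \<psi> \<zeta>')" for \<zeta>' using hist_pert[OF h] .
  have sl: "sol \<sigma> (pert \<psi> \<zeta>') (?y \<zeta>')" for \<zeta>' using sol_soln[OF hp s] .
  have "continuous_on {0..t} (\<lambda>r. norm (?y \<zeta> r))"
    using continuous_on_subset[OF sol_continuous[OF hp s sl]] by (intro continuous_on_norm) auto
  then obtain m where m: "m \<in> {0..t}" "\<And>r. r \<in> {0..t} \<Longrightarrow> norm (?y \<zeta> r) \<le> norm (?y \<zeta> m)"
    using continuous_attains_sup[of "{0..t}"] t by (metis atLeastAtMost_iff compact_Icc empty_iff order_refl)
  \<comment> \<open>The margin left by both inequalities: a change of the point by less than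
    \<open>p\<close> affects \<open>\<bar>u\<bar>\<close> and \<open>\<epsilon> * zc\<close>
    together by less than \<open>(S + 1) * p\<close>.\<close>
  define p where "p = min (d - norm (?y \<zeta> m)) ((\<epsilon> * zc (?y \<zeta> t) - \<bar>?y \<zeta> t $ 1\<bar>) / (S + 1))"
  have p: "0 < p" using small[OF m(1)] ex S by (simp add: p_def)
  have B0: "0 \<le> norm (\<psi> 0) + \<bar>\<zeta>\<bar> + 1" by simp
  obtain L where L: "0 < L" and dep: "\<And>\<phi>1 \<phi>2 y1 y2 r. hist \<phi>1 \<Longrightarrow> hist \<phi>2 \<Longrightarrow> sol \<sigma> \<phi>1 y1 \<Longrightarrow> sol \<sigma> \<phi>2 y2 \<Longrightarrow>
      (\<And>s. s \<le> 0 \<Longrightarrow> \<phi>1 s $ 1 = \<phi>2 s $ 1) \<Longrightarrow> norm (\<phi>1 0) \<le> norm (\<psi> 0) + \<bar>\<zeta>\<bar> + 1 \<Longrightarrow>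
      norm (\<phi>2 0) \<le> norm (\<psi> 0) + \<bar>\<zeta>\<bar> + 1 \<Longrightarrow>
      r \<in> {0..t} \<Longrightarrow> norm (y1 r - y2 r) \<le> 2 * norm (\<phi>1 0 - \<phi>2 0) * exp (2 * L * r)"
    using sol_dependence[OF s t B0] by blast
  define q where "q = min 1 (p / (2 * exp (2 * L * t)))"
  have q: "0 < q" using p by (simp add: q_def)
  have "\<zeta>' \<in> exits \<sigma> \<psi> d \<epsilon>" if "dist \<zeta>' \<zeta> < q" for \<zeta>'
  proof -
    have z: "\<bar>\<zeta>' - \<zeta>\<bar> < q" using that by (simp add: dist_real_def)
    have nle: "norm (pert \<psi> \<zeta>' 0) \<le> norm (\<psi> 0) + \<bar>\<zeta>\<bar> + 1" if "\<bar>\<zeta>' - \<zeta>\<bar> \<le> 1" for \<zeta>'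
    proof -
      have "norm (pert \<psi> \<zeta>' 0) \<le> norm (\<psi> 0) + \<bar>\<zeta>'\<bar>" unfolding pert_0
        by (rule norm_triangle_le) (simp add: axis2)
      then show ?thesis using that by linarith
    qed
    have close: "norm (?y \<zeta>' r - ?y \<zeta> r) < p" if r: "r \<in> {0..t}" for r
    proof -
      have "norm (?y \<zeta>' r - ?y \<zeta> r) \<le> 2 * norm (pert \<psi> \<zeta>' 0 - pert \<psi> \<zeta> 0) * exp (2 * L * r)"
        using z by (intro dep[OF hp hp sl sl _ _ _ r] nle) (auto simp: pert_1 q_def)
      also have "pert \<psi> \<zeta>' 0 - pert \<psi> \<zeta> 0 = (\<zeta>' - \<zeta>) *\<^sub>R axis 2 1" by (simp add: pert_0 algebra_simps)
      also have "2 * norm ((\<zeta>' - \<zeta>) *\<^sub>R axis 2 1 :: real^2) * exp (2 * L * r) = 2 * \<bar>\<zeta>' - \<zeta>\<bar> * exp (2 * L * r)"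
        by (simp add: axis2)
      also have "\<dots> \<le> 2 * \<bar>\<zeta>' - \<zeta>\<bar> * exp (2 * L * t)" using r L by (intro mult_left_mono) auto
      also have "\<dots> < 2 * (p / (2 * exp (2 * L * t))) * exp (2 * L * t)"
        using z by (intro mult_strict_right_mono) (auto simp: q_def)
      also have "\<dots> = p" by simp
      finally show ?thesis .
    qed
    have "norm (?y \<zeta>' r) < d" if r: "r \<in> {0..t}" for r
    proof -
      have "norm (?y \<zeta>' r) \<le> norm (?y \<zeta> r) + norm (?y \<zeta>' r - ?y \<zeta> r)"
        using norm_triangle_ineq[of "?y \<zeta> r" "?y \<zeta>' r - ?y \<zeta> r"] by simp
      also have "\<dots> < norm (?y \<zeta> m) + p" using m(2)[OF r] close[OF r] by linarith
      also have "\<dots> \<le> d" by (simp add: p_def)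
      finally show ?thesis .
    qed
    moreover have "\<bar>?y \<zeta>' t $ 1\<bar> < \<epsilon> * zc (?y \<zeta>' t)"
    proof -
      let ?D = "?y \<zeta>' t - ?y \<zeta> t"
      have D: "norm ?D < p" using close t by simp
      have "\<bar>\<epsilon> * zc ?D\<bar> \<le> S * norm ?D" using zc_le_norm[of ?D] eps by (simp add: abs_mult)
      then have 1: "\<epsilon> * zc (?y \<zeta>' t) \<ge> \<epsilon> * zc (?y \<zeta> t) - S * norm ?D" by (simp add: zc_simps algebra_simps)
      have 2: "\<bar>?y \<zeta>' t $ 1\<bar> \<le> \<bar>?y \<zeta> t $ 1\<bar> + norm ?D" using comp_le_norm[of ?D] by simp
      have "(S + 1) * norm ?D < (S + 1) * p" using D S by (intro mult_strict_left_mono) auto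
      also have "\<dots> \<le> (S + 1) * ((\<epsilon> * zc (?y \<zeta> t) - \<bar>?y \<zeta> t $ 1\<bar>) / (S + 1))" using S by (intro mult_left_mono) (auto simp: p_def)
      also have "\<dots> = \<epsilon> * zc (?y \<zeta> t) - \<bar>?y \<zeta> t $ 1\<bar>" using S by simp
      finally show ?thesis using 1 2 by (simp add: algebra_simps)
    qed
    ultimately show ?thesis unfolding exits_def using t by blast
  qed
  then show "\<exists>e>0. \<forall>y. dist y \<zeta> < e \<longrightarrow> y \<in> exits \<sigma> \<psi> d \<epsilon>" using q by blast
qed

text \<open>Outside the cone the sign of the unstable coordinate cannot change.\<close>
lemma exits_disjoint:
  assumes h: "hist \<psi>" and s: "\<sigma>\<^sub>0 \<le> \<sigma>" and gd: "good e d" and e: "0 \<le> e" "4 * (S\<^sup>2 * e) \<le> min a b"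
  shows "exits \<sigma> \<psi> d 1 \<inter> exits \<sigma> \<psi> d (- 1) = {}"
proof (rule ccontr)
  assume "exits \<sigma> \<psi> d 1 \<inter> exits \<sigma> \<psi> d (- 1) \<noteq> {}"
  then obtain \<zeta> where z: "\<zeta> \<in> exits \<sigma> \<psi> d 1" "\<zeta> \<in> exits \<sigma> \<psi> d (- 1)" by blast
  let ?y = "soln \<sigma> (pert \<psi> \<zeta>)"
  have hp: "hist (pert \<psi> \<zeta>)" using hist_pert[OF h] .
  have sl: "sol \<sigma> (pert \<psi> \<zeta>) ?y" using sol_soln[OF hp s] .
  interpret saddle a b "\<lambda>t. ?y t $ 1" "\<lambda>t. zc (?y t)" "\<lambda>t. Res \<sigma> t ?y $ 1" "\<lambda>t. zc (Res \<sigma> t ?y)"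
    using sol_saddle[OF sl] .
  have False if t: "0 \<le> t1" "t1 \<le> t2" and small: "\<forall>r\<in>{0..t2}. norm (?y r) < d"
    and ep: "\<bar>\<epsilon>\<bar> = 1" "\<bar>?y t1 $ 1\<bar> < \<epsilon> * zc (?y t1)" "\<bar>?y t2 $ 1\<bar> < - \<epsilon> * zc (?y t2)" for \<epsilon> t1 t2
  proof -
    \<comment> \<open>A change of sign forces a zero of \<open>zc\<close> in between; there
      \<open>zc\<^sup>2 - u\<^sup>2\<close> is at most 0, although it was positive at
      \<open>t1\<close> and does not decrease.\<close>
    have "continuous_on {t1..t2} (\<lambda>t. \<epsilon> * zc (?y t))"
      using continuous_on_subset[OF sol_continuous[OF hp s sl]]
      by (intro continuous_on_mult_left bounded_linear.continuous_on[OF bounded_linear_zc]) auto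
    moreover have "\<epsilon> * zc (?y t2) \<le> 0" "0 \<le> \<epsilon> * zc (?y t1)"
      using ep(2,3) abs_ge_zero[of "?y t1 $ 1"] abs_ge_zero[of "?y t2 $ 1"] by linarith+
    ultimately obtain r where r: "t1 \<le> r" "r \<le> t2" "\<epsilon> * zc (?y r) = 0"
      using IVT2'[of "\<lambda>t. \<epsilon> * zc (?y t)" t2 0 t1] t(2) by blast
    then have zr: "zc (?y r) = 0" using ep(1) by auto
    have "(zc (?y t1))\<^sup>2 - 1\<^sup>2 * (?y t1 $ 1)\<^sup>2 \<le> (zc (?y r))\<^sup>2 - 1\<^sup>2 * (?y r $ 1)\<^sup>2"
    proof (rule cone_nondecreasing[where e = "S\<^sup>2 * e"])
      fix x assume x: "x \<in> {t1..r}"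
      then have "x \<in> {0..t2}" using t r by auto
      then have "0 \<le> x" "norm (?y x) \<le> d" using small by (auto intro: less_imp_le)
      then show "\<bar>Res \<sigma> x ?y $ 1\<bar> \<le> S\<^sup>2 * e * (\<bar>?y x $ 1\<bar> + \<bar>zc (?y x)\<bar>)"
        "\<bar>zc (Res \<sigma> x ?y)\<bar> \<le> S\<^sup>2 * e * (\<bar>?y x $ 1\<bar> + \<bar>zc (?y x)\<bar>)"
        using small_residual[OF hp s sl gd e(1)] by blast+
    qed (use e t r in auto)
    then have "(zc (?y t1))\<^sup>2 - (?y t1 $ 1)\<^sup>2 \<le> - ((?y r $ 1)\<^sup>2)" using zr by simp
    then have "(zc (?y t1))\<^sup>2 \<le> (?y t1 $ 1)\<^sup>2" using zero_le_power2[of "?y r $ 1"] by linarith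
    then have "\<bar>zc (?y t1)\<bar> \<le> \<bar>?y t1 $ 1\<bar>" by (simp add: abs_le_square_iff)
    moreover have "\<epsilon> * zc (?y t1) \<le> \<bar>zc (?y t1)\<bar>"
      using abs_ge_self[of "\<epsilon> * zc (?y t1)"] ep(1) by (simp add: abs_mult)
    ultimately show False using ep(2) by linarith
  qed
  note * = this
  from z obtain t1 t2 where t: "0 \<le> t1" "\<forall>r\<in>{0..t1}. norm (?y r) < d" "\<bar>?y t1 $ 1\<bar> < 1 * zc (?y t1)"
    "0 \<le> t2" "\<forall>r\<in>{0..t2}. norm (?y r) < d" "\<bar>?y t2 $ 1\<bar> < - 1 * zc (?y t2)" unfolding exits_def by blast
  show False
  proof (cases "t1 \<le> t2")
    case True
    then show False using *[of t1 t2 1] t by simp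
  next
    case False
    then show False using *[of t2 t1 "- 1"] t by simp
  qed
qed

lemma bounded_perturbation_exists:
  assumes h: "hist \<psi>" and zc0: "zc (\<psi> 0) = 0" and s: "\<sigma>\<^sub>0 \<le> \<sigma>" and gd: "good e d"
    and e: "0 \<le> e" "4 * (S\<^sup>2 * e) \<le> min a b" and small: "(S + 2) * \<bar>\<psi> 0 $ 1\<bar> < d"
  obtains \<zeta> where "\<And>t. 0 \<le> t \<Longrightarrow> norm (soln \<sigma> (pert \<psi> \<zeta>) t) \<le> (S + 1) * \<bar>\<psi> 0 $ 1\<bar>"
proof (cases "\<psi> 0 $ 1 = 0")
  \<comment> \<open>The interval of candidates would degenerate to a point; the history then ends in
    the origin, and the zero continuation is the bounded orbit.\<close>
  case True
  then have "\<psi> 0 = 0" using zc0 by (simp add: vec2_eq_iff zc_def)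
  then have "pert \<psi> 0 0 = 0" by (simp add: pert_0)
  then have "soln \<sigma> (pert \<psi> 0) t = 0" if "0 \<le> t" for t using soln_zero[OF hist_pert[OF h] s _ that] by blast
  then show ?thesis using that[of 0] True by simp
next
  case False
  let ?u = "\<bar>\<psi> 0 $ 1\<bar>" and ?y = "\<lambda>\<zeta>. soln \<sigma> (pert \<psi> \<zeta>)"
  have u: "0 < ?u" using False by simp
  have hp: "hist (pert \<psi> \<zeta>)" for \<zeta> using hist_pert[OF h] .
  have sl: "sol \<sigma> (pert \<psi> \<zeta>) (?y \<zeta>)" for \<zeta> using sol_soln[OF hp s] .
  have y0: "?y \<zeta> 0 $ 1 = \<psi> 0 $ 1" "zc (?y \<zeta> 0) = \<zeta>" for \<zeta>
    using soln_0[OF hp s, of 0] zc0 by (simp_all add: pert_0 axis2 zc_simps)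
  have y0n: "norm (?y \<zeta> 0) < d" if "\<bar>\<zeta>\<bar> \<le> 2 * ?u" for \<zeta>
  proof -
    have "norm (?y \<zeta> 0) \<le> S * ?u + 2 * ?u" using norm_le_coords[of "?y \<zeta> 0"] that y0 by simp
    then show ?thesis using small by (simp add: algebra_simps)
  qed
  \<comment> \<open>For these two values the orbit is outside the cone already at time 0.\<close>
  have "2 * ?u \<in> exits \<sigma> \<psi> d 1" "- 2 * ?u \<in> exits \<sigma> \<psi> d (- 1)"
    unfolding exits_def using u y0 y0n by (auto intro!: exI[of _ 0])
  then have ne: "exits \<sigma> \<psi> d 1 \<inter> {- 2 * ?u..2 * ?u} \<noteq> {}" "exits \<sigma> \<psi> d (- 1) \<inter> {- 2 * ?u..2 * ?u} \<noteq> {}"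
    using u by auto
  have "\<not> {- 2 * ?u..2 * ?u} \<subseteq> exits \<sigma> \<psi> d 1 \<union> exits \<sigma> \<psi> d (- 1)"
  proof
    assume "{- 2 * ?u..2 * ?u} \<subseteq> exits \<sigma> \<psi> d 1 \<union> exits \<sigma> \<psi> d (- 1)"
    then have "exits \<sigma> \<psi> d 1 \<inter> {- 2 * ?u..2 * ?u} = {} \<or> exits \<sigma> \<psi> d (- 1) \<inter> {- 2 * ?u..2 * ?u} = {}"
      using exits_disjoint[OF h s gd e] open_exits[OF h s]
      by (intro connectedD[OF connected_Icc]) auto
    then show False using ne by blast
  qed
  then obtain \<zeta> where "\<zeta> \<in> {- 2 * ?u..2 * ?u}" "\<zeta> \<notin> exits \<sigma> \<psi> d 1" "\<zeta> \<notin> exits \<sigma> \<psi> d (- 1)" by blast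
  then have z: "\<bar>\<zeta>\<bar> \<le> 2 * ?u" "\<zeta> \<notin> exits \<sigma> \<psi> d 1" "\<zeta> \<notin> exits \<sigma> \<psi> d (- 1)" by auto
  \<comment> \<open>Lying in neither exit set means staying in the cone as long as the orbit stays
    in the ball.\<close>
  have cone: "\<bar>zc (?y \<zeta> t)\<bar> \<le> \<bar>?y \<zeta> t $ 1\<bar>" if "0 \<le> t" "\<forall>r\<in>{0..t}. norm (?y \<zeta> r) < d" for t
    using z(2,3) that unfolding exits_def by (force simp: abs_le_iff)
  have bound: "norm (?y \<zeta> t) \<le> (S + 1) * ?u" if t: "0 \<le> t" "\<forall>r\<in>{0..t}. norm (?y \<zeta> r) < d" for t
  proof -
    have "\<bar>?y \<zeta> t $ 1\<bar> \<le> exp (- (a - 2 * (S\<^sup>2 * e)) * (t - 0)) * \<bar>?y \<zeta> 0 $ 1\<bar>"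
    proof (rule small_decay[OF hp s sl gd e(1)])
      fix r assume r: "r \<in> {0..t}"
      show "norm (?y \<zeta> r) \<le> d" using r t by (auto intro: less_imp_le)
      show "\<bar>zc (?y \<zeta> r)\<bar> \<le> \<bar>?y \<zeta> r $ 1\<bar>" using r t by (intro cone) auto
    qed (use t in auto)
    also have "\<dots> \<le> 1 * ?u"
    proof (rule mult_mono)
      have "0 \<le> a - 2 * (S\<^sup>2 * e)" using e S a by (auto simp: min_def split: if_splits)
      then show "exp (- (a - 2 * (S\<^sup>2 * e)) * (t - 0)) \<le> 1" using t by (simp add: mult_nonpos_nonneg)
    qed (use y0 in auto)
    finally have ut: "\<bar>?y \<zeta> t $ 1\<bar> \<le> ?u" by simp
    then have "S * \<bar>?y \<zeta> t $ 1\<bar> \<le> S * ?u" using S by (intro mult_left_mono) auto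
    then show ?thesis using norm_le_coords[of "?y \<zeta> t"] cone[OF t] ut by (simp add: algebra_simps)
  qed
  have lt: "(S + 1) * ?u < d" using small u by (simp add: algebra_simps)
  \<comment> \<open>At the first time \<open>q\<close> with norm at least \<open>d\<close>,
    continuity would still give the bound \<open>(S + 1) * ?u < d\<close> from the times before; so
    the ball is never left and the cone condition holds for ever.\<close>
  have all: "norm (?y \<zeta> t) < d" if t: "0 \<le> t" for t
  proof (rule ccontr)
    assume "\<not> norm (?y \<zeta> t) < d"
    define Z where "Z = {0..t} \<inter> {r. d \<le> norm (?y \<zeta> r)}"
    have cont: "continuous_on UNIV (?y \<zeta>)" using sol_continuous[OF hp s sl] .
    have "closed {r. d \<le> norm (?y \<zeta> r)}" by (intro closed_Collect_le continuous_intros cont)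
    then have "compact Z" unfolding Z_def by (intro compact_Int_closed) auto
    moreover have "t \<in> Z" using t \<open>\<not> norm (?y \<zeta> t) < d\<close> by (simp add: Z_def)
    ultimately obtain q where q: "q \<in> Z" "\<And>r. r \<in> Z \<Longrightarrow> q \<le> r"
      using compact_attains_inf[of Z] by blast
    have before: "norm (?y \<zeta> r) < d" if "0 \<le> r" "r < q" for r
      using q(2)[of r] q(1) that by (force simp: Z_def)
    have q0: "0 < q" using q(1) y0n[OF z(1)] by (cases "q = 0") (auto simp: Z_def)
    have le: "norm (?y \<zeta> r) \<le> (S + 1) * ?u" if "r \<in> {0..<q}" for r
      using that before by (intro bound) auto
    have "norm (?y \<zeta> q) \<le> (S + 1) * ?u"
    proof (rule continuous_le_on_closure[of "{0..<q}" "\<lambda>r. norm (?y \<zeta> r)"])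
      show "continuous_on (closure {0..<q}) (\<lambda>r. norm (?y \<zeta> r))"
        by (intro continuous_on_norm continuous_on_subset[OF cont]) simp
    qed (use q0 le in auto)
    then show False using q(1) lt by (simp add: Z_def)
  qed
  show ?thesis by (rule that[of \<zeta>]) (use bound all in auto)
qed

end

section \<open>The local stable manifold\<close>

lemma has_vector_derivative_shift:
  fixes x :: "real \<Rightarrow> 'a::real_normed_vector"
  shows "((\<lambda>s. x (p + s)) has_vector_derivative v) (at t within {q..}) \<longleftrightarrow>
    (x has_vector_derivative v) (at (p + t) within {p + q..})"
proof
  have img: "(+) p ` {q..} = {p + q..}" for p q :: real by (auto simp: image_iff intro: bexI[of _ "_ - p"])
  have d: "((+) p has_vector_derivative 1) (at t within T)" for p t :: real and T
    by (auto intro!: derivative_eq_intros simp flip: has_real_derivative_iff_has_vector_derivative)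
  {
    assume "(x has_vector_derivative v) (at (p + t) within {p + q..})"
    then have "(x has_vector_derivative v) (at (p + t) within (+) p ` {q..})" by (simp add: img)
    from vector_diff_chain_within[OF d this] show "((\<lambda>s. x (p + s)) has_vector_derivative v) (at t within {q..})"
      by (simp add: o_def)
  }
  assume "((\<lambda>s. x (p + s)) has_vector_derivative v) (at t within {q..})"
  then have "((\<lambda>s. x (p + s)) has_vector_derivative v) (at (- p + (p + t)) within (+) (- p) ` {p + q..})"
    unfolding img by simp
  from vector_diff_chain_within[OF d this] show "(x has_vector_derivative v) (at (p + t) within {p + q..})"
    by (simp add: o_def)
qed

lemma Btilde_bounded:
  assumes "\<phi> \<in> Btilde lam"
  obtains K where "\<And>\<theta>. \<theta> \<le> 0 \<Longrightarrow> exp (lam * \<theta>) * norm (\<phi> \<theta>) \<le> K"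
  using assms unfolding Btilde_def bdd_above_def by auto

lemma seg_diff_Btilde:
  assumes "\<phi> \<in> Btilde lam" "\<psi> \<in> Btilde lam"
  shows "seg_diff \<phi> \<psi> \<in> Btilde lam"
proof -
  obtain K1 where K1: "\<And>\<theta>. \<theta> \<le> 0 \<Longrightarrow> exp (lam * \<theta>) * norm (\<phi> \<theta>) \<le> K1"
    using Btilde_bounded[OF assms(1)] by blast
  obtain K2 where K2: "\<And>\<theta>. \<theta> \<le> 0 \<Longrightarrow> exp (lam * \<theta>) * norm (\<psi> \<theta>) \<le> K2"
    using Btilde_bounded[OF assms(2)] by blast
  have "exp (lam * \<theta>) * norm (\<phi> \<theta> - \<psi> \<theta>) \<le> K1 + K2" if th: "\<theta> \<le> 0" for \<theta>
  proof -
    have "exp (lam * \<theta>) * norm (\<phi> \<theta> - \<psi> \<theta>) \<le> exp (lam * \<theta>) * (norm (\<phi> \<theta>) + norm (\<psi> \<theta>))"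
      by (intro mult_left_mono norm_triangle_ineq4) auto
    then show ?thesis using K1[OF th] K2[OF th] by (simp add: algebra_simps)
  qed
  then have "bdd_above ((\<lambda>\<theta>. exp (lam * \<theta>) * norm (seg_diff \<phi> \<psi> \<theta>)) ` {..0})"
    by (intro bdd_aboveI[of _ "K1 + K2"]) (auto simp: seg_diff_def)
  moreover have "continuous_on {..0} (seg_diff \<phi> \<psi>)"
    unfolding seg_diff_def using assms by (intro continuous_intros) (auto simp: Btilde_def)
  ultimately show ?thesis using assms by (auto simp: Btilde_def seg_diff_def)
qed

section \<open>Segments of solutions in the phase space\<close>

context delay_system
begin

text \<open>At absolute time \<open>\<sigma> + t\<close> the segment is read on
  \<open>[- (\<sigma> + t), 0]\<close>; in shifted time this is the window
  \<open>[- \<sigma>, t]\<close>, whose left end is fixed.\<close>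

lemma is_solution_iff_sol: "is_solution f g h k c \<phi> \<sigma> x \<longleftrightarrow> sol \<sigma> \<phi> (\<lambda>s. x (\<sigma> + s))"
proof -
  have eq: "c (x (\<sigma> + t)) *\<^sub>R delay_rhs f g h k (\<sigma> + t) (seg x (\<sigma> + t)) = rhs \<sigma> t (\<lambda>s. x (\<sigma> + s))" for t
    using hdelay_shift[of "- \<sigma>" \<sigma> t "\<lambda>r. x r $ 1"] by (simp add: delay_rhs_seg rhs_def add.commute)
  have "(\<forall>t\<ge>\<sigma>. (x has_vector_derivative c (x t) *\<^sub>R delay_rhs f g h k t (seg x t)) (at t within {\<sigma>..})) \<longleftrightarrow>
    (\<forall>t\<ge>0. ((\<lambda>s. x (\<sigma> + s)) has_vector_derivative rhs \<sigma> t (\<lambda>s. x (\<sigma> + s))) (at t within {0..}))"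
    (is "?L \<longleftrightarrow> ?R")
  proof
    assume L: ?L
    show ?R
    proof (intro allI impI)
      fix t :: real assume "0 \<le> t"
      then show "((\<lambda>s. x (\<sigma> + s)) has_vector_derivative rhs \<sigma> t (\<lambda>s. x (\<sigma> + s))) (at t within {0..})"
        using L[rule_format, of "\<sigma> + t"] by (simp add: has_vector_derivative_shift eq)
    qed
  next
    assume R: ?R
    show ?L
    proof (intro allI impI)
      fix t :: real assume "\<sigma> \<le> t"
      then show "(x has_vector_derivative c (x t) *\<^sub>R delay_rhs f g h k t (seg x t)) (at t within {\<sigma>..})"
        using R[rule_format, of "t - \<sigma>"] eq[of "t - \<sigma>"] by (simp add: has_vector_derivative_shift)
    qed
  qed
  then show ?thesis by (simp add: is_solution_def sol_def extends_def)
qed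

lemma Bspace_hist: "\<phi> \<in> Bspace lam M \<Longrightarrow> hist \<phi>"
  unfolding hist_def lip_on_def Bspace_def
proof safe
  fix s t :: real
  assume le: "\<forall>s\<le>0. \<forall>t\<le>0. norm (\<phi> s - \<phi> t) \<le> M * \<bar>s - t\<bar>" "s \<le> 0" "t \<le> 0"
  then have "norm (\<phi> s - \<phi> t) \<le> M * \<bar>s - t\<bar>" by blast
  then show "\<bar>\<phi> s $ 1 - \<phi> t $ 1\<bar> \<le> M * \<bar>s - t\<bar>"
    using component_le_norm_cart[of "\<phi> s - \<phi> t" 1] by simp
qed

end

context stable_setting
begin

lemma mu_eq:
  assumes "hist \<phi>" "\<sigma>\<^sub>0 \<le> \<sigma>"
  shows "mu f g h k c t \<phi> \<sigma> = seg (soln \<sigma> \<phi>) (t - \<sigma>)"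
proof -
  have "(THE x. is_solution f g h k c \<phi> \<sigma> x) = (\<lambda>t. soln \<sigma> \<phi> (t - \<sigma>))"
  proof (rule the_equality)
    show "is_solution f g h k c \<phi> \<sigma> (\<lambda>t. soln \<sigma> \<phi> (t - \<sigma>))"
      unfolding is_solution_iff_sol using sol_soln[OF assms] by simp
    fix x assume "is_solution f g h k c \<phi> \<sigma> x"
    then have "soln \<sigma> \<phi> = (\<lambda>s. x (\<sigma> + s))" unfolding is_solution_iff_sol by (rule soln_eqI[OF assms])
    then show "x = (\<lambda>t. soln \<sigma> \<phi> (t - \<sigma>))" by simp
  qed
  then show ?thesis by (simp add: mu_def seg_def fun_eq_iff algebra_simps)
qed

lemma seg_soln_Btilde:
  assumes "hist \<phi>" "\<sigma>\<^sub>0 \<le> \<sigma>" "0 \<le> s"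
  shows "seg (soln \<sigma> \<phi>) s \<in> Btilde lam"
  using assms(1) sol_soln[OF assms(1,2)] sol_continuous[OF assms(1,2) sol_soln[OF assms(1,2)]]
  by (intro seg_Btilde[OF _ _ _ assms(3)]) (auto simp: hist_def sol_def intro: continuous_on_subset)

lemma hist_seg:
  assumes "hist \<phi>" "\<sigma>\<^sub>0 \<le> \<sigma>" "0 \<le> s"
  shows "hist (seg (soln \<sigma> \<phi>) s)"
proof -
  have "lip_on UNIV M (\<lambda>s. soln \<sigma> \<phi> s $ 1)" using sol_lip_on[OF assms(1,2) sol_soln[OF assms(1,2)]] .
  then have "lip_on {..0} M (\<lambda>r. seg (soln \<sigma> \<phi>) s r $ 1)" unfolding lip_on_def
  proof (intro ballI)
    fix p q :: real
    assume lip: "\<forall>x\<in>UNIV. \<forall>y\<in>UNIV. \<bar>soln \<sigma> \<phi> x $ 1 - soln \<sigma> \<phi> y $ 1\<bar> \<le> M * \<bar>x - y\<bar>" and pq: "p \<in> {..0}" "q \<in> {..0}"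
    show "\<bar>seg (soln \<sigma> \<phi>) s p $ 1 - seg (soln \<sigma> \<phi>) s q $ 1\<bar> \<le> M * \<bar>p - q\<bar>"
      using lip[rule_format, of "s + p" "s + q"] pq by (simp add: seg_def)
  qed
  then show ?thesis using seg_soln_Btilde[OF assms] by (simp add: hist_def)
qed

text \<open>The delay integral always begins at absolute time 0, so restarting at a later time
  changes neither the window nor the equation.\<close>

lemma soln_semigroup:
  assumes h: "hist \<phi>" and s: "\<sigma>\<^sub>0 \<le> \<sigma>" and t: "0 \<le> t"
  shows "soln (\<sigma> + t) (seg (soln \<sigma> \<phi>) t) = (\<lambda>r. soln \<sigma> \<phi> (t + r))"
proof (rule soln_eqI[OF hist_seg[OF h s t]])
  let ?y = "soln \<sigma> \<phi>"
  show "sol (\<sigma> + t) (seg ?y t) (\<lambda>r. ?y (t + r))" unfolding sol_def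
  proof (intro conjI allI impI)
    show "extends (seg ?y t) (\<lambda>r. ?y (t + r))" by (simp add: extends_def seg_def)
    fix r :: real assume r: "0 \<le> r"
    have "rhs (\<sigma> + t) r (\<lambda>r. ?y (t + r)) = rhs \<sigma> (t + r) ?y"
      using hdelay_shift[of "- (\<sigma> + t)" t r "\<lambda>s. ?y s $ 1"] by (simp add: rhs_def add.commute)
    moreover have "(?y has_vector_derivative rhs \<sigma> (t + r) ?y) (at (t + r) within {0..})"
      using sol_soln[OF h s] t r by (simp add: sol_def)
    then have "(?y has_vector_derivative rhs \<sigma> (t + r) ?y) (at (t + r) within {t + 0..})"
      by (rule has_vector_derivative_within_subset) (use t in auto)
    ultimately show "((\<lambda>r. ?y (t + r)) has_vector_derivative rhs (\<sigma> + t) r (\<lambda>r. ?y (t + r))) (at r within {0..})"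
      by (simp add: has_vector_derivative_shift)
  qed
qed (use s t in auto)

text \<open>The Lipschitz condition now concerns the whole vector: the history has it by assumption,
  the solution through the global bound on the field, and the two are joined at time 0.\<close>

lemma seg_soln_Bspace:
  assumes phi: "\<phi> \<in> Bspace lam M" and s: "\<sigma>\<^sub>0 \<le> \<sigma>" and t: "0 \<le> t"
  shows "seg (soln \<sigma> \<phi>) t \<in> Bspace lam M"
proof -
  let ?y = "soln \<sigma> \<phi>"
  have h: "hist \<phi>" using Bspace_hist[OF phi] .
  have y0: "?y \<theta> = \<phi> \<theta>" if "\<theta> \<le> 0" for \<theta> using soln_0[OF h s that] .
  have lp: "lip_path ?y" using sol_lip_path[OF h _ sol_soln[OF h s]] s s0 by simp
  have neg: "norm (?y p - ?y q) \<le> M * \<bar>p - q\<bar>" if "p \<le> 0" "q \<le> 0" for p q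
    using phi that by (simp add: Bspace_def y0)
  have pos: "norm (?y p - ?y q) \<le> M * \<bar>p - q\<bar>" if "0 \<le> p" "0 \<le> q" for p q
    using lp that by (simp add: lip_path_def)
  have mix: "norm (?y p - ?y q) \<le> M * \<bar>p - q\<bar>" if "p \<le> 0" "0 \<le> q" for p q
  proof -
    have "norm (?y p - ?y q) \<le> norm (?y p - ?y 0) + norm (?y 0 - ?y q)"
      using norm_triangle_ineq[of "?y p - ?y 0" "?y 0 - ?y q"] by simp
    also have "\<dots> \<le> M * \<bar>p - 0\<bar> + M * \<bar>0 - q\<bar>" using neg[of p 0] pos[of 0 q] that by (intro add_mono) auto
    also have "\<dots> = M * \<bar>p - q\<bar>" using that by (simp add: algebra_simps)
    finally show ?thesis .
  qed
  have all: "norm (?y p - ?y q) \<le> M * \<bar>p - q\<bar>" for p q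
  proof (cases "p \<le> 0"; cases "q \<le> 0")
    assume "\<not> p \<le> 0" "q \<le> 0"
    then show ?thesis using mix[of q p] by (simp add: abs_minus_commute norm_minus_commute)
  qed (use neg mix pos in auto)
  have "norm (seg ?y t p - seg ?y t q) \<le> M * \<bar>p - q\<bar>" if "p \<le> 0" "q \<le> 0" for p q
    using all[of "t + p" "t + q"] that by (simp add: seg_def)
  then show ?thesis using seg_soln_Btilde[OF h s t] by (simp add: Bspace_def)
qed

section \<open>The unstable component of a segment as a real number\<close>

definition eu :: "real \<Rightarrow> segment" where
  "eu \<zeta> = (\<lambda>\<theta>. if \<theta> \<le> 0 then (\<zeta> * exp (b * \<theta>)) *\<^sub>R axis 2 1 else 0)"

lemma eu_0: "eu \<zeta> 0 = \<zeta> *\<^sub>R axis 2 1"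
  by (simp add: eu_def)

lemma seg_diff_eu: "seg_diff (eu \<zeta>) (eu \<zeta>') = eu (\<zeta> - \<zeta>')"
  by (simp add: seg_diff_def eu_def fun_eq_iff left_diff_distrib flip: scaleR_left_diff_distrib)

lemma pert_eq_seg_add: "\<psi> \<in> Btilde lam \<Longrightarrow> pert \<psi> \<zeta> = seg_add \<psi> (eu \<zeta>)"
  by (auto simp: pert_def seg_add_def eu_def Btilde_def fun_eq_iff)

text \<open>The hypothesis bounds the largest slope of \<open>eu \<zeta>\<close>, reached at 0. It
  is the reason why the radius of the graph must also be small compared with
  \<open>M / b\<close>.\<close>

lemma eu_Bspace:
  assumes "b * \<bar>\<zeta>\<bar> \<le> M"
  shows "eu \<zeta> \<in> Bspace lam M"
proof -
  have "continuous_on {..0} (\<lambda>\<theta>. (\<zeta> * exp (b * \<theta>)) *\<^sub>R (axis 2 1 :: real^2))" by (intro continuous_intros)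
  then have 1: "continuous_on {..0} (eu \<zeta>)" by (rule continuous_on_eq) (simp add: eu_def)
  have 2: "bdd_above ((\<lambda>\<theta>. exp (lam * \<theta>) * norm (eu \<zeta> \<theta>)) ` {..0})"
  proof (rule bdd_aboveI[of _ "\<bar>\<zeta>\<bar>"], clarsimp)
    fix \<theta> :: real assume th: "\<theta> \<le> 0"
    have "exp (lam * \<theta>) * (\<bar>\<zeta>\<bar> * exp (b * \<theta>)) \<le> 1 * (\<bar>\<zeta>\<bar> * 1)"
      using lam b th by (intro mult_mono) (auto simp: mult_nonneg_nonpos)
    then show "exp (lam * \<theta>) * norm (eu \<zeta> \<theta>) \<le> \<bar>\<zeta>\<bar>" using th by (simp add: eu_def axis2 abs_mult)
  qed
  have le: "norm (eu \<zeta> s - eu \<zeta> t) \<le> M * \<bar>s - t\<bar>" if st: "s \<le> t" "t \<le> 0" for s t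
  proof -
    have "exp (b * t) - exp (b * s) = exp (b * t) * (1 - exp (- (b * (t - s))))"
      by (simp add: right_diff_distrib algebra_simps flip: exp_add)
    also have "\<dots> \<le> 1 * (b * (t - s))"
      using exp_ge_add_one_self[of "- (b * (t - s))"] b st by (intro mult_mono) (auto simp: mult_nonneg_nonpos)
    finally have d: "exp (b * t) - exp (b * s) \<le> b * (t - s)" by simp
    have "eu \<zeta> s - eu \<zeta> t = (\<zeta> * (exp (b * s) - exp (b * t))) *\<^sub>R axis 2 1"
      using st by (simp add: eu_def right_diff_distrib scaleR_left_diff_distrib)
    then have "norm (eu \<zeta> s - eu \<zeta> t) = \<bar>\<zeta>\<bar> * (exp (b * t) - exp (b * s))"
      using st b by (simp add: axis2 abs_mult)
    also have "\<dots> \<le> \<bar>\<zeta>\<bar> * (b * (t - s))" using d by (intro mult_left_mono) auto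
    also have "\<dots> = b * \<bar>\<zeta>\<bar> * (t - s)" by simp
    also have "\<dots> \<le> M * (t - s)" using assms st by (intro mult_right_mono) auto
    finally show ?thesis using st by simp
  qed
  have "norm (eu \<zeta> s - eu \<zeta> t) \<le> M * \<bar>s - t\<bar>" if "s \<le> 0" "t \<le> 0" for s t
    using le[of s t] le[of t s] that by (cases "s \<le> t") (auto simp: norm_minus_commute abs_minus_commute)
  with 1 2 show ?thesis by (simp add: Bspace_def Btilde_def eu_def)
qed

lemma eu_Eu:
  assumes "b * \<bar>\<zeta>\<bar> \<le> M"
  shows "eu \<zeta> \<in> Eu lam M J"
  unfolding Eu_def
proof (intro CollectI conjI allI impI)
  have u: "(\<zeta> *\<^sub>R axis 2 1 :: real^2) $ 1 = 0" by (simp add: axis2)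
  then show "eu \<zeta> 0 \<in> unstable_space J" by (simp add: eu_0 unst)
  fix \<theta> :: real assume "\<theta> \<le> 0"
  then show "eu \<zeta> \<theta> = exp_mat J \<theta> (eu \<zeta> 0)" using exp_mat_unstable[OF u, of \<theta>] by (simp add: eu_def b_def mult.commute)
qed (rule eu_Bspace[OF assms])

lemma Bnorm_eu: "Bnorm lam (eu \<zeta>) \<le> \<bar>\<zeta>\<bar>"
proof (rule Bnorm_le)
  fix \<theta> :: real assume th: "\<theta> \<le> 0"
  have "exp (lam * \<theta>) * (\<bar>\<zeta>\<bar> * exp (b * \<theta>)) \<le> 1 * (\<bar>\<zeta>\<bar> * 1)"
    using lam b th by (intro mult_mono) (auto simp: mult_nonneg_nonpos)
  then show "exp (lam * \<theta>) * norm (eu \<zeta> \<theta>) \<le> \<bar>\<zeta>\<bar>" using th by (simp add: eu_def axis2 abs_mult)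
qed

lemma Pi_u_eq: "Pi_u J \<phi> = eu (zc (\<phi> 0))"
proof -
  have p: "P_u J (\<phi> 0) = zc (\<phi> 0) *\<^sub>R axis 2 1" by (simp add: P_u_eq vec2_eq_iff zc_def axis_def)
  have "exp_mat J \<theta> (zc (\<phi> 0) *\<^sub>R axis 2 1) = (zc (\<phi> 0) * exp (b * \<theta>)) *\<^sub>R axis 2 1" for \<theta>
    using exp_mat_unstable[of "zc (\<phi> 0) *\<^sub>R axis 2 1" \<theta>] by (simp add: axis2 b_def mult.commute)
  then show ?thesis by (simp add: Pi_u_def p eu_def fun_eq_iff)
qed

lemma Pi_s_eq: "Pi_s J \<phi> = seg_diff \<phi> (eu (zc (\<phi> 0)))"
  by (simp add: Pi_s_def Pi_u_eq)

lemma Pi_s_eq_pert: "\<phi> \<in> Btilde lam \<Longrightarrow> Pi_s J \<phi> = pert \<phi> (- zc (\<phi> 0))"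
  by (auto simp: Pi_s_eq pert_def seg_diff_def eu_def Btilde_def fun_eq_iff)

lemma pert_Pi_s: "\<phi> \<in> Btilde lam \<Longrightarrow> pert (Pi_s J \<phi>) (zc (\<phi> 0)) = \<phi>"
  by (auto simp: Pi_s_eq pert_def seg_diff_def eu_def Btilde_def fun_eq_iff)

lemma Pi_s_pert:
  assumes "\<psi> \<in> Btilde lam" "zc (\<psi> 0) = 0"
  shows "Pi_s J (pert \<psi> \<zeta>) = \<psi>"
  using assms by (auto simp: Pi_s_eq pert_def seg_diff_def eu_def Btilde_def fun_eq_iff zc_simps axis2)

text \<open>A projected element of the phase space need not be \<open>M\<close>-Lipschitz, but
  projecting changes only the second component, so it remains an admissible history.\<close>

lemma Es_ball_hist:
  assumes "\<psi> \<in> Es_ball lam M J r"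
  shows "hist \<psi>" "zc (\<psi> 0) = 0" "\<bar>\<psi> 0 $ 1\<bar> \<le> Bnorm lam \<psi>" "Bnorm lam \<psi> \<le> r"
proof -
  have "hist \<psi> \<and> zc (\<psi> 0) = 0"
  proof (cases "\<psi> \<in> Es lam M J")
    case True
    then show ?thesis using Bspace_hist by (auto simp: Es_def stable_space_eq zc_def)
  next
    case False
    then obtain \<phi> where phi: "\<phi> \<in> Bspace lam M" "\<psi> = Pi_s J \<phi>" using assms by (auto simp: Es_ball_def)
    then have "\<psi> = pert \<phi> (- zc (\<phi> 0))" by (simp add: Pi_s_eq_pert Bspace_def)
    then show ?thesis using hist_pert[OF Bspace_hist[OF phi(1)]] by (simp add: pert_def zc_simps axis2)
  qed
  then show h: "hist \<psi>" and "zc (\<psi> 0) = 0" by auto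
  show "\<bar>\<psi> 0 $ 1\<bar> \<le> Bnorm lam \<psi>"
    using comp_le_norm[of "\<psi> 0"] Bnorm_ge_0[of \<psi> lam] h by (simp add: hist_def)
  show "Bnorm lam \<psi> \<le> r" using assms by (simp add: Es_ball_def)
qed

lemma norm_soln_le_Bnorm:
  assumes "hist \<phi>" "\<sigma>\<^sub>0 \<le> \<sigma>" "0 \<le> t"
  shows "norm (soln \<sigma> \<phi> t) \<le> Bnorm lam (seg (soln \<sigma> \<phi>) t)"
  using Bnorm_ge_0[OF seg_soln_Btilde[OF assms]] by (simp add: seg_def)

text \<open>The segment is split at the initial time: the old history has moved back by
  \<open>t\<close> and is damped by \<open>exp (- lam * t)\<close>, so only the new part needs
  dynamics.\<close>

lemma Bnorm_seg_le:
  assumes h: "hist \<phi>" and s: "\<sigma>\<^sub>0 \<le> \<sigma>" and t: "0 \<le> t" and K: "0 \<le> K"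
    and fwd: "\<And>r. r \<in> {0..t} \<Longrightarrow> exp (- lam * (t - r)) * norm (soln \<sigma> \<phi> r) \<le> K"
    and past: "exp (- lam * t) * Bnorm lam \<phi> \<le> K"
  shows "Bnorm lam (seg (soln \<sigma> \<phi>) t) \<le> K"
proof (rule Bnorm_le)
  fix \<theta> :: real assume th: "\<theta> \<le> 0"
  show "exp (lam * \<theta>) * norm (seg (soln \<sigma> \<phi>) t \<theta>) \<le> K"
  proof (cases "0 \<le> t + \<theta>")
    case True
    then show ?thesis using fwd[of "t + \<theta>"] th by (simp add: seg_def)
  next
    case False
    then have neg: "t + \<theta> \<le> 0" by simp
    have "exp (lam * \<theta>) * norm (seg (soln \<sigma> \<phi>) t \<theta>) = exp (- lam * t) * (exp (lam * (t + \<theta>)) * norm (\<phi> (t + \<theta>)))"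
      using th soln_0[OF h s neg] by (simp add: seg_def algebra_simps flip: exp_add)
    also have "\<dots> \<le> exp (- lam * t) * Bnorm lam \<phi>"
      using Bnorm_ge[OF _ neg, of \<phi> lam] h by (intro mult_left_mono) (auto simp: hist_def)
    also have "\<dots> \<le> K" by (rule past)
    finally show ?thesis .
  qed
qed

lemma W_loc_iff:
  "(\<phi>, \<sigma>) \<in> W_loc f g h k c lam M \<sigma>\<^sub>0 r \<delta> \<longleftrightarrow> \<phi> \<in> Bspace lam M \<and> \<sigma>\<^sub>0 \<le> \<sigma> \<and> Bnorm lam (Pi_s J \<phi>) < r \<and>
     (\<forall>t\<ge>0. Bnorm lam (seg (soln \<sigma> \<phi>) t) < \<delta>)"
proof -
  have "(\<forall>t\<ge>\<sigma>. Bnorm lam (mu f g h k c t \<phi> \<sigma>) < \<delta>) \<longleftrightarrow> (\<forall>t\<ge>0. Bnorm lam (seg (soln \<sigma> \<phi>) t) < \<delta>)"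
    if "\<phi> \<in> Bspace lam M" "\<sigma>\<^sub>0 \<le> \<sigma>"
  proof -
    note m = mu_eq[OF Bspace_hist[OF that(1)] that(2)]
    show ?thesis unfolding m
    proof (intro iffI allI impI)
      fix t :: real assume *: "\<forall>t\<ge>\<sigma>. Bnorm lam (seg (soln \<sigma> \<phi>) (t - \<sigma>)) < \<delta>" "0 \<le> t"
      then show "Bnorm lam (seg (soln \<sigma> \<phi>) t) < \<delta>" using *(1)[rule_format, of "\<sigma> + t"] by simp
    qed simp
  qed
  then show ?thesis by (auto simp: W_loc_def)
qed

end

section \<open>Choice of constants and the graph of the stable manifold\<close>

context stable_setting
begin

text \<open>Small enough for three purposes at once: the cone of width 1 and decay inside it, the
  absorption of the supremum in the comparison of two orbits, and a growth constant of at most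
  \<open>lam\<close> for the backward error of the unstable component.\<close>

definition eps :: real where "eps = min (min a b) lam / (8 * S\<^sup>2 * (S + 2))"

lemma eps: "0 < eps" "4 * (S\<^sup>2 * eps) \<le> min a b" "2 * (S * eps * (S + 2)) \<le> min a b" "2 * (S\<^sup>2 * eps) \<le> lam"
  "4 * (S\<^sup>2 * eps) \<le> a"
proof -
  define m where "m = min (min a b) lam"
  have m: "0 < m" "m \<le> min a b" "m \<le> lam" "m \<le> a" using a b lam by (auto simp: m_def)
  define P where "P = S + 2"
  have P: "1 \<le> P" "0 < P" "1 \<le> S" "0 < S" using S by (auto simp: P_def)
  have eps_eq: "eps = m / (8 * S\<^sup>2 * P)" by (simp add: eps_def m_def P_def)
  show e0: "0 < eps" using m P by (simp add: eps_eq)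
  have "4 * (S\<^sup>2 * eps) = m / (2 * P)" using P by (simp add: eps_eq field_simps)
  also have "\<dots> \<le> m / 1" using m P by (intro divide_left_mono) auto
  finally have 1: "4 * (S\<^sup>2 * eps) \<le> m" by simp
  then show "4 * (S\<^sup>2 * eps) \<le> min a b" "4 * (S\<^sup>2 * eps) \<le> a" using m by linarith+
  have "0 \<le> S\<^sup>2 * eps" using e0 by simp
  then show "2 * (S\<^sup>2 * eps) \<le> lam" using 1 m by linarith
  have "2 * (S * eps * P) = m / (4 * S)" using P by (simp add: eps_eq field_simps power2_eq_square)
  also have "\<dots> \<le> m / 1" using m P by (intro divide_left_mono) auto
  finally show "2 * (S * eps * (S + 2)) \<le> min a b" using m by (simp add: P_def)
qed

definition dl :: real where "dl = (SOME d. good eps d)"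

lemma dl: "good eps dl"
  unfolding dl_def by (rule someI_ex) (use good_exists[OF eps(1)] in blast)

lemma dl_pos: "0 < dl" "dl \<le> 1" using good_pos[OF dl] by auto

text \<open>The factor \<open>(S + 2)\<^sup>2\<close> dominates \<open>1 + S * (S + 1)\<close>, an
  upper bound for the ratio between the norm of a point on the graph and that of its stable part.
  The first bound keeps orbits from the graph below \<open>dl\<close>, the second makes their
  unstable component \<open>M\<close>-Lipschitz.\<close>

definition rad :: real where "rad = min (dl / (2 * (S + 2)\<^sup>2)) (M / (b * (S + 2)\<^sup>2))"

lemma rad_pos: "0 < rad" using dl_pos S M b by (simp add: rad_def)

lemma rad_le: "(S + 2)\<^sup>2 * rad \<le> dl / 2" "b * ((S + 2)\<^sup>2 * rad) \<le> M"
proof -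
  have S2: "0 < (S + 2)\<^sup>2" using S by simp
  have "(S + 2)\<^sup>2 * rad \<le> (S + 2)\<^sup>2 * (dl / (2 * (S + 2)\<^sup>2))" using S2 by (intro mult_left_mono) (auto simp: rad_def)
  then show "(S + 2)\<^sup>2 * rad \<le> dl / 2" using S2 by simp
  have "b * ((S + 2)\<^sup>2 * rad) \<le> b * ((S + 2)\<^sup>2 * (M / (b * (S + 2)\<^sup>2)))" using S2 b by (intro mult_left_mono) (auto simp: rad_def)
  also have "\<dots> = M" using S2 b by (simp add: field_simps)
  finally show "b * ((S + 2)\<^sup>2 * rad) \<le> M" .
qed

text \<open>The unstable coordinate of the point of the stable manifold over \<open>\<psi>\<close>.\<close>
definition zeta :: "segment \<Rightarrow> real \<Rightarrow> real" where
  "zeta \<psi> \<sigma> = (SOME \<zeta>. \<forall>t\<ge>0. norm (soln \<sigma> (pert \<psi> \<zeta>) t) \<le> (S + 1) * \<bar>\<psi> 0 $ 1\<bar>)"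

context
  fixes \<psi> \<sigma>
  assumes psi: "\<psi> \<in> Es_ball lam M J rad" and s: "\<sigma>\<^sub>0 \<le> \<sigma>"
begin

lemma psi_small: "(S + 2)\<^sup>2 * \<bar>\<psi> 0 $ 1\<bar> \<le> dl / 2" "b * ((S + 2)\<^sup>2 * \<bar>\<psi> 0 $ 1\<bar>) \<le> M"
proof -
  have "\<bar>\<psi> 0 $ 1\<bar> \<le> rad" using Es_ball_hist(3,4)[OF psi] by linarith
  then have le: "(S + 2)\<^sup>2 * \<bar>\<psi> 0 $ 1\<bar> \<le> (S + 2)\<^sup>2 * rad" by (intro mult_left_mono) auto
  then show "(S + 2)\<^sup>2 * \<bar>\<psi> 0 $ 1\<bar> \<le> dl / 2" using rad_le by linarith
  have "b * ((S + 2)\<^sup>2 * \<bar>\<psi> 0 $ 1\<bar>) \<le> b * ((S + 2)\<^sup>2 * rad)" by (rule mult_left_mono[OF le less_imp_le[OF b]])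
  then show "b * ((S + 2)\<^sup>2 * \<bar>\<psi> 0 $ 1\<bar>) \<le> M" using rad_le by linarith
qed

lemma soln_zeta_le: "0 \<le> t \<Longrightarrow> norm (soln \<sigma> (pert \<psi> (zeta \<psi> \<sigma>)) t) \<le> (S + 1) * \<bar>\<psi> 0 $ 1\<bar>"
proof -
  have "(S + 2) * \<bar>\<psi> 0 $ 1\<bar> \<le> (S + 2)\<^sup>2 * \<bar>\<psi> 0 $ 1\<bar>"
    using S by (intro mult_right_mono) (auto simp: power2_eq_square mult_le_cancel_left1)
  then have "(S + 2) * \<bar>\<psi> 0 $ 1\<bar> < dl" using psi_small(1) dl_pos by linarith
  then obtain \<zeta> where "\<And>t. 0 \<le> t \<Longrightarrow> norm (soln \<sigma> (pert \<psi> \<zeta>) t) \<le> (S + 1) * \<bar>\<psi> 0 $ 1\<bar>"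
    using bounded_perturbation_exists[OF Es_ball_hist(1,2)[OF psi] s dl less_imp_le[OF eps(1)] eps(2)] by blast
  then have "\<exists>\<zeta>. \<forall>t\<ge>0. norm (soln \<sigma> (pert \<psi> \<zeta>) t) \<le> (S + 1) * \<bar>\<psi> 0 $ 1\<bar>" by blast
  from someI_ex[OF this] show "0 \<le> t \<Longrightarrow> norm (soln \<sigma> (pert \<psi> (zeta \<psi> \<sigma>)) t) \<le> (S + 1) * \<bar>\<psi> 0 $ 1\<bar>"
    unfolding zeta_def by blast
qed

lemma psi_hist_pert: "hist (pert \<psi> \<zeta>)"
  using hist_pert[OF Es_ball_hist(1)[OF psi]] .

lemma zc_pert: "zc (pert \<psi> \<zeta> 0) = \<zeta>"
  using Es_ball_hist(2)[OF psi] by (simp add: pert_0 zc_simps axis2)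

lemma zeta_le: "\<bar>zeta \<psi> \<sigma>\<bar> \<le> S * ((S + 1) * \<bar>\<psi> 0 $ 1\<bar>)"
proof -
  let ?y = "soln \<sigma> (pert \<psi> (zeta \<psi> \<sigma>))"
  have "\<bar>zc (?y 0)\<bar> \<le> S * norm (?y 0)" by (rule zc_le_norm)
  also have "\<dots> \<le> S * ((S + 1) * \<bar>\<psi> 0 $ 1\<bar>)" using soln_zeta_le[of 0] S by (intro mult_left_mono) auto
  finally show ?thesis using soln_0[OF psi_hist_pert s, of 0] by (simp add: zc_pert)
qed

lemma small_factors: "S * ((S + 1) * \<bar>\<psi> 0 $ 1\<bar>) \<le> (S + 2)\<^sup>2 * \<bar>\<psi> 0 $ 1\<bar>" "(S + 1) * \<bar>\<psi> 0 $ 1\<bar> \<le> dl"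
proof -
  have "S * (S + 1) \<le> (S + 2)\<^sup>2" "S + 1 \<le> (S + 2)\<^sup>2" using S by (auto simp: power2_eq_square algebra_simps add_nonneg_nonneg)
  then have "S * (S + 1) * \<bar>\<psi> 0 $ 1\<bar> \<le> (S + 2)\<^sup>2 * \<bar>\<psi> 0 $ 1\<bar>" "(S + 1) * \<bar>\<psi> 0 $ 1\<bar> \<le> (S + 2)\<^sup>2 * \<bar>\<psi> 0 $ 1\<bar>"
    by (intro mult_right_mono; simp)+
  then show "S * ((S + 1) * \<bar>\<psi> 0 $ 1\<bar>) \<le> (S + 2)\<^sup>2 * \<bar>\<psi> 0 $ 1\<bar>" "(S + 1) * \<bar>\<psi> 0 $ 1\<bar> \<le> dl"
    using psi_small(1) dl_pos by (simp_all add: mult.assoc)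
qed

lemma soln_zeta_dl: "0 \<le> t \<Longrightarrow> norm (soln \<sigma> (pert \<psi> (zeta \<psi> \<sigma>)) t) \<le> dl"
  using soln_zeta_le[of t] small_factors(2) by linarith

lemma eu_zeta_Eu: "eu (zeta \<psi> \<sigma>) \<in> Eu lam M J"
proof (rule eu_Eu)
  have "b * \<bar>zeta \<psi> \<sigma>\<bar> \<le> b * ((S + 2)\<^sup>2 * \<bar>\<psi> 0 $ 1\<bar>)"
    using zeta_le small_factors(1) b by (intro mult_left_mono) auto
  then show "b * \<bar>zeta \<psi> \<sigma>\<bar> \<le> M" using psi_small(2) by linarith
qed

text \<open>Equal first components in the history and equal windows mean \<open>D0 = W = 0\<close>
  in the comparison of bounded orbits. The bound assumed here is \<open>dl\<close>, weaker than the
  one that defines \<open>zeta\<close>, since this is what membership in \<open>W_loc\<close>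
  provides.\<close>

lemma zeta_unique:
  assumes "\<And>t. 0 \<le> t \<Longrightarrow> norm (soln \<sigma> (pert \<psi> \<zeta>) t) \<le> dl"
  shows "zeta \<psi> \<sigma> = \<zeta>"
proof -
  have "\<bar>zc (pert \<psi> (zeta \<psi> \<sigma>) 0) - zc (pert \<psi> \<zeta> 0)\<bar> \<le> 3 * 0 + 2 * S * 0 / min a b"
    by (rule two_solutions[OF psi_hist_pert s sol_soln[OF psi_hist_pert s] psi_hist_pert s sol_soln[OF psi_hist_pert s] dl
          less_imp_le[OF eps(1)] eps(3) soln_zeta_dl assms]) (auto simp: pert_1)
  then show ?thesis by (simp add: zc_pert)
qed

text \<open>The new part of the orbit is at most \<open>(S + 1) * Bnorm lam \<psi>\<close>, and the
  old part is the perturbed history; both fit into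
  \<open>(S + 2)\<^sup>2 * rad \<le> dl / 2\<close>.\<close>

lemma Bnorm_seg_zeta:
  assumes t: "0 \<le> t"
  shows "Bnorm lam (seg (soln \<sigma> (pert \<psi> (zeta \<psi> \<sigma>))) t) < dl"
proof -
  let ?p = "pert \<psi> (zeta \<psi> \<sigma>)"
  have n0: "0 \<le> Bnorm lam \<psi>" using Es_ball_hist(3)[OF psi] by linarith
  have u: "\<bar>\<psi> 0 $ 1\<bar> \<le> Bnorm lam \<psi>" using Es_ball_hist(3)[OF psi] .
  have pn: "Bnorm lam ?p \<le> Bnorm lam \<psi> + S * ((S + 1) * Bnorm lam \<psi>)"
  proof (rule Bnorm_le)
    fix \<theta> :: real assume th: "\<theta> \<le> 0"
    have "norm (?p \<theta>) \<le> norm (\<psi> \<theta>) + \<bar>zeta \<psi> \<sigma>\<bar> * exp (b * \<theta>)"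
      using th by (auto simp: pert_def axis2 abs_mult intro!: norm_triangle_le)
    then have "exp (lam * \<theta>) * norm (?p \<theta>) \<le> exp (lam * \<theta>) * (norm (\<psi> \<theta>) + \<bar>zeta \<psi> \<sigma>\<bar> * exp (b * \<theta>))"
      by (intro mult_left_mono) auto
    also have "\<dots> = exp (lam * \<theta>) * norm (\<psi> \<theta>) + exp (lam * \<theta>) * (\<bar>zeta \<psi> \<sigma>\<bar> * exp (b * \<theta>))" by (simp add: algebra_simps)
    also have "\<dots> \<le> Bnorm lam \<psi> + 1 * (\<bar>zeta \<psi> \<sigma>\<bar> * 1)"
      using Es_ball_hist(1)[OF psi] th lam b
      by (intro add_mono mult_mono Bnorm_ge) (auto simp: hist_def mult_nonneg_nonpos)
    also have "\<dots> \<le> Bnorm lam \<psi> + S * ((S + 1) * Bnorm lam \<psi>)"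
    proof -
      have "S * ((S + 1) * \<bar>\<psi> 0 $ 1\<bar>) \<le> S * ((S + 1) * Bnorm lam \<psi>)" using u S by (intro mult_left_mono) auto
      then show ?thesis using zeta_le by simp
    qed
    finally show "exp (lam * \<theta>) * norm (?p \<theta>) \<le> Bnorm lam \<psi> + S * ((S + 1) * Bnorm lam \<psi>)" .
  qed
  let ?K = "(S + 2)\<^sup>2 * Bnorm lam \<psi>"
  have K: "Bnorm lam \<psi> + S * ((S + 1) * Bnorm lam \<psi>) \<le> ?K" "(S + 1) * Bnorm lam \<psi> \<le> ?K"
  proof -
    have "1 + S * (S + 1) \<le> (S + 2)\<^sup>2" "S + 1 \<le> (S + 2)\<^sup>2" using S by (auto simp: power2_eq_square algebra_simps add_nonneg_nonneg)
    then have "(1 + S * (S + 1)) * Bnorm lam \<psi> \<le> ?K" "(S + 1) * Bnorm lam \<psi> \<le> ?K" using n0 by (intro mult_right_mono; simp)+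
    then show "Bnorm lam \<psi> + S * ((S + 1) * Bnorm lam \<psi>) \<le> ?K" "(S + 1) * Bnorm lam \<psi> \<le> ?K" by (simp_all add: algebra_simps)
  qed
  have K0: "0 \<le> ?K" using n0 by simp
  have "Bnorm lam (seg (soln \<sigma> ?p) t) \<le> ?K"
  proof (rule Bnorm_seg_le[OF psi_hist_pert s t K0])
    fix r assume r: "r \<in> {0..t}"
    have "norm (soln \<sigma> ?p r) \<le> (S + 1) * \<bar>\<psi> 0 $ 1\<bar>" using soln_zeta_le r by simp
    also have "\<dots> \<le> (S + 1) * Bnorm lam \<psi>" using u S by (intro mult_left_mono) auto
    also have "\<dots> \<le> ?K" by (rule K)
    finally have "exp (- lam * (t - r)) * norm (soln \<sigma> ?p r) \<le> 1 * ?K"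
      using r lam by (intro mult_mono) (auto simp: mult_nonneg_nonneg)
    then show "exp (- lam * (t - r)) * norm (soln \<sigma> ?p r) \<le> ?K" by simp
  next
    have "exp (- lam * t) * Bnorm lam ?p \<le> 1 * ?K"
      using t lam pn K K0 by (intro mult_mono') (auto intro!: order_trans[OF norm_ge_zero Bnorm_ge_0] simp: psi_hist_pert[unfolded hist_def])
    then show "exp (- lam * t) * Bnorm lam ?p \<le> ?K" by simp
  qed
  also have "?K \<le> (S + 2)\<^sup>2 * rad" using Es_ball_hist(4)[OF psi] by (intro mult_left_mono) auto
  also have "\<dots> \<le> dl / 2" by (rule rad_le)
  also have "\<dots> < dl" using dl_pos by simp
  finally show ?thesis .
qed

end

text \<open>A point of \<open>W_loc\<close> has an orbit bounded by \<open>dl\<close>, so uniqueness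
  identifies its unstable coordinate with \<open>zeta\<close> of its stable part; conversely, orbits
  from the graph are small in the weighted norm. The intersection with \<open>Bspace\<close>
  accounts for sums that violate the Lipschitz condition.\<close>

lemma W_loc_graph:
  "W_loc f g h k c lam M \<sigma>\<^sub>0 rad dl =
      {(seg_add \<psi> (eu (zeta \<psi> \<sigma>)), \<sigma>) | \<psi> \<sigma>. \<psi> \<in> Es_ball lam M J rad \<and> Bnorm lam \<psi> < rad \<and> \<sigma>\<^sub>0 \<le> \<sigma>}
      \<inter> (Bspace lam M \<times> {\<sigma>\<^sub>0..})" (is "_ = ?G \<inter> _")
proof (intro equalityI subsetI)
  fix x assume x: "x \<in> W_loc f g h k c lam M \<sigma>\<^sub>0 rad dl"
  obtain \<phi> \<sigma> where x_eq: "x = (\<phi>, \<sigma>)" by (cases x)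
  from x have phi: "\<phi> \<in> Bspace lam M" and s: "\<sigma>\<^sub>0 \<le> \<sigma>" and n: "Bnorm lam (Pi_s J \<phi>) < rad"
    and small: "\<And>t. 0 \<le> t \<Longrightarrow> Bnorm lam (seg (soln \<sigma> \<phi>) t) < dl" unfolding x_eq W_loc_iff by auto
  have Bt: "\<phi> \<in> Btilde lam" using phi by (simp add: Bspace_def)
  have psi: "Pi_s J \<phi> \<in> Es_ball lam M J rad" using phi n by (simp add: Es_ball_def)
  have p: "pert (Pi_s J \<phi>) (zc (\<phi> 0)) = \<phi>" using pert_Pi_s[OF Bt] .
  have "zeta (Pi_s J \<phi>) \<sigma> = zc (\<phi> 0)"
  proof (rule zeta_unique[OF psi s])
    fix t :: real assume t: "0 \<le> t"
    show "norm (soln \<sigma> (pert (Pi_s J \<phi>) (zc (\<phi> 0))) t) \<le> dl"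
      unfolding p using norm_soln_le_Bnorm[OF Bspace_hist[OF phi] s t] small[OF t] by linarith
  qed
  moreover have "Pi_s J \<phi> \<in> Btilde lam" using Es_ball_hist(1)[OF psi] by (simp add: hist_def)
  ultimately have "\<phi> = seg_add (Pi_s J \<phi>) (eu (zeta (Pi_s J \<phi>) \<sigma>))" using p pert_eq_seg_add by metis
  then show "x \<in> ?G \<inter> (Bspace lam M \<times> {\<sigma>\<^sub>0..})" using psi n s phi unfolding x_eq by blast
next
  fix x assume "x \<in> ?G \<inter> (Bspace lam M \<times> {\<sigma>\<^sub>0..})"
  then obtain \<psi> \<sigma> where x: "x = (seg_add \<psi> (eu (zeta \<psi> \<sigma>)), \<sigma>)" and psi: "\<psi> \<in> Es_ball lam M J rad"
    and n: "Bnorm lam \<psi> < rad" and s: "\<sigma>\<^sub>0 \<le> \<sigma>" and B: "seg_add \<psi> (eu (zeta \<psi> \<sigma>)) \<in> Bspace lam M" by blast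
  have Bt: "\<psi> \<in> Btilde lam" using Es_ball_hist(1)[OF psi] by (simp add: hist_def)
  show "x \<in> W_loc f g h k c lam M \<sigma>\<^sub>0 rad dl"
    using B s n Bnorm_seg_zeta[OF psi s] Pi_s_pert[OF Bt Es_ball_hist(2)[OF psi]]
    unfolding x W_loc_iff pert_eq_seg_add[OF Bt, symmetric] by simp
qed

text \<open>Differences of histories matter on the delay window \<open>[- \<sigma>, 0]\<close> only,
  where the weight is at least \<open>exp (- lam * \<sigma>)\<close>; hence the factor
  \<open>exp (lam * \<sigma>)\<close>.\<close>

lemma zeta_lipschitz:
  assumes psi: "\<psi>1 \<in> Es_ball lam M J rad" "\<psi>2 \<in> Es_ball lam M J rad" and s: "\<sigma>\<^sub>0 \<le> \<sigma>"
  shows "\<bar>zeta \<psi>1 \<sigma> - zeta \<psi>2 \<sigma>\<bar> \<le> 3 * exp (lam * \<sigma>) * Bnorm lam (seg_diff \<psi>1 \<psi>2)"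
proof -
  have Bt: "seg_diff \<psi>1 \<psi>2 \<in> Btilde lam"
    using Es_ball_hist(1)[OF psi(1)] Es_ball_hist(1)[OF psi(2)] by (intro seg_diff_Btilde) (auto simp: hist_def)
  note p1 = psi_hist_pert[OF psi(1) s, of "zeta \<psi>1 \<sigma>"] and p2 = psi_hist_pert[OF psi(2) s, of "zeta \<psi>2 \<sigma>"]
  have "\<bar>zc (pert \<psi>1 (zeta \<psi>1 \<sigma>) 0) - zc (pert \<psi>2 (zeta \<psi>2 \<sigma>) 0)\<bar>
      \<le> 3 * (exp (lam * \<sigma>) * Bnorm lam (seg_diff \<psi>1 \<psi>2)) + 2 * S * 0 / min a b"
  proof (rule two_solutions[OF p1 s sol_soln[OF p1 s] p2 s sol_soln[OF p2 s] dl less_imp_le[OF eps(1)] eps(3)])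
    fix r assume r: "r \<in> {- \<sigma>..0}"
    have "\<bar>pert \<psi>1 (zeta \<psi>1 \<sigma>) r $ 1 - pert \<psi>2 (zeta \<psi>2 \<sigma>) r $ 1\<bar> \<le> norm (seg_diff \<psi>1 \<psi>2 r)"
      using comp_le_norm[of "\<psi>1 r - \<psi>2 r"] r by (simp add: pert_1 seg_diff_def)
    also have "\<dots> = exp (- lam * r) * (exp (lam * r) * norm (seg_diff \<psi>1 \<psi>2 r))" by (simp flip: exp_add mult.assoc)
    also have "\<dots> \<le> exp (lam * \<sigma>) * Bnorm lam (seg_diff \<psi>1 \<psi>2)"
    proof (rule mult_mono)
      have "lam * (- r) \<le> lam * \<sigma>" using r lam by (intro mult_left_mono) auto
      then show "exp (- lam * r) \<le> exp (lam * \<sigma>)" by simp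
      show "exp (lam * r) * norm (seg_diff \<psi>1 \<psi>2 r) \<le> Bnorm lam (seg_diff \<psi>1 \<psi>2)" using r by (intro Bnorm_ge[OF Bt]) auto
    qed auto
    finally show "\<bar>pert \<psi>1 (zeta \<psi>1 \<sigma>) r $ 1 - pert \<psi>2 (zeta \<psi>2 \<sigma>) r $ 1\<bar> \<le> exp (lam * \<sigma>) * Bnorm lam (seg_diff \<psi>1 \<psi>2)" .
  qed (use soln_zeta_dl[OF psi(1) s] soln_zeta_dl[OF psi(2) s] in auto)
  then show ?thesis by (simp add: zc_pert[OF psi(1) s] zc_pert[OF psi(2) s])
qed

text \<open>Same stable part, two windows: the comparison of bounded orbits with
  \<open>D0 = 0\<close>, the defect \<open>W\<close> coming from the change of window alone.\<close>

lemma zeta_continuous: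
  assumes psi: "\<psi> \<in> Es_ball lam M J rad" and s: "\<sigma>\<^sub>0 \<le> \<sigma>" and e: "0 < e"
  shows "\<exists>d>0. \<forall>\<sigma>'\<ge>\<sigma>\<^sub>0. \<bar>\<sigma>' - \<sigma>\<bar> < d \<longrightarrow> \<bar>zeta \<psi> \<sigma>' - zeta \<psi> \<sigma>\<bar> < e"
proof -
  obtain G where G: "0 < G" "\<And>\<sigma> \<sigma>' t y. norm (y t) \<le> 1 \<Longrightarrow> norm (rhs \<sigma> t y - rhs \<sigma>' t y) \<le>
    \<bar>hdelay h k (- \<sigma>) t (\<lambda>s. y s $ 1) - hdelay h k (- \<sigma>') t (\<lambda>s. y s $ 1)\<bar> * G" by (rule rhs_window_bound) blast
  have m: "0 < min a b" using a b by simp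
  \<comment> \<open>Makes the resulting bound \<open>2 * S * (e' * G) / min a b\<close> equal to
    \<open>e / 2\<close>.\<close>
  define e' where "e' = e * min a b / (4 * S * G)"
  have e': "0 < e'" using e m S G(1) by (simp add: e'_def)
  have lip: "lip_on {..0} M (\<lambda>s. \<psi> s $ 1)" using Es_ball_hist(1)[OF psi] by (simp add: hist_def)
  obtain d where d: "0 < d" "\<And>\<sigma>' t u. \<sigma>\<^sub>0 \<le> \<sigma>' \<Longrightarrow> \<bar>\<sigma>' - \<sigma>\<bar> < d \<Longrightarrow> 0 \<le> t \<Longrightarrow> lip_on {..t} M u \<Longrightarrow>
      (\<And>s. s \<le> 0 \<Longrightarrow> u s = \<psi> s $ 1) \<Longrightarrow> \<bar>hdelay h k (- \<sigma>) t u - hdelay h k (- \<sigma>') t u\<bar> \<le> e'"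
    by (rule hdelay_window_continuous[OF lip s e']) blast
  have "\<bar>zeta \<psi> \<sigma>' - zeta \<psi> \<sigma>\<bar> < e" if s': "\<sigma>\<^sub>0 \<le> \<sigma>'" "\<bar>\<sigma>' - \<sigma>\<bar> < d" for \<sigma>'
  proof -
    note p1 = psi_hist_pert[OF psi s, of "zeta \<psi> \<sigma>"] and p2 = psi_hist_pert[OF psi s'(1), of "zeta \<psi> \<sigma>'"]
    let ?y = "soln \<sigma>' (pert \<psi> (zeta \<psi> \<sigma>'))"
    have "\<bar>zc (pert \<psi> (zeta \<psi> \<sigma>) 0) - zc (pert \<psi> (zeta \<psi> \<sigma>') 0)\<bar> \<le> 3 * 0 + 2 * S * (e' * G) / min a b"
    proof (rule two_solutions[OF p1 s sol_soln[OF p1 s] p2 s'(1) sol_soln[OF p2 s'(1)] dl less_imp_le[OF eps(1)] eps(3)])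
      fix t :: real assume t: "0 \<le> t"
      have "norm (?y t) \<le> 1" using soln_zeta_dl[OF psi s'(1) t] dl_pos(2) by linarith
      then have "norm (rhs \<sigma> t ?y - rhs \<sigma>' t ?y) \<le>
          \<bar>hdelay h k (- \<sigma>) t (\<lambda>s. ?y s $ 1) - hdelay h k (- \<sigma>') t (\<lambda>s. ?y s $ 1)\<bar> * G" by (rule G(2))
      also have "\<dots> \<le> e' * G"
        using G(1) sol_lip_on[OF p2 s'(1) sol_soln[OF p2 s'(1)]] soln_0[OF p2 s'(1)]
        by (intro mult_right_mono d(2)[OF s' t]) (auto simp: pert_1)
      finally show "norm (rhs \<sigma> t ?y - rhs \<sigma>' t ?y) \<le> e' * G" .
    qed (use soln_zeta_dl[OF psi s] soln_zeta_dl[OF psi s'(1)] in \<open>auto simp: pert_1\<close>)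
    also have "\<dots> = e / 2"
    proof -
      have "2 * S * (e' * G) = e / 2 * min a b" using S G(1) by (simp add: e'_def)
      then show ?thesis using m less_imp_neq[OF m] by simp
    qed
    finally show ?thesis using e by (simp add: zc_pert[OF psi s] zc_pert[OF psi s'(1)] abs_minus_commute)
  qed
  with d(1) show ?thesis by blast
qed

lemma zero_Es_ball: "(\<lambda>_. 0) \<in> Es_ball lam M J rad"
proof -
  have "(\<lambda>_. 0) \<in> Es lam M J" using M by (auto simp: Es_def Bspace_def Btilde_def stable_space_eq bdd_above_def)
  moreover have "Bnorm lam (\<lambda>_. 0) \<le> rad" using rad_pos by (intro Bnorm_le) auto
  ultimately show ?thesis by (simp add: Es_ball_def)
qed

text \<open>Orbits from the graph over a small \<psi> stay in a small ball for all time, where the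
  residual is so small that bounded orbits lie in a cone of width at most \<open>e\<close>; at time
  0 this bounds \<open>zeta\<close> by \<open>e\<close> times the norm of \<psi>.\<close>

lemma zeta_tangent:
  assumes s: "\<sigma>\<^sub>0 \<le> \<sigma>" and e: "0 < e"
  shows "\<exists>p>0. \<forall>\<psi>\<in>Es_ball lam M J rad. Bnorm lam \<psi> < p \<longrightarrow> \<bar>zeta \<psi> \<sigma> - zeta (\<lambda>_. 0) \<sigma>\<bar> \<le> e * Bnorm lam \<psi>"
proof -
  have z0: "zeta (\<lambda>_. 0) \<sigma> = 0" using zeta_le[OF zero_Es_ball s] by simp
  define q where "q = min 1 e"
  have q: "0 < q" "q \<le> 1" "q \<le> e" using e by (auto simp: q_def)
  define e' where "e' = q * min a b / (4 * S\<^sup>2)"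
  have m: "0 < min a b" using a b by simp
  have e': "0 < e'" "4 * (S\<^sup>2 * e') \<le> q * min a b" using q m S by (simp_all add: e'_def)
  obtain d where d: "good e' d" using good_exists[OF e'(1)] .
  have "\<bar>zeta \<psi> \<sigma> - zeta (\<lambda>_. 0) \<sigma>\<bar> \<le> e * Bnorm lam \<psi>"
    if psi: "\<psi> \<in> Es_ball lam M J rad" and n: "Bnorm lam \<psi> < d / (S + 1)" for \<psi>
  proof -
    let ?p = "pert \<psi> (zeta \<psi> \<sigma>)"
    note hp = psi_hist_pert[OF psi s]
    have u: "\<bar>\<psi> 0 $ 1\<bar> \<le> Bnorm lam \<psi>" using Es_ball_hist(3)[OF psi] .
    have "\<bar>zc (soln \<sigma> ?p 0)\<bar> \<le> q * \<bar>soln \<sigma> ?p 0 $ 1\<bar>"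
    proof (rule small_cone[OF hp s sol_soln[OF hp s] d less_imp_le[OF e'(1)] e'(2) q(1,2)])
      fix t :: real assume t: "0 \<le> t"
      have "norm (soln \<sigma> ?p t) \<le> (S + 1) * \<bar>\<psi> 0 $ 1\<bar>" using soln_zeta_le[OF psi s t] .
      also have "\<dots> \<le> (S + 1) * (d / (S + 1))" using u n S by (intro mult_left_mono) auto
      finally show "norm (soln \<sigma> ?p t) \<le> d" using S by simp
    qed simp
    then have "\<bar>zeta \<psi> \<sigma>\<bar> \<le> q * \<bar>\<psi> 0 $ 1\<bar>"
      using soln_0[OF hp s, of 0] zc_pert[OF psi s] by (simp add: pert_1)
    also have "\<dots> \<le> e * Bnorm lam \<psi>" using q u e by (intro mult_mono) auto
    finally show ?thesis by (simp add: z0)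
  qed
  moreover have "0 < d / (S + 1)" using good_pos(1)[OF d] S by simp
  ultimately show ?thesis by blast
qed

section \<open>Orbits that stay small: decay and positive invariance\<close>

context
  fixes \<phi> \<sigma>
  assumes phi: "hist \<phi>" and s: "\<sigma>\<^sub>0 \<le> \<sigma>" and small: "\<And>t. 0 \<le> t \<Longrightarrow> norm (soln \<sigma> \<phi> t) \<le> dl"
begin

lemma small_orbit_cone: "0 \<le> t \<Longrightarrow> \<bar>zc (soln \<sigma> \<phi> t)\<bar> \<le> \<bar>soln \<sigma> \<phi> t $ 1\<bar>"
  using small_cone[OF phi s sol_soln[OF phi s] dl less_imp_le[OF eps(1)], of 1] eps(2) small by simp

lemma small_orbit_norm: "0 \<le> t \<Longrightarrow> norm (soln \<sigma> \<phi> t) \<le> (S + 1) * \<bar>soln \<sigma> \<phi> t $ 1\<bar>"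
  using norm_le_coords[of "soln \<sigma> \<phi> t"] small_orbit_cone[of t] by (simp add: algebra_simps)

lemma small_orbit_decay:
  assumes "good e d" "0 \<le> e" "0 \<le> p" "p \<le> t" "\<And>r. r \<in> {p..t} \<Longrightarrow> norm (soln \<sigma> \<phi> r) \<le> d"
  shows "\<bar>soln \<sigma> \<phi> t $ 1\<bar> \<le> exp (- (a - 2 * (S\<^sup>2 * e)) * (t - p)) * \<bar>soln \<sigma> \<phi> p $ 1\<bar>"
  using small_decay[OF phi s sol_soln[OF phi s] assms] small_orbit_cone assms(3) by auto

lemma small_orbit_decreasing:
  assumes "0 \<le> p" "p \<le> t"
  shows "\<bar>soln \<sigma> \<phi> t $ 1\<bar> \<le> \<bar>soln \<sigma> \<phi> p $ 1\<bar>"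
proof -
  have "\<bar>soln \<sigma> \<phi> t $ 1\<bar> \<le> exp (- (a - 2 * (S\<^sup>2 * eps)) * (t - p)) * \<bar>soln \<sigma> \<phi> p $ 1\<bar>"
    using small assms by (intro small_orbit_decay[OF dl less_imp_le[OF eps(1)] assms]) auto
  also have "\<dots> \<le> 1 * \<bar>soln \<sigma> \<phi> p $ 1\<bar>"
  proof (rule mult_right_mono)
    have "0 \<le> a - 2 * (S\<^sup>2 * eps)" using eps(5) a by linarith
    then have "- (a - 2 * (S\<^sup>2 * eps)) * (t - p) \<le> 0" using assms by (intro mult_nonpos_nonneg) auto
    then show "exp (- (a - 2 * (S\<^sup>2 * eps)) * (t - p)) \<le> 1" by (simp only: exp_le_one_iff)
  qed simp
  finally show ?thesis by simp
qed

text \<open>Along a small orbit the residual after time \<open>p\<close> is controlled by the first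
  component at \<open>p\<close>, whose modulus does not increase afterwards; \<open>eps\<close> is
  chosen so that the resulting constant is at most \<open>lam\<close>.\<close>

lemma backward_unstable:
  assumes "0 \<le> p" "p \<le> t"
  shows "\<bar>zc (soln \<sigma> \<phi> p) - exp (- b * (t - p)) * zc (soln \<sigma> \<phi> t)\<bar> \<le> lam * \<bar>soln \<sigma> \<phi> p $ 1\<bar> * (t - p)"
proof -
  let ?y = "soln \<sigma> \<phi>"
  interpret saddle a b "\<lambda>t. ?y t $ 1" "\<lambda>t. zc (?y t)" "\<lambda>t. Res \<sigma> t ?y $ 1" "\<lambda>t. zc (Res \<sigma> t ?y)"
    using sol_saddle[OF sol_soln[OF phi s]] .
  show ?thesis
  proof (rule unstable_backward_linear[OF _ assms])
    fix x assume x: "x \<in> {p..t}"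
    have x0: "0 \<le> x" using x assms by simp
    have "\<bar>zc (Res \<sigma> x ?y)\<bar> \<le> S\<^sup>2 * eps * (\<bar>?y x $ 1\<bar> + \<bar>zc (?y x)\<bar>)"
      using small_residual(2)[OF phi s sol_soln[OF phi s] dl less_imp_le[OF eps(1)] x0 small[OF x0]] .
    also have "\<dots> \<le> S\<^sup>2 * eps * (2 * \<bar>?y p $ 1\<bar>)"
      using small_orbit_cone[OF x0] small_orbit_decreasing[OF assms(1), of x] x eps(1) by (intro mult_left_mono) auto
    also have "\<dots> = 2 * (S\<^sup>2 * eps) * \<bar>?y p $ 1\<bar>" by simp
    also have "\<dots> \<le> lam * \<bar>?y p $ 1\<bar>" using eps(4) by (intro mult_right_mono) auto
    finally show "\<bar>zc (Res \<sigma> x ?y)\<bar> \<le> lam * \<bar>?y p $ 1\<bar>" .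
  qed
qed

lemma exp_mult_linear_le_1: "0 \<le> x \<Longrightarrow> exp (- lam * x) * (1 + lam * x) \<le> 1"
proof -
  have "exp (- lam * x) * (1 + lam * x) \<le> exp (- lam * x) * exp (lam * x)"
    by (intro mult_left_mono exp_ge_add_one_self) auto
  then show ?thesis by (simp flip: exp_add)
qed

text \<open>Projecting the later segment subtracts the backward linear orbit through its unstable
  coordinate. At distance \<open>x\<close> into the past its error against the true unstable
  coordinate is at most \<open>lam * x\<close> times the first component there, and the weight
  compensates this because \<open>exp (- lam * x) * (1 + lam * x) \<le> 1\<close>.\<close>

lemma Bnorm_Pi_s_le:
  assumes t: "0 \<le> t"
  shows "Bnorm lam (Pi_s J (seg (soln \<sigma> \<phi>) t)) \<le> Bnorm lam (Pi_s J \<phi>)"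
proof (rule Bnorm_le)
  let ?y = "soln \<sigma> \<phi>" and ?n = "Bnorm lam (Pi_s J \<phi>)"
  let ?e1 = "vector [1, slope] :: real^2" and ?e2 = "axis 2 1 :: real^2"
  have PB: "Pi_s J \<phi> \<in> Btilde lam" using phi hist_pert[OF phi] by (simp add: hist_def Pi_s_eq_pert)
  have dec: "x = x $ 1 *\<^sub>R ?e1 + zc x *\<^sub>R ?e2" for x
    by (simp add: vec2_eq_iff zc_def axis_def)
  have e1: "1 \<le> norm ?e1" using comp_le_norm[of ?e1] by simp
  have y0: "?y 0 = \<phi> 0" using soln_0[OF phi s] by simp
  have u0: "\<bar>?y 0 $ 1\<bar> * norm ?e1 \<le> ?n"
  proof -
    have "Pi_s J \<phi> 0 = ?y 0 $ 1 *\<^sub>R ?e1"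
      by (simp add: Pi_s_eq seg_diff_def eu_0 y0 vec2_eq_iff zc_def axis_def)
    then show ?thesis using Bnorm_ge_0[OF PB] by simp
  qed
  have u0': "\<bar>?y 0 $ 1\<bar> \<le> ?n" using mult_left_mono[OF e1, of "\<bar>?y 0 $ 1\<bar>"] u0 by simp
  fix \<theta> :: real assume th: "\<theta> \<le> 0"
  define p where "p = t + \<theta>"
  have P: "Pi_s J (seg ?y t) \<theta> = ?y p - (zc (?y t) * exp (b * \<theta>)) *\<^sub>R ?e2"
    using th by (simp add: Pi_s_eq seg_diff_def seg_def eu_def p_def)
  show "exp (lam * \<theta>) * norm (Pi_s J (seg ?y t) \<theta>) \<le> ?n"
  proof (cases "0 \<le> p")
    case True
    let ?D = "zc (?y p) - exp (- b * (t - p)) * zc (?y t)"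
    have tp: "0 \<le> t - p" "p \<le> t" using th by (auto simp: p_def)
    have "?y p - (zc (?y t) * exp (b * \<theta>)) *\<^sub>R ?e2 = ?y p $ 1 *\<^sub>R ?e1 + ?D *\<^sub>R ?e2"
      using dec[of "?y p"] by (simp add: p_def algebra_simps) 
    then have "norm (Pi_s J (seg ?y t) \<theta>) \<le> \<bar>?y p $ 1\<bar> * norm ?e1 + \<bar>?D\<bar>"
      unfolding P by (simp only:) (rule norm_triangle_le, simp add: axis2)
    also have "\<dots> \<le> \<bar>?y p $ 1\<bar> * norm ?e1 + lam * \<bar>?y p $ 1\<bar> * (t - p) * norm ?e1"
    proof (rule add_left_mono)
      have "\<bar>?D\<bar> \<le> lam * \<bar>?y p $ 1\<bar> * (t - p) * 1" using backward_unstable[OF True tp(2)] by simp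
      also have "\<dots> \<le> lam * \<bar>?y p $ 1\<bar> * (t - p) * norm ?e1" using e1 lam tp by (intro mult_left_mono) auto
      finally show "\<bar>?D\<bar> \<le> lam * \<bar>?y p $ 1\<bar> * (t - p) * norm ?e1" .
    qed
    also have "\<dots> = (1 + lam * (t - p)) * (\<bar>?y p $ 1\<bar> * norm ?e1)" by (simp add: algebra_simps)
    also have "\<dots> \<le> (1 + lam * (t - p)) * ?n"
    proof (rule mult_left_mono)
      have "\<bar>?y p $ 1\<bar> * norm ?e1 \<le> \<bar>?y 0 $ 1\<bar> * norm ?e1"
        using small_orbit_decreasing[of 0 p] True by (intro mult_right_mono) auto
      then show "\<bar>?y p $ 1\<bar> * norm ?e1 \<le> ?n" using u0 by linarith
    qed (use lam tp in auto)
    finally have "exp (lam * \<theta>) * norm (Pi_s J (seg ?y t) \<theta>) \<le> exp (lam * \<theta>) * ((1 + lam * (t - p)) * ?n)"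
      by (intro mult_left_mono) auto
    also have "\<dots> = exp (- lam * (t - p)) * (1 + lam * (t - p)) * ?n" by (simp add: p_def)
    also have "\<dots> \<le> 1 * ?n" using exp_mult_linear_le_1[OF tp(1)] u0' by (intro mult_right_mono) auto
    finally show ?thesis by simp
  next
    case False
    then have p: "p \<le> 0" by simp
    let ?D = "zc (?y 0) - exp (- b * (t - 0)) * zc (?y t)"
    have "exp (b * \<theta>) = exp (b * p) * exp (- b * (t - 0))" by (simp add: p_def algebra_simps flip: exp_add)
    \<comment> \<open>On the old history the new projection differs from the old one by the backward
      linear orbit of the coordinate error accumulated on \<open>[0, t]\<close>.\<close>
    then have "?y p - (zc (?y t) * exp (b * \<theta>)) *\<^sub>R ?e2 = Pi_s J \<phi> p + (exp (b * p) * ?D) *\<^sub>R ?e2"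
      using soln_0[OF phi s p] y0 p by (simp add: Pi_s_eq seg_diff_def eu_def algebra_simps)
    then have "norm (Pi_s J (seg ?y t) \<theta>) \<le> norm (Pi_s J \<phi> p) + exp (b * p) * \<bar>?D\<bar>"
      unfolding P by (simp only:) (rule norm_triangle_le, simp add: axis2 abs_mult)
    also have "\<dots> \<le> norm (Pi_s J \<phi> p) + 1 * (lam * ?n * t)"
    proof (intro add_left_mono mult_mono)
      have "\<bar>?D\<bar> \<le> lam * \<bar>?y 0 $ 1\<bar> * (t - 0)" by (rule backward_unstable) (use t in auto)
      also have "\<dots> \<le> lam * ?n * t" using u0' lam t by (intro mult_mono) auto
      finally show "\<bar>?D\<bar> \<le> lam * ?n * t" .
    qed (use b p in \<open>auto simp: mult_nonneg_nonpos\<close>)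
    finally have "exp (lam * \<theta>) * norm (Pi_s J (seg ?y t) \<theta>) \<le> exp (lam * \<theta>) * (norm (Pi_s J \<phi> p) + lam * ?n * t)"
      by (intro mult_left_mono) auto
    also have "\<dots> = exp (- lam * t) * (exp (lam * p) * norm (Pi_s J \<phi> p) + exp (lam * p) * (lam * ?n * t))"
    proof -
      have "exp (lam * \<theta>) = exp (- lam * t) * exp (lam * p)" by (simp add: p_def algebra_simps flip: exp_add)
      then show ?thesis by (simp only: distrib_left mult.assoc)
    qed
    also have "\<dots> \<le> exp (- lam * t) * (?n + 1 * (lam * ?n * t))"
      using Bnorm_ge[OF PB p] lam p u0' t by (intro mult_left_mono add_mono mult_right_mono) (auto simp: mult_nonneg_nonpos intro: order_trans[OF abs_ge_zero])
    also have "\<dots> = exp (- lam * t) * (1 + lam * t) * ?n" by (simp add: algebra_simps)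
    also have "\<dots> \<le> 1 * ?n" using exp_mult_linear_le_1[OF t] u0' by (intro mult_right_mono) auto
    finally show ?thesis by simp
  qed
qed

end

text \<open>The radius \<open>dl\<close> only guarantees the fixed rate \<open>m\<close>, so decay
  comes in two stages: rate \<open>m\<close> brings every orbit into a ball adapted to
  \<open>\<beta>\<close> by a time \<open>T\<close> independent of the orbit, and there the residual
  is small enough for rate \<open>\<beta>\<close>. The first stage costs the factor
  \<open>exp (\<beta> * T)\<close>. The bound \<open>\<beta> < lam\<close> makes the shifted initial
  history decay fast enough.\<close>

lemma W_loc_decay:
  assumes be: "0 < \<beta>" "\<beta> < a" "\<beta> < lam"
  obtains N where "\<And>\<phi> \<sigma> t. (\<phi>, \<sigma>) \<in> W_loc f g h k c lam M \<sigma>\<^sub>0 rad dl \<Longrightarrow> 0 \<le> t \<Longrightarrow>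
    Bnorm lam (seg (soln \<sigma> \<phi>) t) \<le> N * exp (- \<beta> * t) * Bnorm lam \<phi>"
proof -
  \<comment> \<open>Solves \<open>a - 2 * (S\<^sup>2 * e) = \<beta>\<close>.\<close>
  define e where "e = (a - \<beta>) / (2 * S\<^sup>2)"
  have e0: "0 < e" using be S by (simp add: e_def)
  have "2 * (S\<^sup>2 * e) = a - \<beta>" using S by (simp add: e_def)
  then have "a - 2 * (S\<^sup>2 * e) = \<beta>" by linarith
  note e = e0 this
  obtain d where d: "good e d" using good_exists[OF e(1)] .
  have d0: "0 < d" using good_pos[OF d] by simp
  define m where "m = a - 2 * (S\<^sup>2 * eps)"
  have m: "0 < m" using eps(5) a unfolding m_def by linarith
  \<comment> \<open>The time after which \<open>(S + 1) * (exp (- m * t) * dl) \<le> d\<close>, and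
    0 if this holds from the start.\<close>
  define T where "T = max 0 (ln ((S + 1) * dl / d) / m)"
  have T0: "0 \<le> T" by (simp add: T_def)
  have T: "(S + 1) * (exp (- m * t) * dl) \<le> d" if "T \<le> t" for t
  proof -
    have pos: "0 < (S + 1) * dl / d" using S dl_pos d0 by simp
    have "ln ((S + 1) * dl / d) / m \<le> t" using that by (simp add: T_def)
    then have "ln ((S + 1) * dl / d) \<le> m * t" using m by (simp add: field_simps)
    then have "(S + 1) * dl / d \<le> exp (m * t)" using pos by (metis exp_le_cancel_iff exp_ln)
    then have "(S + 1) * dl \<le> exp (m * t) * d" using d0 by (simp add: field_simps)
    then have "exp (- m * t) * ((S + 1) * dl) \<le> exp (- m * t) * (exp (m * t) * d)" by (intro mult_left_mono) auto
    then show ?thesis by (simp add: algebra_simps flip: exp_add mult.assoc)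
  qed
  define N where "N = (S + 1) * exp (\<beta> * T)"
  have N: "1 \<le> N"
  proof -
    have "1 * 1 \<le> (S + 1) * exp (\<beta> * T)" using S be T0 by (intro mult_mono) auto
    then show ?thesis by (simp add: N_def)
  qed
  have "Bnorm lam (seg (soln \<sigma> \<phi>) t) \<le> N * exp (- \<beta> * t) * Bnorm lam \<phi>"
    if W: "(\<phi>, \<sigma>) \<in> W_loc f g h k c lam M \<sigma>\<^sub>0 rad dl" and t: "0 \<le> t" for \<phi> \<sigma> t
  proof -
    have h: "hist \<phi>" and s: "\<sigma>\<^sub>0 \<le> \<sigma>" using W Bspace_hist by (auto simp: W_loc_iff)
    have small: "norm (soln \<sigma> \<phi> t) \<le> dl" if "0 \<le> t" for t
      using W that norm_soln_le_Bnorm[OF h s that] by (force simp: W_loc_iff)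
    let ?u = "\<lambda>t. \<bar>soln \<sigma> \<phi> t $ 1\<bar>"
    note so = h s small
    have Bt: "\<phi> \<in> Btilde lam" using h by (simp add: hist_def)
    have u0: "?u 0 \<le> Bnorm lam \<phi>"
      using comp_le_norm[of "\<phi> 0"] Bnorm_ge_0[OF Bt] soln_0[OF h s, of 0] by simp
    have n0: "0 \<le> Bnorm lam \<phi>" using u0 by linarith
    have late: "norm (soln \<sigma> \<phi> t) \<le> d" if tT: "T \<le> t" for t
    proof -
      have t: "0 \<le> t" using tT T0 by simp
      have u0d: "?u 0 \<le> dl" using comp_le_norm[of "soln \<sigma> \<phi> 0"] small[of 0] by simp
      have "?u t \<le> exp (- m * (t - 0)) * ?u 0"
        unfolding m_def using t small by (intro small_orbit_decay[OF so dl less_imp_le[OF eps(1)]]) auto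
      also have "\<dots> \<le> exp (- m * t) * dl" using u0d by simp
      finally have "(S + 1) * ?u t \<le> (S + 1) * (exp (- m * t) * dl)" using S by (intro mult_left_mono) auto
      then show ?thesis using small_orbit_norm[OF so t] T[OF tT] by linarith
    qed
    have ub: "?u r \<le> exp (\<beta> * T) * exp (- \<beta> * r) * ?u 0" if r: "0 \<le> r" for r
    proof (cases "r \<le> T")
      case True
      have "?u r \<le> 1 * ?u 0" using small_orbit_decreasing[OF so, of 0 r] r by simp
      also have "\<dots> \<le> exp (\<beta> * (T - r)) * ?u 0" using True be by (intro mult_right_mono) auto
      also have "exp (\<beta> * (T - r)) = exp (\<beta> * T) * exp (- \<beta> * r)" by (simp add: algebra_simps flip: exp_add)
      finally show ?thesis .
    next
      case False
      have "?u r \<le> exp (- (a - 2 * (S\<^sup>2 * e)) * (r - T)) * ?u T"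
        using False T0 late by (intro small_orbit_decay[OF so d less_imp_le[OF e(1)]]) auto
      also have "\<dots> \<le> exp (- \<beta> * (r - T)) * ?u 0"
        unfolding e(2) using small_orbit_decreasing[OF so, of 0 T] T0 by (intro mult_left_mono) auto
      also have "exp (- \<beta> * (r - T)) = exp (\<beta> * T) * exp (- \<beta> * r)" by (simp add: algebra_simps flip: exp_add)
      finally show ?thesis .
    qed
    have nb: "norm (soln \<sigma> \<phi> r) \<le> N * exp (- \<beta> * r) * Bnorm lam \<phi>" if r: "0 \<le> r" for r
    proof -
      have "norm (soln \<sigma> \<phi> r) \<le> (S + 1) * ?u r" by (rule small_orbit_norm[OF so r])
      also have "\<dots> \<le> (S + 1) * (exp (\<beta> * T) * exp (- \<beta> * r) * Bnorm lam \<phi>)"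
      proof (rule mult_left_mono)
        have "exp (\<beta> * T) * exp (- \<beta> * r) * ?u 0 \<le> exp (\<beta> * T) * exp (- \<beta> * r) * Bnorm lam \<phi>"
          using u0 by (intro mult_left_mono) auto
        then show "?u r \<le> exp (\<beta> * T) * exp (- \<beta> * r) * Bnorm lam \<phi>" using ub[OF r] by linarith
      qed (use S in auto)
      finally show ?thesis by (simp add: N_def mult.assoc)
    qed
    show ?thesis
    proof (rule Bnorm_seg_le[OF h s t])
      show "0 \<le> N * exp (- \<beta> * t) * Bnorm lam \<phi>" using N n0 by simp
      fix r assume r: "r \<in> {0..t}"
      have "exp (- lam * (t - r)) * norm (soln \<sigma> \<phi> r) \<le> exp (- \<beta> * (t - r)) * (N * exp (- \<beta> * r) * Bnorm lam \<phi>)"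
        using r be nb[of r] by (intro mult_mono) (auto intro: mult_right_mono)
      also have "\<dots> = N * (exp (- \<beta> * (t - r)) * exp (- \<beta> * r)) * Bnorm lam \<phi>" by simp
      also have "exp (- \<beta> * (t - r)) * exp (- \<beta> * r) = exp (- \<beta> * t)" by (simp add: algebra_simps flip: exp_add)
      finally show "exp (- lam * (t - r)) * norm (soln \<sigma> \<phi> r) \<le> N * exp (- \<beta> * t) * Bnorm lam \<phi>" .
    next
      have "exp (- lam * t) * Bnorm lam \<phi> \<le> exp (- \<beta> * t) * Bnorm lam \<phi>"
        using be t n0 by (intro mult_right_mono) (auto intro: mult_right_mono)
      also have "\<dots> \<le> N * (exp (- \<beta> * t) * Bnorm lam \<phi>)" using mult_right_mono[OF N, of "exp (- \<beta> * t) * Bnorm lam \<phi>"] n0 by simp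
      finally show "exp (- lam * t) * Bnorm lam \<phi> \<le> N * exp (- \<beta> * t) * Bnorm lam \<phi>" by (simp add: mult.assoc)
    qed
  qed
  then show ?thesis using that by blast
qed

text \<open>Smallness passes to the restarted orbit by the semigroup property, the Lipschitz
  condition by invariance of the phase space, and the radius because the norm of the stable part
  does not grow.\<close>

lemma W_loc_invariant:
  assumes W: "(\<phi>, \<sigma>) \<in> W_loc f g h k c lam M \<sigma>\<^sub>0 rad dl" and t: "0 \<le> t"
  shows "(seg (soln \<sigma> \<phi>) t, \<sigma> + t) \<in> W_loc f g h k c lam M \<sigma>\<^sub>0 rad dl"
proof -
  have phi: "\<phi> \<in> Bspace lam M" and s: "\<sigma>\<^sub>0 \<le> \<sigma>" and n: "Bnorm lam (Pi_s J \<phi>) < rad"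
    and B: "\<And>t. 0 \<le> t \<Longrightarrow> Bnorm lam (seg (soln \<sigma> \<phi>) t) < dl" using W by (auto simp: W_loc_iff)
  have h: "hist \<phi>" using Bspace_hist[OF phi] .
  have small: "norm (soln \<sigma> \<phi> t) \<le> dl" if "0 \<le> t" for t
    using B[OF that] norm_soln_le_Bnorm[OF h s that] by linarith
  have "seg (soln (\<sigma> + t) (seg (soln \<sigma> \<phi>) t)) r = seg (soln \<sigma> \<phi>) (t + r)" for r
    unfolding soln_semigroup[OF h s t] by (simp add: seg_def fun_eq_iff add.assoc)
  then show ?thesis
    using seg_soln_Bspace[OF phi s t] s t Bnorm_Pi_s_le[OF h s small t] n B by (auto simp: W_loc_iff)
qed

end

theorem theorem3p1:
  fixes F G f g :: "real^2 \<Rightarrow> real^2" and h :: "real \<Rightarrow> real" and c :: "real^2 \<Rightarrow> real"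
    and \<kappa> :: nat and D :: "(real^2) set" and A :: "real^2^2"
    and H \<eta> lam M C \<alpha> \<sigma>\<^sub>0 :: real
  assumes "C1_map F" and "C1_map G" and "F 0 = 0" and "G 0 = 0"
    and "\<exists>z. eigenvalue_of (jacobian F (at 0)) z \<and> Re z = 0"
    and "h C1_differentiable_on UNIV" and "(h \<longlongrightarrow> 0) at_top" and "(h \<longlongrightarrow> 0) at_bot"
    and "0 < H" and "0 < \<eta>"
    and "\<And>\<tau>. \<bar>h \<tau>\<bar> \<le> H * exp (- \<eta> * \<tau>)" and "\<And>\<tau>. \<bar>deriv h \<tau>\<bar> \<le> H * exp (- \<eta> * \<tau>)"
    and "1 \<le> \<kappa>" and "desingularization \<kappa> F f" and "desingularization \<kappa> G g" and "f 0 = 0"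
    and "0 < lam" and "cut_off f g h \<kappa> lam D c M" and "0 < M" and "M < \<eta>"
    and A: "A = jacobian f (at 0)"
    and hyperbolic: "\<And>z. eigenvalue_of A z \<Longrightarrow> Re z \<noteq> 0"
    and unstable: "unstable_space A = {x. x $ 1 = 0}"
    and "0 < C" and "0 < \<alpha>"
    and "\<And>t \<phi>. 0 \<le> t \<Longrightarrow> \<phi> \<in> Es lam M A \<Longrightarrow> Bnorm lam (V A t \<phi>) \<le> C * exp (- \<alpha> * t) * Bnorm lam \<phi>"
    and "\<And>t \<phi>. t \<le> 0 \<Longrightarrow> \<phi> \<in> Eu lam M A \<Longrightarrow> Bnorm lam (V A t \<phi>) \<le> C * exp (\<alpha> * t) * Bnorm lam \<phi>"
    and "0 < \<sigma>\<^sub>0"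
  shows "\<exists>r>0. \<exists>\<delta>>0. \<exists>w :: segment \<Rightarrow> real \<Rightarrow> segment.
    (\<forall>\<psi>\<in>Es_ball lam M A r. \<forall>\<sigma>\<ge>\<sigma>\<^sub>0. w \<psi> \<sigma> \<in> Eu lam M A) \<and>
    W_loc f g h \<kappa> c lam M \<sigma>\<^sub>0 r \<delta> =
      {(seg_add \<psi> (w \<psi> \<sigma>), \<sigma>) | \<psi> \<sigma>. \<psi> \<in> Es_ball lam M A r \<and> Bnorm lam \<psi> < r \<and> \<sigma>\<^sub>0 \<le> \<sigma>}
      \<inter> (Bspace lam M \<times> {\<sigma>\<^sub>0..}) \<and>
    (\<forall>\<sigma>\<ge>\<sigma>\<^sub>0. \<exists>L. \<forall>\<psi>\<^sub>1\<in>Es_ball lam M A r. \<forall>\<psi>\<^sub>2\<in>Es_ball lam M A r.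
       Bnorm lam (seg_diff (w \<psi>\<^sub>1 \<sigma>) (w \<psi>\<^sub>2 \<sigma>)) \<le> L * Bnorm lam (seg_diff \<psi>\<^sub>1 \<psi>\<^sub>2)) \<and>
    (\<forall>\<psi>\<in>Es_ball lam M A r. \<forall>\<sigma>\<ge>\<sigma>\<^sub>0. \<forall>\<epsilon>>0. \<exists>d>0. \<forall>\<sigma>'\<ge>\<sigma>\<^sub>0. \<bar>\<sigma>' - \<sigma>\<bar> < d \<longrightarrow>
       Bnorm lam (seg_diff (w \<psi> \<sigma>') (w \<psi> \<sigma>)) < \<epsilon>) \<and>
    (\<forall>\<sigma>\<ge>\<sigma>\<^sub>0. \<forall>\<epsilon>>0. \<exists>\<rho>>0. \<forall>\<psi>\<in>Es_ball lam M A r. Bnorm lam \<psi> < \<rho> \<longrightarrow>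
       Bnorm lam (seg_diff (w \<psi> \<sigma>) (w (\<lambda>_. 0) \<sigma>)) \<le> \<epsilon> * Bnorm lam \<psi>) \<and>
    (\<forall>\<beta>. 0 < \<beta> \<and> \<beta> < \<alpha> \<longrightarrow>
       (\<exists>N. \<forall>(\<phi>, \<sigma>)\<in>W_loc f g h \<kappa> c lam M \<sigma>\<^sub>0 r \<delta>. \<forall>t\<ge>\<sigma>.
          Bnorm lam (mu f g h \<kappa> c t \<phi> \<sigma>) \<le> N * exp (- \<beta> * (t - \<sigma>)) * Bnorm lam \<phi>)) \<and>
    (\<forall>(\<phi>, \<sigma>)\<in>W_loc f g h \<kappa> c lam M \<sigma>\<^sub>0 r \<delta>. \<forall>t\<ge>\<sigma>.
       Pi_s A (mu f g h \<kappa> c t \<phi> \<sigma>) \<in> Es_ball lam M A r \<longrightarrow>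
       (mu f g h \<kappa> c t \<phi> \<sigma>, t) \<in> W_loc f g h \<kappa> c lam M \<sigma>\<^sub>0 r \<delta>)"
proof -
  have fg: "C1_map f" "C1_map g" using \<open>desingularization \<kappa> F f\<close> \<open>desingularization \<kappa> G g\<close>
    by (simp_all add: desingularization_def)
  have cut: "open D" "0 \<in> D" "\<exists>L. L-lipschitz_on UNIV c" "\<forall>x. 0 \<le> c x \<and> c x \<le> 1" "\<forall>x\<in>D. c x = 1"
    "\<forall>t\<ge>0. \<forall>\<phi>\<in>Btilde lam. norm (c (\<phi> 0) *\<^sub>R delay_rhs f g h \<kappa> t \<phi>) \<le> M"
    using \<open>cut_off f g h \<kappa> lam D c M\<close> unfolding cut_off_def by blast+
  have h_deriv: "(h has_real_derivative deriv h \<tau>) (at \<tau>)" for \<tau>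
    using \<open>h C1_differentiable_on UNIV\<close> unfolding C1_differentiable_on_eq
    by (simp add: DERIV_deriv_iff_real_differentiable)
  interpret stable_setting h \<kappa> M H \<eta> \<sigma>\<^sub>0 f g c lam
  proof unfold_locales
    show "\<exists>d>0. \<forall>x. norm x < d \<longrightarrow> c x = 1"
    proof -
      obtain d where "0 < d" "ball 0 d \<subseteq> D" using cut(1,2) open_contains_ball by blast
      then show ?thesis using cut(5) by (intro exI[of _ d]) auto
    qed
  qed (use assms fg cut h_deriv in auto)
  \<comment> \<open>The decay estimate on \<open>Es\<close> turns \<open>\<beta> < \<alpha>\<close>
    into the two bounds \<open>\<beta> < a\<close> and \<open>\<beta> < lam\<close> that the orbit
    estimates use.\<close>
  have "\<alpha> \<le> - J $ 1 $ 1" "\<alpha> \<le> lam"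
    using rate_le[OF \<open>0 < C\<close> \<open>0 < lam\<close> \<open>0 < M\<close> assms(26)[unfolded A]] by simp_all
  then have al: "\<alpha> \<le> a" "\<alpha> \<le> lam" by (simp_all add: a_def)
  let ?W = "W_loc f g h \<kappa> c lam M \<sigma>\<^sub>0 rad dl" and ?E = "Es_ball lam M J rad"
  have W_hist: "hist \<phi>" "\<sigma>\<^sub>0 \<le> \<sigma>" if "(\<phi>, \<sigma>) \<in> ?W" for \<phi> \<sigma>
    using that Bspace_hist by (auto simp: W_loc_iff)
  show ?thesis
    unfolding A
  proof (rule exI[of _ rad], rule conjI[OF rad_pos], rule exI[of _ dl], rule conjI[OF dl_pos(1)],
      rule exI[of _ "\<lambda>\<psi> \<sigma>. eu (zeta \<psi> \<sigma>)"], intro conjI)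
    show "\<forall>\<psi>\<in>?E. \<forall>\<sigma>\<ge>\<sigma>\<^sub>0. eu (zeta \<psi> \<sigma>) \<in> Eu lam M J" using eu_zeta_Eu by blast
    show "?W = {(seg_add \<psi> (eu (zeta \<psi> \<sigma>)), \<sigma>) | \<psi> \<sigma>. \<psi> \<in> ?E \<and> Bnorm lam \<psi> < rad \<and> \<sigma>\<^sub>0 \<le> \<sigma>}
      \<inter> (Bspace lam M \<times> {\<sigma>\<^sub>0..})" by (rule W_loc_graph)
    \<comment> \<open>Differences of unstable components are again of the form \<open>eu\<close>,
      with norm at most the difference of the real coordinates, so the scalar estimates for
      \<open>zeta\<close> suffice here and in the next two items.\<close>
    show "\<forall>\<sigma>\<ge>\<sigma>\<^sub>0. \<exists>L. \<forall>\<psi>\<^sub>1\<in>?E. \<forall>\<psi>\<^sub>2\<in>?E.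
       Bnorm lam (seg_diff (eu (zeta \<psi>\<^sub>1 \<sigma>)) (eu (zeta \<psi>\<^sub>2 \<sigma>))) \<le> L * Bnorm lam (seg_diff \<psi>\<^sub>1 \<psi>\<^sub>2)"
    proof (intro allI impI exI ballI)
      fix \<sigma> \<psi>\<^sub>1 \<psi>\<^sub>2 assume "\<sigma>\<^sub>0 \<le> \<sigma>" "\<psi>\<^sub>1 \<in> ?E" "\<psi>\<^sub>2 \<in> ?E"
      then show "Bnorm lam (seg_diff (eu (zeta \<psi>\<^sub>1 \<sigma>)) (eu (zeta \<psi>\<^sub>2 \<sigma>)))
          \<le> 3 * exp (lam * \<sigma>) * Bnorm lam (seg_diff \<psi>\<^sub>1 \<psi>\<^sub>2)"
        unfolding seg_diff_eu by (intro order_trans[OF Bnorm_eu zeta_lipschitz])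
    qed
    show "\<forall>\<psi>\<in>?E. \<forall>\<sigma>\<ge>\<sigma>\<^sub>0. \<forall>\<epsilon>>0. \<exists>d>0. \<forall>\<sigma>'\<ge>\<sigma>\<^sub>0. \<bar>\<sigma>' - \<sigma>\<bar> < d \<longrightarrow>
       Bnorm lam (seg_diff (eu (zeta \<psi> \<sigma>')) (eu (zeta \<psi> \<sigma>))) < \<epsilon>"
      unfolding seg_diff_eu using zeta_continuous by (meson Bnorm_eu le_less_trans)
    show "\<forall>\<sigma>\<ge>\<sigma>\<^sub>0. \<forall>\<epsilon>>0. \<exists>\<rho>>0. \<forall>\<psi>\<in>?E. Bnorm lam \<psi> < \<rho> \<longrightarrow>
       Bnorm lam (seg_diff (eu (zeta \<psi> \<sigma>)) (eu (zeta (\<lambda>_. 0) \<sigma>))) \<le> \<epsilon> * Bnorm lam \<psi>"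
      unfolding seg_diff_eu using zeta_tangent by (meson Bnorm_eu order_trans)
    show "\<forall>\<beta>. 0 < \<beta> \<and> \<beta> < \<alpha> \<longrightarrow> (\<exists>N. \<forall>(\<phi>, \<sigma>)\<in>?W. \<forall>t\<ge>\<sigma>.
          Bnorm lam (mu f g h \<kappa> c t \<phi> \<sigma>) \<le> N * exp (- \<beta> * (t - \<sigma>)) * Bnorm lam \<phi>)"
    proof (intro allI impI)
      fix \<beta> assume "0 < \<beta> \<and> \<beta> < \<alpha>"
      then obtain N where N: "\<And>\<phi> \<sigma> t. (\<phi>, \<sigma>) \<in> ?W \<Longrightarrow> 0 \<le> t \<Longrightarrow>
          Bnorm lam (seg (soln \<sigma> \<phi>) t) \<le> N * exp (- \<beta> * t) * Bnorm lam \<phi>"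
        using W_loc_decay[of \<beta>] al by auto
      show "\<exists>N. \<forall>(\<phi>, \<sigma>)\<in>?W. \<forall>t\<ge>\<sigma>.
          Bnorm lam (mu f g h \<kappa> c t \<phi> \<sigma>) \<le> N * exp (- \<beta> * (t - \<sigma>)) * Bnorm lam \<phi>"
      proof (intro exI[of _ N] ballI, clarify)
        fix \<phi> \<sigma> t assume W: "(\<phi>, \<sigma>) \<in> ?W" and "\<sigma> \<le> t"
        then show "Bnorm lam (mu f g h \<kappa> c t \<phi> \<sigma>) \<le> N * exp (- \<beta> * (t - \<sigma>)) * Bnorm lam \<phi>"
          unfolding mu_eq[OF W_hist[OF W]] by (intro N) auto
      qed
    qed
    show "\<forall>(\<phi>, \<sigma>)\<in>?W. \<forall>t\<ge>\<sigma>. Pi_s J (mu f g h \<kappa> c t \<phi> \<sigma>) \<in> ?E \<longrightarrow> (mu f g h \<kappa> c t \<phi> \<sigma>, t) \<in> ?W"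
    proof clarify
      fix \<phi> \<sigma> t assume W: "(\<phi>, \<sigma>) \<in> ?W" and "\<sigma> \<le> t"
      then show "(mu f g h \<kappa> c t \<phi> \<sigma>, t) \<in> ?W"
        using W_loc_invariant[OF W, of "t - \<sigma>"] unfolding mu_eq[OF W_hist[OF W]] by simp
    qed
  qed
qed

end
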